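(* Let $n\ge1$. Consider a positive number $M>0$ and a regular solution $h$ of $\partial_t h+G(h)h=0$ defined on $[0,T]$. Then for any derivative $$D\in\{\partial_t,\partial_{x_1},\ldots,\partial_{x_n}\},$$ if, initially, $\sup_{x\in\mathbf{T}^n}Dh(0,x)\le M$, then, for all times $t\in[0,T]$, $$\sup_{x\in\mathbf{T}^n}Dh(t,x)\le M.$$
   Context: $\mathbf{T}^n$ is an $n$-dimensional torus; $\nabla=\nabla_x$. Dirichlet to Neumann operator: given $h:\mathbf{T}^n\to\mathbf{R}$, set $\Omega=\{(x,y)\in\mathbf{T}^n\times\mathbf{R}: y<h(x)\}$. For $\psi:\mathbf{T}^n\to\mathbf{R}$, its harmonic extension $\varphi$ is the unique (variational) solution of $\Delta_{x,y}\varphi=0$ in $\Omega$, $\varphi(x,h(x))=\psi(x)$, with $\nabla_{x,y}\varphi\in L^2(\Omega)$. Then $G(h)\psi(x)=(\partial_y\varphi)(x,h(x))-\nabla h(x)\cdot(\nabla\varphi)(x,h(x))$. When $h,\psi$ depend on time $t$, $G(h)\psi$ is computed at each fixed $t$. Regular solution on $[0,T]$: a solution $h$ of $\partial_t h+G(h)h=0$ such that, for some $s>n/2+1$, $h\in C^0([0,T];H^s(\mathbf{T}^n))\cap C^1([0,T];H^{s-1}(\mathbf{T}^n))\cap L^2([0,T];H^{s+1/2}(\mathbf{T}^n))$ and $h\in C^\infty((0,T]\times\mathbf{T}^n)$. *)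

theory Defs
  imports "HOL-Analysis.Analysis"
begin

text \<open>
  The torus is \<open>(\<real> / 2\<pi>\<int>)\<^sup>n\<close> with \<open>n = CARD('n)\<close>; a function on it is a function on
  \<open>real^'n\<close> that is \<open>2\<pi>\<close>-periodic in every coordinate.
\<close>

definition periodic :: "(real^'n \<Rightarrow> real) \<Rightarrow> bool" where
  "periodic f \<longleftrightarrow> (\<forall>x i. f (x + axis i (2 * pi)) = f x)"

definition torus_cell :: "(real^'n) set" where
  "torus_cell = cbox 0 (\<chi> i. 2 * pi)"

definition partial :: "'n \<Rightarrow> (real^'n \<Rightarrow> real) \<Rightarrow> real^'n \<Rightarrow> real" where
  "partial i f x = deriv (\<lambda>r. f (x + r *\<^sub>R axis i 1)) 0"

definition grad :: "(real^'n \<Rightarrow> real) \<Rightarrow> real^'n \<Rightarrow> real^'n" where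
  "grad f x = (\<chi> i. partial i f x)"

text \<open>
  Derivatives in \<open>Ck_on\<close> are relative to \<open>S\<close>. Every \<open>S\<close> used below is open or of the form
  \<open>{0<..T} \<times> UNIV\<close> with \<open>0 < T\<close>, so these derivatives are unique.
\<close>

primrec Ck_on :: "nat \<Rightarrow> ('a::euclidean_space \<Rightarrow> real) \<Rightarrow> 'a set \<Rightarrow> bool" where
  "Ck_on 0 f S \<longleftrightarrow> continuous_on S f"
| "Ck_on (Suc k) f S \<longleftrightarrow>
     (\<exists>f'. (\<forall>z\<in>S. (f has_derivative f' z) (at z within S)) \<and> (\<forall>v. Ck_on k (\<lambda>z. f' z v) S))"

definition smooth_on :: "('a::euclidean_space \<Rightarrow> real) \<Rightarrow> 'a set \<Rightarrow> bool" where
  "smooth_on f S \<longleftrightarrow> (\<forall>k. Ck_on k f S)"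

definition laplacian :: "('a::euclidean_space \<Rightarrow> real) \<Rightarrow> 'a \<Rightarrow> real" where
  "laplacian f z =
     (\<Sum>b\<in>Basis. frechet_derivative (\<lambda>w. frechet_derivative f (at w) b) (at z) b)"


subsection \<open>The Dirichlet to Neumann operator\<close>

definition fluid_domain :: "(real^'n \<Rightarrow> real) \<Rightarrow> ((real^'n) \<times> real) set" where
  "fluid_domain h = {(x, y). y < h x}"

text \<open>
  The variational solution is smooth inside the domain and, for continuous data, continuous up to
  the boundary, so the equation and the boundary condition are stated classically; what singles it
  out among classical solutions is the finite Dirichlet energy over one period.
  The values of \<open>\<phi>\<close> outside the closure of the domain are irrelevant.
\<close>

definition harmonic_extension ::
    "(real^'n \<Rightarrow> real) \<Rightarrow> (real^'n \<Rightarrow> real) \<Rightarrow> ((real^'n) \<times> real \<Rightarrow> real) \<Rightarrow> bool" where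
  "harmonic_extension h \<psi> \<phi> \<longleftrightarrow>
     (\<forall>(x, y) \<in> closure (fluid_domain h). \<forall>i. \<phi> (x + axis i (2 * pi), y) = \<phi> (x, y)) \<and>
     Ck_on 2 \<phi> (fluid_domain h) \<and>
     continuous_on (closure (fluid_domain h)) \<phi> \<and>
     (\<forall>z \<in> fluid_domain h. laplacian \<phi> z = 0) \<and>
     (\<forall>x. \<phi> (x, h x) = \<psi> x) \<and>
     set_integrable lebesgue (fluid_domain h \<inter> torus_cell \<times> UNIV)
       (\<lambda>z. \<Sum>b\<in>Basis. (frechet_derivative \<phi> (at z) b)\<^sup>2)"

text \<open>
  \<open>has_dirichlet_neumann h \<psi> g\<close> means that \<open>G(h)\<psi>\<close> is defined pointwise and equals \<open>g\<close>. The
  derivatives of \<open>\<phi>\<close> on the boundary are those relative to the closed fluid domain: \<open>L (0, 1)\<close> is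
  \<open>\<partial>\<^sub>y\<phi>(x, h x)\<close> and \<open>L (axis i 1, 0)\<close> is \<open>\<partial>\<^sub>i\<phi>(x, h x)\<close>.
\<close>

definition has_dirichlet_neumann ::
    "(real^'n \<Rightarrow> real) \<Rightarrow> (real^'n \<Rightarrow> real) \<Rightarrow> (real^'n \<Rightarrow> real) \<Rightarrow> bool" where
  "has_dirichlet_neumann h \<psi> g \<longleftrightarrow>
     (\<exists>\<phi>. harmonic_extension h \<psi> \<phi> \<and>
       (\<forall>x. \<exists>L. (\<phi> has_derivative L) (at (x, h x) within closure (fluid_domain h)) \<and>
          g x = L (0, 1) - grad h x \<bullet> (\<chi> i. L (axis i 1, 0))))"


subsection \<open>Sobolev spaces on the torus\<close>

definition fourier_coeff :: "(real^'n \<Rightarrow> real) \<Rightarrow> int^'n \<Rightarrow> complex" where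
  "fourier_coeff f k =
     (LINT x:torus_cell|lebesgue. f x *\<^sub>R cis (- (\<Sum>i\<in>UNIV. of_int (k $ i) * x $ i)))
       / of_real ((2 * pi) ^ CARD('n))"

definition sobolev_term :: "real \<Rightarrow> (real^'n \<Rightarrow> real) \<Rightarrow> int^'n \<Rightarrow> real" where
  "sobolev_term s f k =
     (1 + (\<Sum>i\<in>UNIV. (of_int (k $ i))\<^sup>2)) powr s * (cmod (fourier_coeff f k))\<^sup>2"

text \<open>Only orders \<open>s \<ge> 0\<close> occur, for which \<open>H\<^sup>s\<close> is a subspace of \<open>L\<^sup>2\<close>.\<close>

definition sobolev :: "real \<Rightarrow> (real^'n \<Rightarrow> real) set" where
  "sobolev s = {f. periodic f \<and> f \<in> borel_measurable lebesgue \<and>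
     set_integrable lebesgue torus_cell (\<lambda>x. (f x)\<^sup>2) \<and> sobolev_term s f summable_on UNIV}"

definition sobolev_norm :: "real \<Rightarrow> (real^'n \<Rightarrow> real) \<Rightarrow> real" where
  "sobolev_norm s f = sqrt (\<Sum>\<^sub>\<infinity>k. sobolev_term s f k)"

definition C0_sobolev :: "real \<Rightarrow> real \<Rightarrow> (real \<Rightarrow> real^'n \<Rightarrow> real) \<Rightarrow> bool" where
  "C0_sobolev T s u \<longleftrightarrow>
     (\<forall>t\<in>{0..T}. u t \<in> sobolev s) \<and>
     (\<forall>t\<in>{0..T}. ((\<lambda>\<tau>. sobolev_norm s (\<lambda>x. u \<tau> x - u t x)) \<longlongrightarrow> 0) (at t within {0..T}))"

definition C1_sobolev :: "real \<Rightarrow> real \<Rightarrow> (real \<Rightarrow> real^'n \<Rightarrow> real) \<Rightarrow> bool" where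
  "C1_sobolev T s u \<longleftrightarrow> C0_sobolev T s u \<and>
     (\<exists>u'. C0_sobolev T s u' \<and>
       (\<forall>t\<in>{0..T}. ((\<lambda>\<tau>. sobolev_norm s (\<lambda>x. (u \<tau> x - u t x) / (\<tau> - t) - u' t x)) \<longlongrightarrow> 0)
          (at t within {0..T})))"

text \<open>
  Since \<open>H\<^sup>s\<close> is separable, strong measurability of an \<open>H\<^sup>s\<close>-valued function is measurability of
  all its Fourier coefficients.
\<close>

definition L2_sobolev :: "real \<Rightarrow> real \<Rightarrow> (real \<Rightarrow> real^'n \<Rightarrow> real) \<Rightarrow> bool" where
  "L2_sobolev T s u \<longleftrightarrow>
     (\<forall>k. (\<lambda>t. fourier_coeff (u t) k) \<in> borel_measurable (lebesgue_on {0..T})) \<and>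
     (AE t in lebesgue_on {0..T}. u t \<in> sobolev s) \<and>
     integrable (lebesgue_on {0..T}) (\<lambda>t. (sobolev_norm s (u t))\<^sup>2)"


subsection \<open>Regular solutions\<close>

text \<open>The time derivative is one-sided at the endpoints \<open>0\<close> and \<open>T\<close>.\<close>

definition time_deriv :: "real \<Rightarrow> (real \<Rightarrow> real^'n \<Rightarrow> real) \<Rightarrow> real \<Rightarrow> real^'n \<Rightarrow> real" where
  "time_deriv T h t x = vector_derivative (\<lambda>\<tau>. h \<tau> x) (at t within {0..T})"

definition space_deriv :: "'n \<Rightarrow> (real \<Rightarrow> real^'n \<Rightarrow> real) \<Rightarrow> real \<Rightarrow> real^'n \<Rightarrow> real" where
  "space_deriv i h t x = partial i (h t) x"

text \<open>
  An element of \<open>H\<^sup>s\<close> with \<open>s > n/2 + 1\<close> has a unique continuous representative; the continuity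
  requirement on \<open>h t\<close> only selects it, so that pointwise derivatives make sense also at \<open>t = 0\<close>.
\<close>

definition regular_solution :: "real \<Rightarrow> (real \<Rightarrow> real^'n \<Rightarrow> real) \<Rightarrow> bool" where
  "regular_solution T h \<longleftrightarrow>
     (\<forall>t\<in>{0..T}. continuous_on UNIV (h t)) \<and>
     (\<exists>s > real CARD('n) / 2 + 1.
        C0_sobolev T s h \<and> C1_sobolev T (s - 1) h \<and> L2_sobolev T (s + 1/2) h) \<and>
     smooth_on (\<lambda>(t, x). h t x) ({0<..T} \<times> UNIV) \<and>
     (\<forall>t\<in>{0..T}. \<exists>g. has_dirichlet_neumann (h t) (h t) g \<and> (\<forall>x. time_deriv T h t x + g x = 0))"

end

theory Submission
  imports Defs
begin

text \<open>The equation does not change when the graph is translated horizontally or vertically, or when time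
  is shifted, and its solutions obey a comparison principle (\<open>comparison\<close>): an order between two
  solutions at the initial time persists. Compare \<open>h (t, x + r e\<^sub>i)\<close> with \<open>h (t, x) + M r\<close>. The two
  are ordered at time 0 because \<open>\<partial>\<^sub>i h \<le> M\<close> there, hence ordered at all times, and dividing by \<open>r\<close> gives
  \<open>\<partial>\<^sub>i h \<le> M\<close>. For the time derivative, compare \<open>h (t + r, x)\<close> with \<open>h (t, x) + (M + \<epsilon>) r\<close>; here the
  order at time 0 holds for small \<open>r\<close> because the difference quotients in time converge uniformly
  in \<open>x\<close>.

  For the comparison of \<open>h\<^sub>1\<close> and \<open>h\<^sub>2\<close>, raise \<open>h\<^sub>2\<close> by \<open>\<epsilon> (1 + t)\<close> and look at a first point of contact.
  There \<open>\<partial>\<^sub>t h\<^sub>1 \<ge> \<partial>\<^sub>t h\<^sub>2 + \<epsilon>\<close>. On the other hand (\<open>dirichlet_neumann_touching\<close>), the harmonic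
  extension \<open>\<phi>\<^sub>2\<close> lies above the height function \<open>y\<close> in its domain, so it lies above \<open>\<phi>\<^sub>1\<close> on the lower of
  the two graphs, hence everywhere below that graph by the maximum principle, while both agree at the
  point of contact. Differentiating into the fluid gives \<open>G(h\<^sub>1)h\<^sub>1 \<ge> G(h\<^sub>2)h\<^sub>2\<close> at the contact, that is,
  \<open>\<partial>\<^sub>t h\<^sub>1 \<le> \<partial>\<^sub>t h\<^sub>2\<close>, a contradiction: the term \<open>\<epsilon> t\<close> makes the first
  inequality strict, and the second one only takes the weak maximum principle.

  The domain is unbounded below, and the maximum principle there (\<open>harmonic_nonpos\<close>) has to come from
  the finite Dirichlet energy. Let \<open>J y\<close> be the integral over the slice at height \<open>y\<close> of \<open>\<gamma> (u - \<delta>)\<close>, where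
  \<open>\<gamma>\<close> is a smoothed square of the positive part, chosen so that \<open>\<surd>\<gamma>\<close> is convex. If \<open>u\<close> is harmonic and
  nonpositive on the graph, then \<open>\<surd>J\<close> is convex on the whole line and vanishes far up. Finite energy
  only allows linear growth of \<open>J\<close> at \<open>-\<infinity>\<close>, so \<open>J\<close> vanishes identically.

  At time 0 the solution is only controlled in Sobolev norms. The needed uniform convergence of
  \<open>h (t)\<close>, of \<open>\<partial>\<^sub>i h (t)\<close> and of \<open>(h (t) - h (0)) / t\<close> as \<open>t\<close> tends to 0 follows from the embedding of
  \<open>H\<^sup>s\<close> in the continuous functions for \<open>s > n / 2\<close> (\<open>sobolev_embedding\<close>). Its core is that the absolute
  sum of the Fourier coefficients bounds a continuous function
  (\<open>abs_le_sum_fourier_coeffs\<close>); this is seen by testing against powers of a nonnegative trigonometric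
  polynomial, which concentrate at its maximum.\<close>

section \<open>Periodic functions and integrals over a period cell\<close>

lemma line_derivative_shift:
  fixes g :: "'a::real_normed_vector \<Rightarrow> 'b::real_normed_vector"
  assumes "((\<lambda>s. g ((x + r *\<^sub>R e) + s *\<^sub>R e)) has_vector_derivative d) (at 0)"
  shows "((\<lambda>s. g (x + s *\<^sub>R e)) has_vector_derivative d) (at r within A)"
proof -
  have "((\<lambda>s. s - r) has_vector_derivative 1) (at r)"
    by (auto intro!: derivative_eq_intros)
  moreover have "((\<lambda>s. g ((x + r *\<^sub>R e) + s *\<^sub>R e)) has_vector_derivative d) (at (r - r))"
    using assms by simp
  ultimately have "((\<lambda>s. g ((x + r *\<^sub>R e) + s *\<^sub>R e)) \<circ> (\<lambda>s. s - r) has_vector_derivative 1 *\<^sub>R d) (at r)"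
    by (rule vector_diff_chain_at)
  moreover have "(\<lambda>s. g ((x + r *\<^sub>R e) + s *\<^sub>R e)) \<circ> (\<lambda>s. s - r) = (\<lambda>s. g (x + s *\<^sub>R e))"
    by (auto simp: algebra_simps)
  ultimately show ?thesis
    by (auto intro: has_vector_derivative_at_within)
qed

lemma torus_cell_eq: "(torus_cell :: (real^'n) set) = {x. \<forall>i. 0 \<le> x $ i \<and> x $ i \<le> 2 * pi}"
  by (auto simp: torus_cell_def mem_box_cart)

lemma compact_torus_cell: "compact (torus_cell :: (real^'n) set)"
  by (simp add: torus_cell_def)

lemma continuous_integrable_torus_cell:
  fixes g :: "real^'n \<Rightarrow> 'b::banach"
  assumes "continuous_on UNIV g"
  shows "g integrable_on torus_cell"
  unfolding torus_cell_def
  by (rule integrable_continuous) (use assms continuous_on_subset in blast)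

text \<open>Cut the shifted cell along the hyperplane where the \<open>i\<close>-th coordinate is \<open>2 \<pi>\<close> and move the part
  beyond it back by one period.\<close>

lemma integral_torus_cell_shift:
  fixes g :: "real^'n \<Rightarrow> 'b::euclidean_space"
  assumes per: "\<And>x. g (x + axis i (2 * pi)) = g x" and cont: "continuous_on UNIV g"
    and r: "0 \<le> r" "r \<le> 2 * pi"
  shows "integral torus_cell (\<lambda>x. g (x + r *\<^sub>R axis i 1)) = integral torus_cell g"
proof -
  define P :: "real^'n" where "P = (\<chi> j. 2 * pi)"
  define e :: "real^'n" where "e = axis i 1"
  have e: "e \<in> Basis" by (simp add: e_def axis_in_Basis_iff)
  have int: "g integrable_on cbox a b" for a b
    by (rule integrable_continuous) (use cont continuous_on_subset in blast)
  have cuts: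
    "cbox (r *\<^sub>R e) (P + r *\<^sub>R e) \<inter> {x. x \<bullet> e \<le> 2 * pi} = cbox (r *\<^sub>R e) P"
    "cbox (r *\<^sub>R e) (P + r *\<^sub>R e) \<inter> {x. x \<bullet> e \<ge> 2 * pi} = cbox ((2 * pi) *\<^sub>R e) (P + r *\<^sub>R e)"
    "cbox 0 P \<inter> {x. x \<bullet> e \<le> r} = cbox 0 (P + (r - 2 * pi) *\<^sub>R e)"
    "cbox 0 P \<inter> {x. x \<bullet> e \<ge> r} = cbox (r *\<^sub>R e) P"
  proof -
    have Pi: "P $ j = 2 * pi" and ei: "(c *\<^sub>R e) $ j = (if j = i then c else 0)" for j c
      by (simp_all add: P_def e_def axis_def)
    have xe: "x \<bullet> e = x $ i" for x :: "real^'n" by (simp add: e_def inner_axis)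
    note * = mem_box_cart xe vector_add_component Pi ei zero_index
    show "cbox (r *\<^sub>R e) (P + r *\<^sub>R e) \<inter> {x. x \<bullet> e \<le> 2 * pi} = cbox (r *\<^sub>R e) P"
      unfolding set_eq_iff Int_iff mem_Collect_eq * using r by (smt (verit, best))
    show "cbox (r *\<^sub>R e) (P + r *\<^sub>R e) \<inter> {x. x \<bullet> e \<ge> 2 * pi} = cbox ((2 * pi) *\<^sub>R e) (P + r *\<^sub>R e)"
      unfolding set_eq_iff Int_iff mem_Collect_eq * using r by (smt (verit, best))
    show "cbox 0 P \<inter> {x. x \<bullet> e \<le> r} = cbox 0 (P + (r - 2 * pi) *\<^sub>R e)"
      unfolding set_eq_iff Int_iff mem_Collect_eq * using r by (smt (verit, best))
    show "cbox 0 P \<inter> {x. x \<bullet> e \<ge> r} = cbox (r *\<^sub>R e) P"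
      unfolding set_eq_iff Int_iff mem_Collect_eq * using r by (smt (verit, best))
  qed
  have "integral torus_cell (\<lambda>x. g (x + r *\<^sub>R axis i 1)) = integral (cbox (r *\<^sub>R e) (P + r *\<^sub>R e)) g"
    using integral_shift_cbox[of "r *\<^sub>R e" "r *\<^sub>R e" "P + r *\<^sub>R e" g]
    by (simp add: torus_cell_def P_def e_def)
  also have "\<dots> = integral (cbox (r *\<^sub>R e) P) g + integral (cbox ((2 * pi) *\<^sub>R e) (P + r *\<^sub>R e)) g"
    using integral_split[OF int e, of "r *\<^sub>R e" "P + r *\<^sub>R e" "2 * pi"] by (simp only: cuts)
  also have "integral (cbox ((2 * pi) *\<^sub>R e) (P + r *\<^sub>R e)) g
      = integral (cbox 0 (P + (r - 2 * pi) *\<^sub>R e)) (\<lambda>x. g (x + (2 * pi) *\<^sub>R e))"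
    using integral_shift_cbox[of "(2 * pi) *\<^sub>R e" "(2 * pi) *\<^sub>R e" "P + r *\<^sub>R e" g]
    by (simp add: algebra_simps)
  also have "(\<lambda>x. g (x + (2 * pi) *\<^sub>R e)) = g"
  proof -
    have "(2 * pi) *\<^sub>R e = axis i (2 * pi)" by (simp add: e_def vec_eq_iff axis_def)
    then show ?thesis using per by simp
  qed
  also have "integral (cbox (r *\<^sub>R e) P) g + integral (cbox 0 (P + (r - 2 * pi) *\<^sub>R e)) g
      = integral (cbox 0 P) g"
    using integral_split[OF int e, of 0 P r] by (simp only: cuts) (simp add: add.commute)
  finally show ?thesis by (simp add: torus_cell_def P_def)
qed

text \<open>By the previous lemma the integral of \<open>g (x + r e\<^sub>i)\<close> is independent of \<open>r\<close>; differentiate under the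
  integral sign. This is the divergence theorem on the torus, one direction at a time.\<close>

lemma integral_torus_cell_derivative:
  fixes g g' :: "real^'n \<Rightarrow> 'b::euclidean_space"
  assumes per: "\<And>x. g (x + axis i (2 * pi)) = g x" and cont: "continuous_on UNIV g"
    and der: "\<And>x. ((\<lambda>r. g (x + r *\<^sub>R axis i 1)) has_vector_derivative g' x) (at 0)"
    and cont': "continuous_on UNIV g'"
  shows "integral torus_cell g' = 0"
proof -
  define F where "F r = integral torus_cell (\<lambda>x. g (x + r *\<^sub>R axis i 1))" for r
  have "(F has_vector_derivative integral torus_cell (\<lambda>x. g' (x + 0 *\<^sub>R axis i 1))) (at 0 within {0..1})"
    unfolding F_def torus_cell_def
  proof (rule leibniz_rule_vector_derivative)
    show "((\<lambda>s. g (t + s *\<^sub>R axis i 1)) has_vector_derivative g' (t + s *\<^sub>R axis i 1)) (at s within {0..1})"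
      for s t
      by (rule line_derivative_shift, rule der)
    show "(\<lambda>x. g (x + s *\<^sub>R axis i 1)) integrable_on cbox 0 (\<chi> i. 2 * pi)" for s
      by (intro integrable_continuous continuous_on_compose2[OF cont] continuous_intros) auto
    show "continuous_on ({0..1} \<times> cbox 0 (\<chi> i. 2 * pi)) (\<lambda>(s, t). g' (t + s *\<^sub>R axis i 1))"
      unfolding split_beta by (intro continuous_on_compose2[OF cont'] continuous_intros) auto
  qed auto
  moreover have "F s = F 0" if "s \<in> {0..1}" for s
  proof -
    have "s \<le> 2 * pi" using that pi_gt3 by (simp)
    then show ?thesis using that integral_torus_cell_shift[OF per cont, of s]
      by (simp add: F_def)
  qed
  then have "(F has_vector_derivative 0) (at 0 within {0..1})"
    by (rule has_vector_derivative_transform[OF _ _ has_vector_derivative_const[of "F 0"], rotated]) simp_all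
  ultimately have "integral torus_cell (\<lambda>x. g' (x + 0 *\<^sub>R axis i 1)) = 0"
    by (intro vector_derivative_unique_within[of 0 "{0..1}" F]) (simp_all add: trivial_limit_within)
  then show ?thesis by simp
qed

lemma axis_as_scaleR: "axis i (c::real) = c *\<^sub>R axis i 1"
  by (simp add: vec_eq_iff axis_def)

text \<open>One point of the cell serves all periodic functions at once, so that suprema over the torus become
  suprema over a compact set.\<close>

lemma reduce_to_torus_cell:
  fixes x :: "real^'n"
  shows "\<exists>x'\<in>torus_cell. \<forall>f. periodic f \<longrightarrow> f x' = f x"
proof -
  define k where "k i = - \<lfloor>x $ i / (2 * pi)\<rfloor>" for i
  define x' where "x' = x + (\<Sum>i\<in>UNIV. of_int (k i) *\<^sub>R axis i (2 * pi))"
  have comp: "x' $ i = x $ i + of_int (k i) * (2 * pi)" for i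
    by (simp add: x'_def axis_def if_distrib sum.delta cong: if_cong)
  have "x' \<in> torus_cell"
    unfolding torus_cell_eq
  proof safe
    fix i
    have "of_int \<lfloor>x $ i / (2 * pi)\<rfloor> * (2 * pi) \<le> x $ i"
         "x $ i < (of_int \<lfloor>x $ i / (2 * pi)\<rfloor> + 1) * (2 * pi)"
      by (rule floor_divide_lower floor_divide_upper, simp)+
    then show "0 \<le> x' $ i" "x' $ i \<le> 2 * pi" unfolding comp k_def by (simp_all add: algebra_simps)
  qed
  moreover have "f x' = f x" if "periodic f" for f
  proof -
    have per: "f (x + axis i (2 * pi)) = f x" for x i using that by (simp add: periodic_def)
    have nat: "f (z + of_nat m *\<^sub>R axis i (2 * pi)) = f z" for z i m
    proof (induction m)
      case (Suc m)
      have "z + of_nat (Suc m) *\<^sub>R axis i (2 * pi) = (z + of_nat m *\<^sub>R axis i (2 * pi)) + axis i (2 * pi)"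
        by (simp add: algebra_simps)
      then show ?case using per Suc by metis
    qed simp
    have int: "f (z + of_int m *\<^sub>R axis i (2 * pi)) = f z" for z i m
    proof (cases "m \<ge> 0")
      case True then show ?thesis using nat[of z "nat m" i] by simp
    next
      case False then show ?thesis
        using nat[of "z + of_int m *\<^sub>R axis i (2 * pi)" "nat (- m)" i] by (simp add: algebra_simps)
    qed
    have "f (x + (\<Sum>i\<in>A. of_int (k i) *\<^sub>R axis i (2 * pi))) = f x" if "finite A" for A
      using that
    proof induction
      case (insert i A)
      have "x + (\<Sum>i\<in>insert i A. of_int (k i) *\<^sub>R axis i (2 * pi))
         = (x + (\<Sum>i\<in>A. of_int (k i) *\<^sub>R axis i (2 * pi))) + of_int (k i) *\<^sub>R axis i (2 * pi)"
        using insert by (simp add: algebra_simps)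
      then show ?case by (simp only: int insert.IH)
    qed simp
    then show ?thesis by (simp add: x'_def)
  qed
  ultimately show ?thesis by blast
qed

section \<open>A maximum principle in an unbounded periodic domain\<close>

text \<open>The inequality between \<open>J1\<close> and \<open>J2\<close> says that \<open>\<surd>J\<close> is convex where \<open>J\<close> is positive. A convex function
  that is positive somewhere and vanishes for large \<open>y\<close> grows at least linearly at \<open>-\<infinity>\<close>, and then \<open>J\<close>
  grows quadratically.\<close>

lemma nonneg_with_convex_sqrt_zero:
  fixes J :: "real \<Rightarrow> real"
  assumes J: "\<And>y. (J has_real_derivative J1 y) (at y)"
    and J1: "\<And>y. (J1 has_real_derivative J2 y) (at y)"
    and nonneg: "\<And>y. J y \<ge> 0" and convex: "\<And>y. J2 y \<ge> 0"
    and sqrt_convex: "\<And>y. (J1 y)\<^sup>2 \<le> 2 * J y * J2 y"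
    and zero: "\<And>y. y \<ge> Y \<Longrightarrow> J y = 0"
    and growth: "\<And>y. y \<le> Y0 \<Longrightarrow> J y \<le> C * (1 + \<bar>y\<bar>)"
  shows "J y = 0"
proof (rule ccontr)
  assume "J y \<noteq> 0"
  then have pos: "J y > 0" using nonneg[of y] by simp
  then have "y < Y" using zero[of y] by force
  have J1_mono: "J1 a \<le> J1 b" if "a \<le> b" for a b
    using DERIV_nonneg_imp_nondecreasing[OF that] J1 convex by blast
  have J1_flat: "J1 a = 0" if "a > Y" for a
  proof (rule DERIV_unique[OF J])
    show "(J has_real_derivative 0) (at a)"
      by (rule has_field_derivative_transform_within_open[of "\<lambda>_. 0" _ _ "{Y<..}"])
         (use that zero in auto)
  qed
  have J1_nonpos: "J1 a \<le> 0" for a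
    using J1_mono[of a "max a Y + 1"] J1_flat[of "max a Y + 1"] by auto
  have J_anti: "J b \<le> J a" if "a \<le> b" for a b
    using DERIV_nonpos_imp_nonincreasing[OF that] J J1_nonpos by blast
  obtain \<xi> where \<xi>: "y < \<xi>" "\<xi> < Y" "J Y - J y = (Y - y) * J1 \<xi>"
    using MVT2[OF \<open>y < Y\<close>, of J J1] J by auto
  have "(Y - y) * J1 \<xi> < 0" using \<xi>(3) zero[of Y] pos by simp
  then have neg: "J1 \<xi> < 0" using \<open>y < Y\<close> by (simp add: mult_less_0_iff)
  have "J \<xi> \<noteq> 0" using sqrt_convex[of \<xi>] neg by auto
  then have pos': "J z > 0" if "z \<le> \<xi>" for z
    using nonneg[of \<xi>] J_anti[OF that] by linarith
  \<comment> \<open>Twice the derivative of \<open>\<surd>J\<close>; it is nondecreasing and negative at \<open>\<xi>\<close>.\<close>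
  define R where "R z = J1 z / sqrt (J z)" for z
  define a where "a = - R \<xi> / 2"
  have "a > 0" using neg pos'[of \<xi>] by (simp add: a_def R_def divide_neg_pos)
  have R_mono: "R z \<le> R \<xi>" if "z \<le> \<xi>" for z
  proof (rule DERIV_nonneg_imp_nondecreasing[OF that])
    fix x assume "z \<le> x" "x \<le> \<xi>"
    define s where "s = sqrt (J x)"
    have s: "s > 0" "s * s = J x" using pos'[OF \<open>x \<le> \<xi>\<close>] by (auto simp: s_def)
    have "(R has_real_derivative (J2 x * s - J1 x * (J1 x / (2 * s))) / (s * s)) (at x)"
      unfolding R_def s_def using pos'[OF \<open>x \<le> \<xi>\<close>]
      by (auto intro!: derivative_eq_intros J J1 simp: field_simps)
    moreover have "J1 x * (J1 x / (2 * s)) \<le> J2 x * s"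
    proof -
      have "(J1 x)\<^sup>2 \<le> (J2 x * s) * (2 * s)"
        using sqrt_convex[of x] unfolding s(2)[symmetric] by (simp add: mult_ac)
      then have "(J1 x)\<^sup>2 / (2 * s) \<le> J2 x * s"
        using s(1) by (simp add: divide_le_eq)
      then show ?thesis by (simp add: power2_eq_square)
    qed
    ultimately show "\<exists>y. (R has_real_derivative y) (at x) \<and> 0 \<le> y"
      using s(1) by (meson diff_ge_0_iff_ge divide_nonneg_pos mult_pos_pos)
  qed
  have lower: "a * (\<xi> - z) \<le> sqrt (J z)" if "z \<le> \<xi>" for z
  proof -
    have "sqrt (J \<xi>) + a * \<xi> \<le> sqrt (J z) + a * z"
    proof (rule DERIV_nonpos_imp_nonincreasing[OF that])
      fix x assume "z \<le> x" "x \<le> \<xi>"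
      have "((\<lambda>z. sqrt (J z) + a * z) has_real_derivative R x / 2 + a) (at x)"
        unfolding R_def using pos'[OF \<open>x \<le> \<xi>\<close>]
        by (auto intro!: derivative_eq_intros J simp: field_simps)
      then show "\<exists>y. ((\<lambda>z. sqrt (J z) + a * z) has_real_derivative y) (at x) \<and> y \<le> 0"
        using R_mono[OF \<open>x \<le> \<xi>\<close>] by (auto simp: a_def)
    qed
    moreover have "0 \<le> sqrt (J \<xi>)" using nonneg by simp
    ultimately show ?thesis unfolding right_diff_distrib by linarith
  qed
  define K where "K = \<bar>C\<bar> * (2 + \<bar>\<xi>\<bar>)"
  define s where "s = max 1 (max (\<xi> - Y0) (K / a\<^sup>2 + 1))"
  have s: "s \<ge> 1" "\<xi> - s \<le> Y0" "s > K / a\<^sup>2"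
    unfolding s_def by auto
  have "(a * s)\<^sup>2 \<le> (sqrt (J (\<xi> - s)))\<^sup>2"
    using lower[of "\<xi> - s"] s \<open>a > 0\<close> by (intro power_mono) auto
  also have "\<dots> = J (\<xi> - s)" using nonneg by simp
  also have "\<dots> \<le> C * (1 + \<bar>\<xi> - s\<bar>)" using growth s by simp
  also have "\<dots> \<le> \<bar>C\<bar> * (1 + \<bar>\<xi> - s\<bar>)" by (intro mult_right_mono) auto
  also have "\<dots> \<le> \<bar>C\<bar> * ((2 + \<bar>\<xi>\<bar>) * s)"
  proof (intro mult_left_mono)
    have "\<bar>\<xi>\<bar> \<le> \<bar>\<xi>\<bar> * s" using s mult_left_mono[of 1 s "\<bar>\<xi>\<bar>"] by simp
    then show "1 + \<bar>\<xi> - s\<bar> \<le> (2 + \<bar>\<xi>\<bar>) * s" using s by (simp add: algebra_simps)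
  qed auto
  finally have "a\<^sup>2 * s * s \<le> K * s" by (simp add: K_def power2_eq_square mult_ac)
  then have "a\<^sup>2 * s \<le> K" using s by simp
  then show False using s(3) \<open>a > 0\<close> by (simp add: field_simps)
qed

text \<open>The witness is \<open>r\<^sup>3 / (1 + r)\<close> for positive \<open>r\<close>: it is cubic at 0, hence twice continuously
  differentiable, and quadratic at infinity. The last property says that its square root is convex;
  that property passes to slice integrals.\<close>

lemma smooth_hinge_exists:
  obtains \<gamma> \<gamma>1 \<gamma>2 :: "real \<Rightarrow> real" where
    "\<And>r. (\<gamma> has_real_derivative \<gamma>1 r) (at r)" "\<And>r. (\<gamma>1 has_real_derivative \<gamma>2 r) (at r)"
    "continuous_on UNIV \<gamma>2" "\<And>r. r \<le> 0 \<Longrightarrow> \<gamma> r = 0 \<and> \<gamma>1 r = 0 \<and> \<gamma>2 r = 0"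
    "\<And>r. r > 0 \<Longrightarrow> \<gamma> r > 0" "\<And>r. 0 \<le> \<gamma> r" "\<And>r. \<gamma> r \<le> (max 0 r)\<^sup>2" "\<And>r. 0 \<le> \<gamma>2 r"
    "\<And>r. (\<gamma>1 r)\<^sup>2 \<le> 2 * \<gamma> r * \<gamma>2 r"
proof
  define q :: "real \<Rightarrow> real" where "q r = max 0 r" for r
  define \<gamma> where "\<gamma> r = (q r)^3 / (1 + q r)" for r
  define \<gamma>1 where "\<gamma>1 r = (3 * (q r)^2 + 2 * (q r)^3) / (1 + q r)^2" for r
  define \<gamma>2 where "\<gamma>2 r = (6 * q r + 6 * (q r)^2 + 2 * (q r)^3) / (1 + q r)^3" for r
  have q: "q r \<ge> 0" for r by (simp add: q_def)
  have near0: "(f has_real_derivative 0) (at 0)"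
    if f: "\<And>r. \<bar>f r\<bar> \<le> 5 * r\<^sup>2" for f :: "real \<Rightarrow> real"
    unfolding DERIV_def
  proof (rule Lim_null_comparison[of _ "\<lambda>r. 5 * \<bar>r\<bar>"])
    have "f 0 = 0" using f[of 0] by simp
    then have "norm ((f (0 + r) - f 0) / r) \<le> 5 * \<bar>r\<bar>" for r
      using f[of r] by (cases "r = 0") (auto simp: abs_divide divide_le_eq power2_eq_square abs_mult)
    then show "\<forall>\<^sub>F r in at 0. norm ((f (0 + r) - f 0) / r) \<le> 5 * \<bar>r\<bar>" by (simp add: eventually_mono)
    show "((\<lambda>r. 5 * \<bar>r\<bar>) \<longlongrightarrow> 0) (at (0::real))"
      by (auto intro!: tendsto_eq_intros)
  qed
  have bound: "\<bar>\<gamma> r\<bar> \<le> 5 * r\<^sup>2" "\<bar>\<gamma>1 r\<bar> \<le> 5 * r\<^sup>2" for r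
  proof -
    have "q r ^ 3 \<le> q r ^ 2 * (1 + q r)" "3 * q r ^ 2 + 2 * q r ^ 3 \<le> 5 * q r ^ 2 * (1 + q r)^2"
      using q[of r] by (auto simp: power2_eq_square power3_eq_cube algebra_simps intro!: add_nonneg_nonneg mult_nonneg_nonneg)
    moreover have "q r ^ 2 \<le> r^2" by (auto simp: q_def max_def)
    ultimately show "\<bar>\<gamma> r\<bar> \<le> 5 * r\<^sup>2" "\<bar>\<gamma>1 r\<bar> \<le> 5 * r\<^sup>2"
      unfolding \<gamma>_def \<gamma>1_def using q[of r]
      by (auto simp: divide_le_eq mult_ac elim!: order_trans intro!: mult_right_mono)
  qed
  have der: "(\<gamma> has_real_derivative \<gamma>1 r) (at r) \<and> (\<gamma>1 has_real_derivative \<gamma>2 r) (at r)" for r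
  proof -
    consider "r < 0" | "r = 0" | "r > 0" by linarith
    then show ?thesis
    proof cases
      case 1
      have "(f has_real_derivative 0) (at r)" if "\<And>x. x < 0 \<Longrightarrow> f x = 0" for f :: "real \<Rightarrow> real"
        using has_field_derivative_transform_within_open[of "\<lambda>_. 0" 0 r "{..<0}" f] that 1 by simp
      then have "(\<gamma> has_real_derivative 0) (at r)" "(\<gamma>1 has_real_derivative 0) (at r)"
        by (simp_all add: \<gamma>_def \<gamma>1_def q_def)
      then show ?thesis using 1 by (simp add: \<gamma>1_def \<gamma>2_def q_def)
    next
      case 2
      then show ?thesis using near0[of \<gamma>] near0[of \<gamma>1] bound by (simp add: \<gamma>1_def \<gamma>2_def q_def)
    next
      case 3
      have "((\<lambda>r. r^3 / (1 + r)) has_real_derivative (3 * r^2 + 2 * r^3) / (1 + r)^2) (at r)"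
        using 3 by (auto intro!: derivative_eq_intros simp: divide_simps) (simp add: power2_eq_square power3_eq_cube algebra_simps)
      moreover have "((\<lambda>r. (3 * r^2 + 2 * r^3) / (1 + r)^2) has_real_derivative
         (6 * r + 6 * r^2 + 2 * r^3) / (1 + r)^3) (at r)"
        using 3 by (auto intro!: derivative_eq_intros simp: divide_simps) (simp add: eval_nat_numeral algebra_simps)
      moreover have "(f has_real_derivative d) (at r)"
        if "(f' has_real_derivative d) (at r)" "\<And>x. x > 0 \<Longrightarrow> f' x = f x" for f f' d
        using has_field_derivative_transform_within_open[OF that(1), of "{0<..}" f] that(2) 3 by simp
      ultimately have "(\<gamma> has_real_derivative (3 * r^2 + 2 * r^3) / (1 + r)^2) (at r)"
        "(\<gamma>1 has_real_derivative (6 * r + 6 * r^2 + 2 * r^3) / (1 + r)^3) (at r)"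
        by (simp_all add: \<gamma>_def \<gamma>1_def q_def)
      then show ?thesis using 3 by (simp add: \<gamma>1_def \<gamma>2_def q_def)
    qed
  qed
  show "(\<gamma> has_real_derivative \<gamma>1 r) (at r)" "(\<gamma>1 has_real_derivative \<gamma>2 r) (at r)" for r
    using der by auto
  show "continuous_on UNIV \<gamma>2"
    unfolding \<gamma>2_def q_def by (intro continuous_intros) (auto simp: max_def)
  show "\<gamma> r = 0 \<and> \<gamma>1 r = 0 \<and> \<gamma>2 r = 0" if "r \<le> 0" for r
    using that by (simp add: \<gamma>_def \<gamma>1_def \<gamma>2_def q_def)
  show "\<gamma> r > 0" if "r > 0" for r using that by (simp add: \<gamma>_def q_def)
  show "\<gamma> r \<ge> 0" "\<gamma>2 r \<ge> 0" for r
    using q[of r] by (auto simp: \<gamma>_def \<gamma>2_def intro!: divide_nonneg_nonneg add_nonneg_nonneg)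
  show "\<gamma> r \<le> (max 0 r)\<^sup>2" for r
    using q[of r] unfolding \<gamma>_def q_def[symmetric]
    by (simp add: divide_le_eq power2_eq_square power3_eq_cube algebra_simps)
  show "(\<gamma>1 r)\<^sup>2 \<le> 2 * \<gamma> r * \<gamma>2 r" for r
  proof -
    have "(3 * q r ^ 2 + 2 * q r ^ 3)^2 \<le> 2 * q r ^ 3 * (6 * q r + 6 * (q r)^2 + 2 * (q r)^3)"
      using q[of r] by (simp add: eval_nat_numeral algebra_simps)
    then show ?thesis
      using q[of r] by (simp add: \<gamma>_def \<gamma>1_def \<gamma>2_def power_divide divide_right_mono flip: power_mult power_Suc)
  qed
qed

text \<open>Derivatives are taken along coordinate lines only and are carried as data \<open>d\<close>, \<open>dd\<close>. Slice
  integrals see no other derivatives, and with this encoding translations, differences,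
  compositions and extensions by zero reduce to calculus in one variable.\<close>

definition line_C2 ::
  "'a::euclidean_space set \<Rightarrow> ('a \<Rightarrow> real) \<Rightarrow> ('a \<Rightarrow> 'a \<Rightarrow> real) \<Rightarrow> ('a \<Rightarrow> 'a \<Rightarrow> real) \<Rightarrow> bool" where
  "line_C2 S u d dd \<longleftrightarrow> continuous_on S u \<and>
     (\<forall>b\<in>Basis. continuous_on S (d b) \<and> continuous_on S (dd b) \<and>
       (\<forall>z\<in>S. ((\<lambda>r. u (z + r *\<^sub>R b)) has_real_derivative d b z) (at 0) \<and>
              ((\<lambda>r. d b (z + r *\<^sub>R b)) has_real_derivative dd b z) (at 0)))"

lemma line_C2_subset:
  "line_C2 S u d dd \<Longrightarrow> A \<subseteq> S \<Longrightarrow> line_C2 A u d dd"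
  unfolding line_C2_def by (meson continuous_on_subset subsetD)

lemma line_C2_compose:
  assumes u: "line_C2 S u d dd"
    and g: "\<And>r. (\<gamma> has_real_derivative \<gamma>1 r) (at r)" "\<And>r. (\<gamma>1 has_real_derivative \<gamma>2 r) (at r)"
    and g2: "continuous_on UNIV \<gamma>2"
  shows "line_C2 S (\<lambda>z. \<gamma> (u z)) (\<lambda>b z. \<gamma>1 (u z) * d b z)
           (\<lambda>b z. \<gamma>2 (u z) * (d b z)\<^sup>2 + \<gamma>1 (u z) * dd b z)"
proof -
  have [continuous_intros]: "continuous_on A (\<lambda>z. \<gamma> (f z))" "continuous_on A (\<lambda>z. \<gamma>1 (f z))"
    "continuous_on A (\<lambda>z. \<gamma>2 (f z))" if "continuous_on A f" for A :: "'a set" and f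
    using that g g2
    by (auto intro!: continuous_on_compose2[of UNIV _ A f] DERIV_continuous_on
        intro: has_field_derivative_at_within)
  have u': "continuous_on S u" "\<And>b. b \<in> Basis \<Longrightarrow> continuous_on S (d b)"
    "\<And>b. b \<in> Basis \<Longrightarrow> continuous_on S (dd b)"
    "\<And>b z. b \<in> Basis \<Longrightarrow> z \<in> S \<Longrightarrow> ((\<lambda>r. u (z + r *\<^sub>R b)) has_real_derivative d b z) (at 0)"
    "\<And>b z. b \<in> Basis \<Longrightarrow> z \<in> S \<Longrightarrow> ((\<lambda>r. d b (z + r *\<^sub>R b)) has_real_derivative dd b z) (at 0)"
    using u by (auto simp: line_C2_def)
  have ch: "((\<lambda>r. f (u (z + r *\<^sub>R b))) has_real_derivative f' (u z) * d b z) (at 0)"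
    if "\<And>r. (f has_real_derivative f' r) (at r)" "b \<in> Basis" "z \<in> S" for f f' b z
    using DERIV_chain2[OF _ u'(4)[OF that(2,3)], of f "f' (u z)"] that(1)[of "u z"] by simp
  show ?thesis
    unfolding line_C2_def
  proof (intro conjI ballI)
    fix b z :: 'a assume b: "b \<in> Basis" and z: "z \<in> S"
    show "((\<lambda>r. \<gamma> (u (z + r *\<^sub>R b))) has_real_derivative \<gamma>1 (u z) * d b z) (at 0)"
      by (rule ch[OF g(1) b z])
    show "((\<lambda>r. \<gamma>1 (u (z + r *\<^sub>R b)) * d b (z + r *\<^sub>R b)) has_real_derivative
        \<gamma>2 (u z) * (d b z)\<^sup>2 + \<gamma>1 (u z) * dd b z) (at 0)"
      using DERIV_mult[OF ch[OF g(2) b z] u'(5)[OF b z]] by (simp add: power2_eq_square algebra_simps)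
  qed (auto intro!: continuous_intros u')
qed

text \<open>The function vanishes off the closed set \<open>C\<close>, so near every point one of the open sets \<open>S\<close>, \<open>- C\<close> is
  available, and on the second everything is zero.\<close>

lemma line_C2_zero_extension:
  assumes u: "line_C2 S u d dd" and S: "open S" and C: "closed C" "C \<subseteq> S"
    and zero: "\<And>z b. z \<in> S - C \<Longrightarrow> u z = 0 \<and> d b z = 0 \<and> dd b z = 0"
  shows "line_C2 UNIV (\<lambda>z. if z \<in> S then u z else 0) (\<lambda>b z. if z \<in> S then d b z else 0)
           (\<lambda>b z. if z \<in> S then dd b z else 0)"
proof -
  have cover: "UNIV = S \<union> - C" and open_C: "open (- C)" using C by (auto simp: open_Compl)
  have cont: "continuous_on UNIV (\<lambda>z. if z \<in> S then f z else 0)"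
    if "continuous_on S f" "\<And>z. z \<in> S - C \<Longrightarrow> f z = 0" for f :: "'a \<Rightarrow> real"
  proof -
    have "continuous_on S (\<lambda>z. if z \<in> S then f z else 0)"
      by (subst continuous_on_cong[OF refl, of S _ f]) (use that in auto)
    moreover have "continuous_on (- C) (\<lambda>z. if z \<in> S then f z else 0)"
      by (subst continuous_on_cong[OF refl, of "- C" _ "\<lambda>_. 0"]) (use that in auto)
    ultimately show ?thesis
      unfolding cover by (intro continuous_on_open_Un S open_C)
  qed
  have der: "((\<lambda>r. (if z + r *\<^sub>R b \<in> S then f (z + r *\<^sub>R b) else 0)) has_real_derivative
      (if z \<in> S then f' z else 0)) (at 0)"
    if f: "z \<in> S \<Longrightarrow> ((\<lambda>r. f (z + r *\<^sub>R b)) has_real_derivative f' z) (at 0)"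
      and f0: "\<And>z. z \<in> S - C \<Longrightarrow> f z = 0" for f f' :: "'a \<Rightarrow> real" and b z
  proof (cases "z \<in> S")
    case True
    have o: "open ((\<lambda>r. z + r *\<^sub>R b) -` S)"
      by (intro open_vimage S continuous_intros)
    show ?thesis
      using has_field_derivative_transform_within_open[OF f[OF True] o] True by simp
  next
    case False
    have o: "open ((\<lambda>r. z + r *\<^sub>R b) -` (- C))"
      by (intro open_vimage open_C continuous_intros)
    have "0 \<in> (\<lambda>r. z + r *\<^sub>R b) -` (- C)" using False C by auto
    then have "((\<lambda>r. (if z + r *\<^sub>R b \<in> S then f (z + r *\<^sub>R b) else 0)) has_real_derivative 0) (at 0)"
      using has_field_derivative_transform_within_open[OF DERIV_const[of 0] o] f0 by simp
    then show ?thesis using False by simp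
  qed
  show ?thesis
    using u zero unfolding line_C2_def
    by (intro conjI ballI cont der) auto
qed

lemma basis_prod_sum:
  "(\<Sum>b\<in>Basis. f b) = (\<Sum>i\<in>UNIV. f (axis i 1, 0)) + f (0, 1)"
  for f :: "(real^'n) \<times> real \<Rightarrow> 'b::comm_monoid_add"
proof -
  have eq: "(Basis :: ((real^'n) \<times> real) set) = range (\<lambda>i. (axis i 1, 0)) \<union> {(0, 1)}"
    by (auto simp: Basis_prod_def Basis_vec_def)
  have "sum f Basis = sum f (range (\<lambda>i::'n. (axis i 1, 0))) + sum f {(0, 1)}"
    unfolding eq by (rule sum.union_disjoint) auto
  also have "sum f (range (\<lambda>i::'n. (axis i 1, 0))) = (\<Sum>i\<in>UNIV. f (axis i 1, 0))"
    by (subst sum.reindex) (auto simp: inj_on_def axis_eq_axis)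
  finally show ?thesis by simp
qed

lemma axis_basis_prod: "(axis i 1, 0) \<in> (Basis :: ((real^'n) \<times> real) set)"
  and vertical_basis_prod: "(0, 1) \<in> (Basis :: ((real^'n) \<times> real) set)"
  by (auto simp: Basis_prod_def axis_in_Basis_iff)

lemma slice_continuous:
  assumes "continuous_on (UNIV \<times> I) f" "y \<in> I"
  shows "continuous_on A (\<lambda>x. f (x, y))"
  by (rule continuous_on_compose2[OF assms(1)]) (use assms(2) in \<open>auto intro!: continuous_intros\<close>)

text \<open>In the second derivative the tangential terms \<open>dd (axis i 1, 0)\<close> are added for free, since they
  are derivatives of periodic functions and integrate to 0. Thus the second derivative of a slice
  integral is the slice integral of the Laplacian.\<close>

lemma slice_integral_derivatives:
  fixes B :: "(real^'n) \<times> real \<Rightarrow> real"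
  assumes B: "line_C2 (UNIV \<times> I) B d dd" and I: "open I" "convex I" and y: "y \<in> I"
    and per: "\<And>x y i. y \<in> I \<Longrightarrow> B (x + axis i (2 * pi), y) = B (x, y)"
  shows "((\<lambda>y. integral torus_cell (\<lambda>x. B (x, y))) has_real_derivative
            integral torus_cell (\<lambda>x. d (0, 1) (x, y))) (at y)"
    and "((\<lambda>y. integral torus_cell (\<lambda>x. d (0, 1) (x, y))) has_real_derivative
            integral torus_cell (\<lambda>x. \<Sum>b\<in>Basis. dd b (x, y))) (at y)"
proof -
  let ?P = "\<chi> i::'n. 2 * pi"
  have cont: "continuous_on (UNIV \<times> I) B"
    "\<And>b. b \<in> Basis \<Longrightarrow> continuous_on (UNIV \<times> I) (d b)" "\<And>b. b \<in> Basis \<Longrightarrow> continuous_on (UNIV \<times> I) (dd b)"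
    using B by (auto simp: line_C2_def)
  note int = slice_continuous[THEN integrable_continuous]
  have leib: "((\<lambda>y. integral torus_cell (\<lambda>x. f (x, y))) has_real_derivative
       integral torus_cell (\<lambda>x. f' (x, y))) (at y)"
    if f: "continuous_on (UNIV \<times> I) f" "continuous_on (UNIV \<times> I) f'"
      and der: "\<And>z. z \<in> UNIV \<times> I \<Longrightarrow> ((\<lambda>r. f (z + r *\<^sub>R (0, 1))) has_real_derivative f' z) (at 0)"
    for f f' :: "(real^'n) \<times> real \<Rightarrow> real"
  proof -
    have "((\<lambda>y. integral (cbox 0 ?P) (\<lambda>x. f (x, y))) has_real_derivative
       integral (cbox 0 ?P) (\<lambda>x. f' (x, y))) (at y within I)"
    proof (rule leibniz_rule_field_derivative)
      fix s t assume s: "s \<in> I"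
      have "((\<lambda>r. f ((t, 0) + r *\<^sub>R (0, 1))) has_vector_derivative f' (t, s)) (at s within I)"
        by (rule line_derivative_shift)
           (use der[of "(t, s)"] s in \<open>simp add: has_real_derivative_iff_has_vector_derivative\<close>)
      then show "((\<lambda>r. f (t, r)) has_real_derivative f' (t, s)) (at s within I)"
        by (simp add: has_real_derivative_iff_has_vector_derivative)
      show "(\<lambda>x. f (x, s)) integrable_on cbox 0 ?P"
        by (rule int[OF f(1) s])
    next
      show "continuous_on (I \<times> cbox 0 ?P) (\<lambda>(s, t). f' (t, s))"
        unfolding split_beta
        by (intro continuous_on_compose2[OF f(2)] continuous_intros) auto
    qed (use y I in auto)
    then show ?thesis
      unfolding torus_cell_def at_within_open[OF y I(1)] .
  qed
  show "((\<lambda>y. integral torus_cell (\<lambda>x. B (x, y))) has_real_derivative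
            integral torus_cell (\<lambda>x. d (0, 1) (x, y))) (at y)"
    by (rule leib[OF cont(1) cont(2)[OF vertical_basis_prod]])
       (use B vertical_basis_prod in \<open>auto simp: line_C2_def\<close>)
  have "((\<lambda>y. integral torus_cell (\<lambda>x. d (0, 1) (x, y))) has_real_derivative
            integral torus_cell (\<lambda>x. dd (0, 1) (x, y))) (at y)"
    by (rule leib[OF cont(2)[OF vertical_basis_prod] cont(3)[OF vertical_basis_prod]])
       (use B vertical_basis_prod in \<open>auto simp: line_C2_def\<close>)
  moreover have "integral torus_cell (\<lambda>x. dd (axis i 1, 0) (x, y)) = 0" for i
  proof (rule integral_torus_cell_derivative[where g = "\<lambda>x. d (axis i 1, 0) (x, y)" and i = i])
    let ?e = "(axis i 1, 0) :: (real^'n) \<times> real"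
    note e = axis_basis_prod[of i]
    have derB: "((\<lambda>r. B (x + r *\<^sub>R axis i 1, y)) has_real_derivative d ?e (x, y)) (at 0)"
     and derd: "((\<lambda>r. d ?e (x + r *\<^sub>R axis i 1, y)) has_real_derivative dd ?e (x, y)) (at 0)" for x
      using B e y unfolding line_C2_def by (auto dest!: bspec[of _ _ ?e])
    show "((\<lambda>r. d ?e (x + r *\<^sub>R axis i 1, y)) has_vector_derivative dd ?e (x, y)) (at 0)" for x
      using derd by (simp add: has_real_derivative_iff_has_vector_derivative)
    show "d ?e (x + axis i (2 * pi), y) = d ?e (x, y)" for x
    proof (rule DERIV_unique[OF derB])
      have "B (x + axis i (2 * pi) + r *\<^sub>R axis i 1, y) = B (x + r *\<^sub>R axis i 1, y)" for r
        using per[OF y, of "x + r *\<^sub>R axis i 1" i] by (simp add: algebra_simps)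
      then show "((\<lambda>r. B (x + axis i (2 * pi) + r *\<^sub>R axis i 1, y)) has_real_derivative d ?e (x, y)) (at 0)"
        using derB[of x] by simp
    qed
  qed (use slice_continuous cont axis_basis_prod y in blast)+
  then have "integral torus_cell (\<lambda>x. \<Sum>b\<in>Basis. dd b (x, y)) = integral torus_cell (\<lambda>x. dd (0, 1) (x, y))"
    unfolding basis_prod_sum torus_cell_def
    using int[OF cont(3)[OF axis_basis_prod] y] int[OF cont(3)[OF vertical_basis_prod] y]
    by (subst integral_add) (auto intro!: integrable_sum simp: integral_sum)
  ultimately show "((\<lambda>y. integral torus_cell (\<lambda>x. d (0, 1) (x, y))) has_real_derivative
            integral torus_cell (\<lambda>x. \<Sum>b\<in>Basis. dd b (x, y))) (at y)"
    by simp
qed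

lemma open_fluid_domain:
  assumes h: "continuous_on UNIV h"
  shows "open (fluid_domain h)"
  unfolding fluid_domain_def split_beta
  by (intro open_Collect_less continuous_on_compose2[OF h] continuous_on_fst continuous_on_snd
      continuous_on_id) auto

lemma closure_fluid_domain:
  assumes h: "continuous_on UNIV h"
  shows "closure (fluid_domain h) = {(x, y). y \<le> h x}"
proof
  show "closure (fluid_domain h) \<subseteq> {(x, y). y \<le> h x}"
  proof (rule closure_minimal)
    show "closed {(x, y). y \<le> h x}"
      unfolding split_beta
      by (intro closed_Collect_le continuous_on_compose2[OF h] continuous_on_fst continuous_on_snd
          continuous_on_id) auto
  qed (auto simp: fluid_domain_def)
  show "{(x, y). y \<le> h x} \<subseteq> closure (fluid_domain h)"
  proof clarify
    fix x y assume y: "y \<le> h x"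
    show "(x, y) \<in> closure (fluid_domain h)"
    proof (unfold closure_sequential, intro exI conjI allI)
      show "(x, y - inverse (real (Suc n))) \<in> fluid_domain h" for n
        using y by (simp add: fluid_domain_def) (smt (verit) of_nat_0_le_iff inverse_positive_iff_positive)
      have "(\<lambda>n. (x, y - inverse (real (Suc n)))) \<longlonglongrightarrow> (x, y - 0)"
        by (intro tendsto_Pair tendsto_const tendsto_diff LIMSEQ_inverse_real_of_nat)
      then show "(\<lambda>n. (x, y - inverse (real (Suc n)))) \<longlonglongrightarrow> (x, y)" by simp
    qed
  qed
qed

lemma periodic_continuous_bounded:
  fixes f :: "real^'n \<Rightarrow> real"
  assumes "continuous_on UNIV f" "periodic f"
  obtains K where "\<And>x. \<bar>f x\<bar> \<le> K"
proof -
  have "compact (f ` torus_cell)"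
    by (rule compact_continuous_image) (use assms compact_torus_cell continuous_on_subset in blast)+
  then obtain K where K: "\<And>z. z \<in> f ` torus_cell \<Longrightarrow> norm z \<le> K"
    using bounded_iff compact_imp_bounded by metis
  have "\<bar>f x\<bar> \<le> K" for x
    using reduce_to_torus_cell[of x] K assms(2) by (metis imageI real_norm_def)
  then show thesis using that by blast
qed

lemma line_C2_if_Ck_on_2:
  assumes u: "Ck_on 2 u S" and S: "open S"
  obtains d dd where "line_C2 S u d dd" "\<And>z. z \<in> S \<Longrightarrow> (\<Sum>b\<in>Basis. dd b z) = laplacian u z"
    "\<And>z b. z \<in> S \<Longrightarrow> d b z = frechet_derivative u (at z) b"
proof -
  obtain u' where u': "\<And>z. z \<in> S \<Longrightarrow> (u has_derivative u' z) (at z within S)"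
    "\<And>v. Ck_on 1 (\<lambda>z. u' z v) S"
    using u by (auto simp: numeral_2_eq_2)
  have "\<forall>v. \<exists>D. (\<forall>z\<in>S. ((\<lambda>z. u' z v) has_derivative D z) (at z within S)) \<and>
      (\<forall>w. continuous_on S (\<lambda>z. D z w))"
    using u'(2) by simp
  then obtain u'' where u'': "\<And>v z. z \<in> S \<Longrightarrow> ((\<lambda>z. u' z v) has_derivative u'' v z) (at z within S)"
    "\<And>v w. continuous_on S (\<lambda>z. u'' v z w)"
    by metis
  have at: "(u has_derivative u' z) (at z)" "((\<lambda>z. u' z v) has_derivative u'' v z) (at z)"
    if "z \<in> S" for z v
    using u'(1)[OF that] u''(1)[OF that] unfolding at_within_open[OF that S] by blast+
  have frechet: "frechet_derivative u (at z) = u' z" if "z \<in> S" for z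
    using frechet_derivative_at[OF at(1)[OF that]] by simp
  have line: "((\<lambda>r. f (z + r *\<^sub>R b)) has_real_derivative f' b) (at 0)"
    if "(f has_derivative f') (at z)" for f f' and b z :: 'a
  proof -
    have "((\<lambda>r. z + r *\<^sub>R b) has_derivative (\<lambda>r. r *\<^sub>R b)) (at (0::real))"
      by (auto intro!: derivative_eq_intros)
    then have "((\<lambda>r. f (z + r *\<^sub>R b)) has_derivative (\<lambda>r. f' (r *\<^sub>R b))) (at 0)"
      by (rule has_derivative_compose) (use that in simp)
    moreover have "(\<lambda>r. f' (r *\<^sub>R b)) = (*) (f' b)"
      using linear_scale[OF has_derivative_linear[OF that]] by (auto simp: mult.commute)
    ultimately show ?thesis by (simp add: has_field_derivative_def)
  qed
  show thesis
  proof
    show "line_C2 S u (\<lambda>b z. u' z b) (\<lambda>b z. u'' b z b)"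
      unfolding line_C2_def
    proof (intro conjI ballI)
      show "continuous_on S u" by (rule has_derivative_continuous_on[OF u'(1)])
      show "continuous_on S (\<lambda>z. u' z b)" for b by (rule has_derivative_continuous_on[OF u''(1)])
      show "continuous_on S (\<lambda>z. u'' b z b)" for b by (rule u''(2))
      fix b z assume z: "z \<in> S"
      show "((\<lambda>r. u (z + r *\<^sub>R b)) has_real_derivative u' z b) (at 0)" by (rule line[OF at(1)[OF z]])
      show "((\<lambda>r. u' (z + r *\<^sub>R b) b) has_real_derivative u'' b z b) (at 0)"
        by (rule line[OF at(2)[OF z]])
    qed
    show "u' z b = frechet_derivative u (at z) b" if "z \<in> S" for z b
      using frechet that by simp
    show "(\<Sum>b\<in>Basis. u'' b z b) = laplacian u z" if "z \<in> S" for z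
      unfolding laplacian_def
    proof (rule sum.cong)
      fix b :: 'a
      have "((\<lambda>w. frechet_derivative u (at w) b) has_derivative u'' b z) (at z)"
        by (rule has_derivative_transform_within_open[OF at(2)[OF that] S that]) (simp add: frechet)
      then show "u'' b z b = frechet_derivative (\<lambda>w. frechet_derivative u (at w) b) (at z) b"
        using frechet_derivative_at by metis
    qed simp
  qed
qed

lemma line_C2_diff:
  assumes "line_C2 S u d dd" "line_C2 S v e ee"
  shows "line_C2 S (\<lambda>z. u z - v z) (\<lambda>b z. d b z - e b z) (\<lambda>b z. dd b z - ee b z)"
  using assms unfolding line_C2_def by (auto intro!: continuous_intros DERIV_diff)

lemma line_C2_height:
  "line_C2 S (\<lambda>z :: (real^'n) \<times> real. snd z - c) (\<lambda>b z. snd b) (\<lambda>b z. 0)"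
  unfolding line_C2_def by (auto intro!: continuous_intros derivative_eq_intros)

lemma line_C2_translate:
  assumes "line_C2 S u d dd"
  shows "line_C2 {z. z + a \<in> S} (\<lambda>z. u (z + a)) (\<lambda>b z. d b (z + a)) (\<lambda>b z. dd b (z + a))"
proof -
  have [simp]: "continuous_on {z. z + a \<in> S} (\<lambda>z. f (z + a))" if "continuous_on S f" for f :: "'a \<Rightarrow> real"
    by (rule continuous_on_compose2[OF that]) (auto intro!: continuous_intros)
  have *: "z + r *\<^sub>R b + a = (z + a) + r *\<^sub>R b" for z b and r :: real by (simp add: algebra_simps)
  show ?thesis using assms unfolding line_C2_def * by auto
qed

text \<open>For \<open>\<delta> > 0\<close> the function \<open>\<gamma> (u - \<delta>)\<close> vanishes near the graph, so it extends by zero to the whole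
  space. Its slice integral \<open>J\<close> satisfies \<open>J1\<^sup>2 \<le> 2 J J2\<close> because its Laplacian is \<open>\<gamma>2 |\<nabla>u|\<^sup>2\<close>, and
  the growth condition rules out a nonzero \<open>J\<close>.\<close>

lemma harmonic_nonpos:
  fixes h :: "real^'n \<Rightarrow> real"
  assumes h: "continuous_on UNIV h" "periodic h"
    and u: "line_C2 (fluid_domain h) u d dd"
    and harmonic: "\<And>z. z \<in> fluid_domain h \<Longrightarrow> (\<Sum>b\<in>Basis. dd b z) = 0"
    and cont: "continuous_on {(x, y). y \<le> h x} u"
    and per: "\<And>x y i. y \<le> h x \<Longrightarrow> u (x + axis i (2 * pi), y) = u (x, y)"
    and boundary: "\<And>x. u (x, h x) \<le> 0"
    and growth: "\<And>y. y \<le> Y \<Longrightarrow> integral torus_cell (\<lambda>x. (max 0 (u (x, y)))\<^sup>2) \<le> C * (1 + \<bar>y\<bar>)"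
    and xy: "y \<le> h x"
  shows "u (x, y) \<le> 0"
proof (cases "y = h x")
  case False
  then have xy: "(x, y) \<in> fluid_domain h" using xy by (simp add: fluid_domain_def)
  obtain \<gamma> \<gamma>1 \<gamma>2 :: "real \<Rightarrow> real" where
    \<gamma>: "\<And>r. (\<gamma> has_real_derivative \<gamma>1 r) (at r)" "\<And>r. (\<gamma>1 has_real_derivative \<gamma>2 r) (at r)"
    "continuous_on UNIV \<gamma>2" and \<gamma>0: "\<And>r. r \<le> 0 \<Longrightarrow> \<gamma> r = 0 \<and> \<gamma>1 r = 0 \<and> \<gamma>2 r = 0"
    and \<gamma>_pos: "\<And>r. r > 0 \<Longrightarrow> \<gamma> r > 0" "\<And>r. 0 \<le> \<gamma> r" and \<gamma>_le: "\<And>r. \<gamma> r \<le> (max 0 r)\<^sup>2"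
    and \<gamma>2_nonneg: "\<And>r. 0 \<le> \<gamma>2 r" and \<gamma>_sqrt: "\<And>r. (\<gamma>1 r)\<^sup>2 \<le> 2 * \<gamma> r * \<gamma>2 r"
    using smooth_hinge_exists by metis
  obtain K where K: "\<And>x. \<bar>h x\<bar> \<le> K" using periodic_continuous_bounded[OF h] by metis
  have le_\<delta>: "u (x, y) \<le> \<delta>" if "\<delta> > 0" for \<delta>
  proof -
    define S where "S = fluid_domain h"
    define B where "B z = (if z \<in> S then \<gamma> (u z - \<delta>) else 0)" for z
    define B1 where "B1 b z = (if z \<in> S then \<gamma>1 (u z - \<delta>) * d b z else 0)" for b z
    define B2 where "B2 b z = (if z \<in> S then \<gamma>2 (u z - \<delta>) * (d b z)\<^sup>2 + \<gamma>1 (u z - \<delta>) * dd b z else 0)"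
      for b z
    \<comment> \<open>Closed in the whole space because \<open>u\<close> is continuous up to the graph, and inside the open domain because \<open>u \<le> 0\<close> on the graph.\<close>
    define Z where "Z = {z. case z of (x, y) \<Rightarrow> y \<le> h x} \<inter> u -` {\<delta>..}"
    have shift: "\<And>r. ((\<lambda>r. \<gamma> (r - \<delta>)) has_real_derivative \<gamma>1 (r - \<delta>)) (at r)"
      "\<And>r. ((\<lambda>r. \<gamma>1 (r - \<delta>)) has_real_derivative \<gamma>2 (r - \<delta>)) (at r)"
      by (auto intro!: DERIV_chain2[OF \<gamma>(1), THEN DERIV_cong] DERIV_chain2[OF \<gamma>(2), THEN DERIV_cong]
           derivative_eq_intros)
    have "continuous_on UNIV (\<lambda>r. \<gamma>2 (r - \<delta>))"
      by (rule continuous_on_compose2[OF \<gamma>(3)]) (auto intro!: continuous_intros)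
    note comp = line_C2_compose[OF u shift this, folded S_def]
    have closedZ: "closed Z"
      unfolding Z_def
      by (intro continuous_closed_preimage cont closed_atLeast)
         (use closure_fluid_domain[OF h(1)] closed_closure in metis)
    have "Z \<subseteq> S"
    proof
      fix z assume z: "z \<in> Z"
      obtain a b where ab: "z = (a, b)" by (cases z)
      have "b \<noteq> h a" using z boundary[of a] that by (auto simp: Z_def ab)
      then show "z \<in> S" using z by (auto simp: Z_def ab S_def fluid_domain_def)
    qed
    have small: "u z - \<delta> \<le> 0" if "z \<in> S - Z" for z
      using that by (auto simp: Z_def S_def fluid_domain_def)
    have B: "line_C2 UNIV B B1 B2"
      unfolding B_def[abs_def] B1_def[abs_def] B2_def[abs_def]
      by (rule line_C2_zero_extension[OF comp _ closedZ \<open>Z \<subseteq> S\<close>])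
         (use \<gamma>0 small open_fluid_domain[OF h(1)] in \<open>auto simp: S_def\<close>)
    then have B': "line_C2 (UNIV \<times> UNIV) B B1 B2" by simp
    have hper: "h (a + axis i (2 * pi)) = h a" for a i using h(2) by (simp add: periodic_def)
    have Bper: "B (a + axis i (2 * pi), b) = B (a, b)" for a b i
      using hper[of a i] per[of b a i] by (auto simp: B_def S_def fluid_domain_def)
    define J where "J b = integral torus_cell (\<lambda>a. B (a, b))" for b
    define J1 where "J1 b = integral torus_cell (\<lambda>a. B1 (0, 1) (a, b))" for b
    define J2 where "J2 b = integral torus_cell (\<lambda>a. \<Sum>e\<in>Basis. B2 e (a, b))" for b
    have J_der: "(J has_real_derivative J1 b) (at b)" "(J1 has_real_derivative J2 b) (at b)" for b
      unfolding J_def[abs_def] J1_def[abs_def] J2_def[abs_def]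
      using slice_integral_derivatives[OF B' open_UNIV convex_UNIV UNIV_I Bper] by auto
    have "continuous_on UNIV B" "continuous_on UNIV (B1 (0, 1))" "\<And>e. e \<in> Basis \<Longrightarrow> continuous_on UNIV (B2 e)"
      using B vertical_basis_prod by (auto simp: line_C2_def)
    then have contB: "continuous_on A (\<lambda>a. B (a, b))" "continuous_on A (\<lambda>a. B1 (0, 1) (a, b))"
      "continuous_on A (\<lambda>a. \<Sum>e\<in>Basis. B2 e (a, b))" for A b
      by (auto intro!: continuous_on_sum slice_continuous[of UNIV])
    note int = contB[THEN continuous_integrable_torus_cell]
    have sumB2: "(\<Sum>e\<in>Basis. B2 e z) = (if z \<in> S then \<gamma>2 (u z - \<delta>) * (\<Sum>e\<in>Basis. (d e z)\<^sup>2) else 0)" for z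
      using harmonic[of z] unfolding B2_def S_def
      by (simp add: sum.distrib flip: sum_distrib_left)
    have J_nonneg: "J b \<ge> 0" "J2 b \<ge> 0" for b
      unfolding J_def J2_def sumB2
      using int(1)[of b] int(3)[of b, unfolded sumB2] \<gamma>_pos(2) \<gamma>2_nonneg
      by (auto intro!: integral_nonneg mult_nonneg_nonneg sum_nonneg simp: B_def)
    \<comment> \<open>The integrand is nonnegative by the discriminant condition on \<open>\<gamma>\<close>; the discriminant
      of the integrated quadratic gives the condition on \<open>J\<close>.\<close>
    have quad: "0 \<le> J b + l * J1 b + l\<^sup>2 / 2 * J2 b" for l b
    proof -
      have "0 \<le> B z + l * B1 (0, 1) z + l\<^sup>2 / 2 * (\<Sum>e\<in>Basis. B2 e z)" for z
      proof (cases "z \<in> S")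
        case True
        define p where "p = l * d (0, 1) z"
        define g g1 g2 where "g = \<gamma> (u z - \<delta>)" "g1 = \<gamma>1 (u z - \<delta>)" "g2 = \<gamma>2 (u z - \<delta>)"
        note g = \<gamma>_pos(2)[of "u z - \<delta>"] \<gamma>2_nonneg[of "u z - \<delta>"] \<gamma>_sqrt[of "u z - \<delta>"]
        have "(d (0, 1) z)\<^sup>2 \<le> (\<Sum>e\<in>Basis. (d e z)\<^sup>2)"
          using member_le_sum[OF vertical_basis_prod, of "\<lambda>e. (d e z)\<^sup>2"] by simp
        then have "l\<^sup>2 / 2 * (g2 * (d (0, 1) z)\<^sup>2) \<le> l\<^sup>2 / 2 * (g2 * (\<Sum>e\<in>Basis. (d e z)\<^sup>2))"
          using g by (intro mult_left_mono) (auto simp: g_g1_g2_def)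
        moreover have "0 \<le> g + g1 * p + g2 * p\<^sup>2 / 2"
        proof (cases "g2 = 0")
          case True
          then have "g1 = 0" using g(3) by (simp add: g_g1_g2_def)
          then show ?thesis using True g(1) by (simp add: g_g1_g2_def)
        next
          case False
          then have "g2 > 0" using g(2) by (simp add: g_g1_g2_def)
          have "0 \<le> (g1 + g2 * p)\<^sup>2 + (2 * g * g2 - g1\<^sup>2)"
            using g(3) by (simp add: g_g1_g2_def)
          also have "\<dots> = 2 * g2 * (g + g1 * p + g2 * p\<^sup>2 / 2)"
            by (simp add: power2_eq_square algebra_simps)
          finally show ?thesis using \<open>g2 > 0\<close> by (simp add: zero_le_mult_iff)
        qed
        ultimately show ?thesis
          unfolding sumB2 using True by (simp add: B_def B1_def p_def g_g1_g2_def power_mult_distrib mult_ac)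
      qed (simp add: B_def B1_def sumB2)
      then have "0 \<le> integral torus_cell (\<lambda>a. B (a, b) + l * B1 (0, 1) (a, b) + l\<^sup>2 / 2 * (\<Sum>e\<in>Basis. B2 e (a, b)))"
        by (intro integral_nonneg continuous_integrable_torus_cell continuous_intros contB)
      also have "\<dots> = J b + l * J1 b + l\<^sup>2 / 2 * J2 b"
        unfolding J_def J1_def J2_def
        by (simp only: integral_add[OF integrable_add[OF int(1) integrable_on_mult_right[OF int(2)]]
              integrable_on_mult_right[OF int(3)]]
            integral_add[OF int(1) integrable_on_mult_right[OF int(2)]] integral_mult_right)
      finally show ?thesis .
    qed
    have J_sqrt: "(J1 b)\<^sup>2 \<le> 2 * J b * J2 b" for b
    proof (cases "J2 b = 0")
      case True
      have "J1 b = 0"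
      proof (rule ccontr)
        assume "J1 b \<noteq> 0"
        then show False using quad[of b "- (J b + 1) / J1 b"] True by simp
      qed
      then show ?thesis using True by simp
    next
      case False
      then have "J2 b > 0" using J_nonneg(2)[of b] by simp
      have "0 \<le> J b + (- J1 b / J2 b) * J1 b + (- J1 b / J2 b)\<^sup>2 / 2 * J2 b" by (rule quad)
      also have "\<dots> = (2 * J b * J2 b - (J1 b)\<^sup>2) / (2 * J2 b)"
        using \<open>J2 b > 0\<close> by (simp add: field_simps power2_eq_square)
      finally show ?thesis using \<open>J2 b > 0\<close> by (simp add: zero_le_divide_iff)
    qed
    have J_zero: "J b = 0" if "b \<ge> K + 1" for b
    proof -
      have "B (a, b) = 0" for a
        using that K[of a] by (auto simp: B_def S_def fluid_domain_def)
      then show ?thesis by (simp add: J_def)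
    qed
    have J_growth: "J b \<le> C * (1 + \<bar>b\<bar>)" if "b \<le> min Y (- K - 1)" for b
    proof -
      have inS: "(a, b) \<in> S" for a using that K[of a] by (auto simp: S_def fluid_domain_def)
      have "continuous_on UNIV (\<lambda>a. u (a, b))"
        using u inS unfolding line_C2_def S_def
        by (auto intro!: continuous_on_compose2[of "fluid_domain h" u] continuous_intros)
      then have "J b \<le> integral torus_cell (\<lambda>a. (max 0 (u (a, b)))\<^sup>2)"
        unfolding J_def
      proof (intro integral_le int continuous_integrable_torus_cell continuous_intros)
        fix a
        have "(max 0 (u (a, b) - \<delta>))\<^sup>2 \<le> (max 0 (u (a, b)))\<^sup>2"
          using \<open>\<delta> > 0\<close> by (intro power_mono) auto
        then have "\<gamma> (u (a, b) - \<delta>) \<le> (max 0 (u (a, b)))\<^sup>2"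
          using \<gamma>_le by (rule order_trans[rotated])
        then show "B (a, b) \<le> (max 0 (u (a, b)))\<^sup>2"
          unfolding B_def by simp
      qed
      then show ?thesis using growth that by fastforce
    qed
    have "J b = 0" for b
      by (rule nonneg_with_convex_sqrt_zero[OF J_der J_nonneg J_sqrt J_zero J_growth])
    then have "integral (cbox 0 (\<chi> i. 2 * pi)) (\<lambda>a. B (a, y)) = 0"
      by (simp add: J_def torus_cell_def)
    moreover have "B (a, y) \<ge> 0" for a using \<gamma>_pos(2) by (simp add: B_def)
    moreover have "box 0 (\<chi> i. 2 * pi) \<noteq> ({} :: (real^'n) set)" by (simp add: interval_ne_empty_cart)
    ultimately have B0: "\<forall>a\<in>torus_cell. B (a, y) = 0"
      unfolding torus_cell_def using integral_cbox_eq_0_iff[OF contB(1)] by blast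
    obtain a where a: "a \<in> torus_cell"
      and red: "\<And>f. periodic f \<Longrightarrow> f a = f x"
      using reduce_to_torus_cell[of x] by metis
    have "B (x, y) = 0" using B0 a red[of "\<lambda>a. B (a, y)"] Bper by (simp add: periodic_def)
    then show ?thesis using \<gamma>_pos(1)[of "u (x, y) - \<delta>"] xy by (force simp: B_def S_def)
  qed
  show ?thesis by (rule field_le_epsilon) (use le_\<delta> in simp)
qed (use boundary in simp)

section \<open>Harmonic extensions and contact of two graphs\<close>

text \<open>The slice integral of \<open>\<phi>\<^sup>2\<close> has second derivative twice that of \<open>|\<nabla>\<phi>|\<^sup>2\<close>, which is integrable in \<open>y\<close>
  by finiteness of the energy. So its first derivative is bounded at \<open>-\<infinity>\<close>.\<close>

lemma harmonic_extension_slice_growth: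
  fixes h :: "real^'n \<Rightarrow> real"
  assumes h: "continuous_on UNIV h" "periodic h" and \<phi>: "harmonic_extension h \<psi> \<phi>"
  obtains C Y0 where "\<And>x. Y0 < h x"
    "\<And>y. y \<le> Y0 \<Longrightarrow> integral torus_cell (\<lambda>x. (\<phi> (x, y))\<^sup>2) \<le> C * (1 + \<bar>y\<bar>)"
proof -
  obtain K where K: "\<And>x. \<bar>h x\<bar> \<le> K" using periodic_continuous_bounded[OF h] by metis
  define Y1 where "Y1 = - K - 1"
  define I where "I = {..<Y1}"
  define Y0 where "Y0 = Y1 - 1"
  have Y1: "Y1 < h x" for x using K[of x] by (simp add: Y1_def abs_le_iff)
  have Y0_less: "Y0 < h x" for x using Y1[of x] by (simp add: Y0_def)
  have sub: "UNIV \<times> I \<subseteq> fluid_domain h"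
    using Y1 by (auto simp: I_def fluid_domain_def intro: less_trans)
  have Ck: "Ck_on 2 \<phi> (fluid_domain h)" and lap0: "\<And>z. z \<in> fluid_domain h \<Longrightarrow> laplacian \<phi> z = 0"
    using \<phi> unfolding harmonic_extension_def by blast+
  obtain d dd where u: "line_C2 (fluid_domain h) \<phi> d dd"
    and lap: "\<And>z. z \<in> fluid_domain h \<Longrightarrow> (\<Sum>b\<in>Basis. dd b z) = laplacian \<phi> z"
    and fr: "\<And>z b. z \<in> fluid_domain h \<Longrightarrow> d b z = frechet_derivative \<phi> (at z) b"
    using line_C2_if_Ck_on_2[OF Ck open_fluid_domain[OF h(1)]] by metis
  define e where "e z = (\<Sum>b\<in>Basis. (d b z)\<^sup>2)" for z
  have "line_C2 (UNIV \<times> I) (\<lambda>z. (\<phi> z)\<^sup>2) (\<lambda>b z. 2 * \<phi> z * d b z)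
           (\<lambda>b z. 2 * (d b z)\<^sup>2 + 2 * \<phi> z * dd b z)"
    by (rule line_C2_compose[OF line_C2_subset[OF u sub], of "\<lambda>r. r\<^sup>2" "\<lambda>r. 2 * r" "\<lambda>r. 2"])
       (auto intro!: derivative_eq_intros)
  note B = this
  define J where "J y = integral torus_cell (\<lambda>x. (\<phi> (x, y))\<^sup>2)" for y
  define J1 where "J1 y = integral torus_cell (\<lambda>x. 2 * \<phi> (x, y) * d (0, 1) (x, y))" for y
  have per: "(\<phi> (x + axis i (2 * pi), y))\<^sup>2 = (\<phi> (x, y))\<^sup>2" if "y \<in> I" for x y i
  proof -
    have "(x, y) \<in> closure (fluid_domain h)" using sub that closure_subset by blast
    then show ?thesis using \<phi> unfolding harmonic_extension_def by fastforce
  qed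
  have sum_eq: "(\<Sum>b\<in>Basis. 2 * (d b z)\<^sup>2 + 2 * \<phi> z * dd b z) = 2 * e z" if "z \<in> UNIV \<times> I" for z
  proof -
    have "z \<in> fluid_domain h" using that sub by blast
    then have "(\<Sum>b\<in>Basis. dd b z) = 0" using lap[of z] lap0[of z] by simp
    then show ?thesis by (simp add: sum.distrib e_def flip: sum_distrib_left)
  qed
  have J_der: "(J has_real_derivative J1 y) (at y)"
    "(J1 has_real_derivative integral torus_cell (\<lambda>x. 2 * e (x, y))) (at y)" if "y \<in> I" for y
  proof -
    have "open I" "convex I" by (auto simp: I_def)
    note D = slice_integral_derivatives[OF B this that per]
    show "(J has_real_derivative J1 y) (at y)" unfolding J_def[abs_def] J1_def[abs_def] by (rule D(1))
    show "(J1 has_real_derivative integral torus_cell (\<lambda>x. 2 * e (x, y))) (at y)"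
      unfolding J1_def[abs_def] using D(2) sum_eq that by simp
  qed
  have cont_e: "continuous_on (UNIV \<times> I) (\<lambda>z. 2 * e z)"
    using line_C2_subset[OF u sub] unfolding line_C2_def e_def by (auto intro!: continuous_intros)
  define A where "A = fluid_domain h \<inter> torus_cell \<times> UNIV"
  have "set_integrable lebesgue A (\<lambda>z. \<Sum>b\<in>Basis. (frechet_derivative \<phi> (at z) b)\<^sup>2)"
    using \<phi> by (simp add: harmonic_extension_def A_def)
  then have "(\<lambda>z. \<Sum>b\<in>Basis. (frechet_derivative \<phi> (at z) b)\<^sup>2) integrable_on A"
    by (rule set_lebesgue_integral_eq_integral)
  then have "e integrable_on A"
    by (rule integrable_eq) (auto simp: e_def A_def fr)
  then have int_A: "(\<lambda>z. 2 * e z) integrable_on A" by (rule integrable_on_mult_right)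
  define E where "E = integral A (\<lambda>z. 2 * e z)"
  define L where "L = \<bar>J1 Y0\<bar> + E"
  have "0 \<le> E" unfolding E_def using int_A by (intro integral_nonneg) (auto simp: e_def sum_nonneg)
  have J1_lower: "- L \<le> J1 y" if "y \<le> Y0" for y
  proof -
    have inI: "s \<in> I" if "s \<in> {y..Y0}" for s using that by (auto simp: I_def Y0_def)
    have box: "cbox (0, y) (\<chi> i. 2 * pi, Y0) = torus_cell \<times> {y..Y0}"
      by (auto simp: torus_cell_def)
    have cont_box: "continuous_on (cbox (0, y) (\<chi> i. 2 * pi, Y0)) (\<lambda>z. 2 * e z)"
      by (rule continuous_on_subset[OF cont_e]) (use inI in \<open>auto simp: box\<close>)
    have "((\<lambda>s. integral torus_cell (\<lambda>x. 2 * e (x, s))) has_integral (J1 Y0 - J1 y)) {y..Y0}"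
      using J_der(2)[OF inI] that
      by (intro fundamental_theorem_of_calculus)
         (auto simp: has_real_derivative_iff_has_vector_derivative[symmetric]
               intro: has_field_derivative_at_within)
    then have "J1 Y0 - J1 y = integral {y..Y0} (\<lambda>s. integral torus_cell (\<lambda>x. 2 * e (x, s)))"
      by (rule integral_unique[symmetric])
    also have "integral {y..Y0} (\<lambda>s. integral torus_cell (\<lambda>x. 2 * e (x, s)))
        = integral (cbox (0, y) (\<chi> i. 2 * pi, Y0)) (\<lambda>z. 2 * e z)"
    proof -
      have "continuous_on (cbox (0, y) (\<chi> i. 2 * pi, Y0)) (\<lambda>(x, s). 2 * e (x, s))"
        using cont_box by (simp add: split_beta)
      from integral_swap_continuous[OF this] show ?thesis
        unfolding integral_prod_continuous[OF cont_box] torus_cell_def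
        unfolding cbox_interval by (rule sym)
    qed
    also have "\<dots> \<le> E"
      unfolding E_def
    proof (rule integral_subset_le)
      show "cbox (0, y) (\<chi> i. 2 * pi, Y0) \<subseteq> A"
        using inI sub by (auto simp: box A_def)
    qed (use integrable_continuous[OF cont_box] int_A in \<open>auto simp: e_def sum_nonneg\<close>)
    finally show ?thesis by (simp add: L_def)
  qed
  have J_upper: "J y \<le> J Y0 + L * (Y0 - y)" if "y \<le> Y0" for y
  proof -
    have "J y + L * y \<le> J Y0 + L * Y0"
    proof (rule DERIV_nonneg_imp_nondecreasing[OF that])
      fix s assume s: "y \<le> s" "s \<le> Y0"
      have "((\<lambda>s. J s + L * s) has_real_derivative J1 s + L) (at s)"
        using s by (auto intro!: derivative_eq_intros J_der simp: I_def Y0_def)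
      then show "\<exists>D. ((\<lambda>s. J s + L * s) has_real_derivative D) (at s) \<and> 0 \<le> D"
        using J1_lower[OF s(2)] by (intro exI[of _ "J1 s + L"]) auto
    qed
    then show ?thesis by (simp add: algebra_simps)
  qed
  have "J y \<le> (\<bar>J Y0\<bar> + L * (\<bar>Y0\<bar> + 1)) * (1 + \<bar>y\<bar>)" if "y \<le> Y0" for y
  proof -
    have "L \<ge> 0" using \<open>0 \<le> E\<close> by (simp add: L_def)
    have "J y \<le> \<bar>J Y0\<bar> + L * (\<bar>Y0\<bar> + \<bar>y\<bar>)"
    proof -
      have "Y0 - y \<le> \<bar>Y0\<bar> + \<bar>y\<bar>" by linarith
      then have "L * (Y0 - y) \<le> L * (\<bar>Y0\<bar> + \<bar>y\<bar>)" using \<open>L \<ge> 0\<close> by (rule mult_left_mono)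
      then show ?thesis using J_upper[OF that] by linarith
    qed
    also have "\<dots> \<le> \<bar>J Y0\<bar> * (1 + \<bar>y\<bar>) + L * ((\<bar>Y0\<bar> + 1) * (1 + \<bar>y\<bar>))"
      using \<open>L \<ge> 0\<close> by (intro add_mono mult_left_mono) (auto simp: algebra_simps)
    finally show ?thesis by (simp add: algebra_simps)
  qed
  then show thesis
    using that[of Y0] Y0_less unfolding J_def by blast
qed

lemma harmonic_extension_properties:
  assumes h: "continuous_on UNIV h" "periodic h" and \<phi>: "harmonic_extension h \<psi> \<phi>"
  shows "continuous_on {(x, y). y \<le> h x} \<phi>" "\<And>x y i. y \<le> h x \<Longrightarrow> \<phi> (x + axis i (2 * pi), y) = \<phi> (x, y)"
    "\<And>x. \<phi> (x, h x) = \<psi> x"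
    and "\<exists>d dd. line_C2 (fluid_domain h) \<phi> d dd \<and> (\<forall>z\<in>fluid_domain h. (\<Sum>b\<in>Basis. dd b z) = 0)"
proof -
  show "continuous_on {(x, y). y \<le> h x} \<phi>" "\<And>x y i. y \<le> h x \<Longrightarrow> \<phi> (x + axis i (2 * pi), y) = \<phi> (x, y)"
    "\<And>x. \<phi> (x, h x) = \<psi> x"
    using \<phi> unfolding harmonic_extension_def closure_fluid_domain[OF h(1)] by auto
  have Ck: "Ck_on 2 \<phi> (fluid_domain h)" and lap0: "\<And>z. z \<in> fluid_domain h \<Longrightarrow> laplacian \<phi> z = 0"
    using \<phi> unfolding harmonic_extension_def by blast+
  obtain d dd where "line_C2 (fluid_domain h) \<phi> d dd"
    "\<And>z. z \<in> fluid_domain h \<Longrightarrow> (\<Sum>b\<in>Basis. dd b z) = laplacian \<phi> z"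
    using line_C2_if_Ck_on_2[OF Ck open_fluid_domain[OF h(1)]] by metis
  then show "\<exists>d dd. line_C2 (fluid_domain h) \<phi> d dd \<and> (\<forall>z\<in>fluid_domain h. (\<Sum>b\<in>Basis. dd b z) = 0)"
    using lap0 by metis
qed

lemma slice_below_graph:
  assumes "continuous_on {(x, y). y \<le> h x} \<phi>" "\<And>x. y \<le> h x"
  shows "continuous_on A (\<lambda>x. \<phi> (x, y))"
  by (rule continuous_on_compose2[OF assms(1)]) (use assms(2) in \<open>auto intro!: continuous_intros\<close>)

text \<open>The function \<open>y - \<phi>\<close> vanishes on the graph, and for negative \<open>y\<close> its positive part is at most \<open>|\<phi>|\<close>,
  so its growth is controlled by that of \<open>\<phi>\<close>. Physically, the pressure in the fluid is nonnegative.\<close>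

lemma height_le_harmonic_extension:
  fixes h :: "real^'n \<Rightarrow> real"
  assumes h: "continuous_on UNIV h" "periodic h" and \<phi>: "harmonic_extension h h \<phi>" and xy: "y \<le> h x"
  shows "y \<le> \<phi> (x, y)"
proof -
  note p = harmonic_extension_properties[OF h \<phi>]
  obtain d dd where u: "line_C2 (fluid_domain h) \<phi> d dd"
    and lap: "\<And>z. z \<in> fluid_domain h \<Longrightarrow> (\<Sum>b\<in>Basis. dd b z) = 0"
    using p(4) by metis
  obtain C Y0 where Y0: "\<And>x. Y0 < h x"
    and C: "\<And>y. y \<le> Y0 \<Longrightarrow> integral torus_cell (\<lambda>x. (\<phi> (x, y))\<^sup>2) \<le> C * (1 + \<bar>y\<bar>)"
    using harmonic_extension_slice_growth[OF h \<phi>] by metis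
  have "(\<lambda>z. snd z - 0 - \<phi> z) (x, y) \<le> 0"
  proof (rule harmonic_nonpos[OF h line_C2_diff[OF line_C2_height u], where Y = "min Y0 0" and C = C, OF _ _ _ _ _ xy])
    show "(\<Sum>b\<in>Basis. 0 - dd b z) = 0" if "z \<in> fluid_domain h" for z
      using lap[OF that] by (simp add: sum_negf)
    show "continuous_on {(x, y). y \<le> h x} (\<lambda>z. snd z - 0 - \<phi> z)"
      by (intro continuous_intros p(1))
    fix y assume y: "y \<le> min Y0 0"
    have below: "y \<le> h x" for x using y Y0[of x] by simp
    note cont = slice_below_graph[OF p(1) below, where A = UNIV]
    have "integral torus_cell (\<lambda>x. (max 0 (y - \<phi> (x, y)))\<^sup>2) \<le> integral torus_cell (\<lambda>x. (\<phi> (x, y))\<^sup>2)"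
    proof (intro integral_le continuous_integrable_torus_cell continuous_intros cont)
      fix x
      have "(max 0 (y - \<phi> (x, y)))\<^sup>2 \<le> \<bar>\<phi> (x, y)\<bar>\<^sup>2" using y by (intro power_mono) auto
      then show "(max 0 (y - \<phi> (x, y)))\<^sup>2 \<le> (\<phi> (x, y))\<^sup>2" by simp
    qed
    then show "integral torus_cell (\<lambda>x. (max 0 (snd (x, y) - 0 - \<phi> (x, y)))\<^sup>2) \<le> C * (1 + \<bar>y\<bar>)"
      using C[of y] y by simp
  qed (use p in auto)
  then show ?thesis by simp
qed

lemma derivative_le_if_quotients_le:
  fixes f :: "real \<Rightarrow> real"
  assumes "(f has_real_derivative D) (at t within A)" "at t within A \<noteq> bot"
    and "\<forall>\<^sub>F s in at t within A. (f s - f t) / (s - t) \<le> K"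
  shows "D \<le> K"
  using assms tendsto_upperbound unfolding has_field_derivative_iff by blast

lemma line_C2_minus_const:
  "line_C2 S u d dd \<Longrightarrow> line_C2 S (\<lambda>z. u z - c) d dd"
  unfolding line_C2_def by (auto intro!: continuous_intros derivative_eq_intros)

lemma has_line_derivative_partial:
  fixes f :: "real^'n \<Rightarrow> real"
  assumes "(f has_derivative f') (at x)"
  shows "((\<lambda>r. f (x + r *\<^sub>R axis i 1)) has_real_derivative f' (axis i 1)) (at 0)"
    "partial i f x = f' (axis i 1)"
proof -
  have "((\<lambda>r. x + r *\<^sub>R axis i 1) has_derivative (\<lambda>r. r *\<^sub>R axis i 1)) (at (0::real))"
    by (auto intro!: derivative_eq_intros)
  then have "((\<lambda>r. f (x + r *\<^sub>R axis i 1)) has_derivative (\<lambda>r. f' (r *\<^sub>R axis i 1))) (at 0)"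
    by (rule has_derivative_compose) (use assms in simp)
  moreover have "(\<lambda>r. f' (r *\<^sub>R axis i 1)) = (*) (f' (axis i 1))"
    using linear_scale[OF has_derivative_linear[OF assms]] by (auto simp: mult.commute)
  ultimately show "((\<lambda>r. f (x + r *\<^sub>R axis i 1)) has_real_derivative f' (axis i 1)) (at 0)"
    by (simp add: has_field_derivative_def)
  then show "partial i f x = f' (axis i 1)" unfolding partial_def by (rule DERIV_imp_deriv)
qed

lemma has_derivative_grad:
  fixes f :: "real^'n \<Rightarrow> real"
  assumes "f differentiable (at x)"
  shows "(f has_derivative (\<lambda>v. grad f x \<bullet> v)) (at x)"
proof -
  obtain f' where f': "(f has_derivative f') (at x)" using assms by (auto simp: differentiable_def)
  note partial = has_line_derivative_partial(2)[OF f']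
  have "f' v = grad f x \<bullet> v" for v
  proof -
    have lin: "linear f'" using has_derivative_linear[OF f'] .
    have "v = (\<Sum>i\<in>UNIV. (v $ i) *\<^sub>R axis i 1)"
      by (simp add: vec_eq_iff axis_def if_distrib sum.delta cong: if_cong)
    then have "f' v = f' (\<Sum>i\<in>UNIV. (v $ i) *\<^sub>R axis i 1)" by (rule arg_cong)
    also have "\<dots> = (\<Sum>i\<in>UNIV. v $ i * f' (axis i 1))"
      by (simp add: linear_sum[OF lin] linear_scale[OF lin])
    finally show ?thesis
      by (simp add: partial grad_def inner_vec_def mult.commute)
  qed
  then have "f' = (\<lambda>v. grad f x \<bullet> v)" by (rule ext)
  then show ?thesis using f' by simp
qed

text \<open>The vector \<open>(G, -1)\<close>, an inner normal of the graph, points strictly below the tangent plane, since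
  \<open>G \<bullet> G > -1\<close>. It is the direction in which the Dirichlet to Neumann operator differentiates, up
  to sign.\<close>

lemma downward_ray_below_graph:
  fixes k :: "real^'n \<Rightarrow> real"
  assumes "(k has_derivative (\<lambda>v. G \<bullet> v)) (at x0)"
  obtains \<delta> where "\<delta> > 0" "\<And>s. 0 \<le> s \<Longrightarrow> s < \<delta> \<Longrightarrow> k x0 - s \<le> k (x0 + s *\<^sub>R G)"
proof -
  have "((\<lambda>s. x0 + s *\<^sub>R G) has_derivative (\<lambda>s. s *\<^sub>R G)) (at (0::real))"
    by (auto intro!: derivative_eq_intros)
  then have "((\<lambda>s. k (x0 + s *\<^sub>R G)) has_derivative (\<lambda>s. G \<bullet> (s *\<^sub>R G))) (at 0)"
    by (rule has_derivative_compose) (use assms in simp)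
  moreover have "(\<lambda>s. G \<bullet> (s *\<^sub>R G)) = (*) (G \<bullet> G)" by (auto simp: mult.commute)
  ultimately have "((\<lambda>s. k (x0 + s *\<^sub>R G)) has_real_derivative G \<bullet> G) (at 0)"
    by (simp add: has_field_derivative_def)
  then have "((\<lambda>s. k (x0 + s *\<^sub>R G) + s) has_real_derivative G \<bullet> G + 1) (at 0)"
    by (auto intro!: derivative_eq_intros)
  moreover have "G \<bullet> G + 1 > 0" using inner_ge_zero[of G] by linarith
  ultimately obtain \<delta> where \<delta>: "\<delta> > 0"
    "\<And>s. s > 0 \<Longrightarrow> s < \<delta> \<Longrightarrow> k (x0 + 0 *\<^sub>R G) + 0 < k (x0 + (0 + s) *\<^sub>R G) + (0 + s)"
    using DERIV_pos_inc_right by blast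
  show thesis
  proof (rule that[OF \<open>\<delta> > 0\<close>])
    fix s :: real assume "0 \<le> s" "s < \<delta>"
    then show "k x0 - s \<le> k (x0 + s *\<^sub>R G)"
      using \<delta>(2)[of s] by (cases "s = 0") auto
  qed
qed

text \<open>The translation by \<open>(p, c)\<close> is carried along explicitly. Below the graph of
  \<open>k x = a (x + p) - c\<close>, which is the lower one, the translate of \<open>\<phi>1\<close> minus \<open>\<phi>2\<close> is harmonic, and on
  the graph it equals \<open>y - \<phi>2 \<le> 0\<close>. So it is nonpositive and vanishes at the point of contact, where
  moreover the gradients of the two graphs coincide; its derivative along the inner normal there
  is the asserted difference.\<close>

lemma dirichlet_neumann_touching:
  fixes a b :: "real^'n \<Rightarrow> real"
  assumes a: "continuous_on UNIV a" "periodic a" and b: "continuous_on UNIV b" "periodic b"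
    and g1: "has_dirichlet_neumann a a g1" and g2: "has_dirichlet_neumann b b g2"
    and p: "p = r *\<^sub>R axis i 1" "0 \<le> r" "r \<le> 2 * pi"
    and le: "\<And>x. a (x + p) \<le> b x + c" and touch: "a (x0 + p) = b x0 + c"
    and diff: "a differentiable (at (x0 + p))" "b differentiable (at x0)"
  shows "g2 x0 \<le> g1 (x0 + p)"
proof -
  obtain \<phi>1 L1 where \<phi>1: "harmonic_extension a a \<phi>1"
    and L1: "(\<phi>1 has_derivative L1) (at (x0 + p, a (x0 + p)) within closure (fluid_domain a))"
    and g1_eq: "g1 (x0 + p) = L1 (0, 1) - grad a (x0 + p) \<bullet> (\<chi> i. L1 (axis i 1, 0))"
    using g1 unfolding has_dirichlet_neumann_def by metis
  obtain \<phi>2 L2 where \<phi>2: "harmonic_extension b b \<phi>2"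
    and L2: "(\<phi>2 has_derivative L2) (at (x0, b x0) within closure (fluid_domain b))"
    and g2_eq: "g2 x0 = L2 (0, 1) - grad b x0 \<bullet> (\<chi> i. L2 (axis i 1, 0))"
    using g2 unfolding has_dirichlet_neumann_def by metis
  note f1 = harmonic_extension_properties[OF a \<phi>1]
  note f2 = harmonic_extension_properties[OF b \<phi>2]
  define k where "k x = a (x + p) - c" for x
  have k_le: "k x \<le> b x" for x using le[of x] by (simp add: k_def)
  have k: "continuous_on UNIV k"
    unfolding k_def by (intro continuous_intros continuous_on_compose2[OF a(1)]) auto
  have k_per: "periodic k"
    unfolding periodic_def
  proof (intro allI)
    fix x j
    show "k (x + axis j (2 * pi)) = k x"
      using a(2)[unfolded periodic_def, rule_format, of "x + p" j] by (simp add: k_def algebra_simps)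
  qed
  define u where "u z = \<phi>1 (z + (p, c)) - \<phi>2 z - c" for z
  have u_nonpos: "u (x, y) \<le> 0" if xy: "y \<le> k x" for x y
  proof -
    obtain d1 dd1 where 1: "line_C2 (fluid_domain a) \<phi>1 d1 dd1"
      "\<And>z. z \<in> fluid_domain a \<Longrightarrow> (\<Sum>b\<in>Basis. dd1 b z) = 0" using f1(4) by metis
    obtain d2 dd2 where 2: "line_C2 (fluid_domain b) \<phi>2 d2 dd2"
      "\<And>z. z \<in> fluid_domain b \<Longrightarrow> (\<Sum>b\<in>Basis. dd2 b z) = 0" using f2(4) by metis
    have dom: "{z. z + (p, c) \<in> fluid_domain a} = fluid_domain k"
      by (auto simp: fluid_domain_def k_def)
    have sub: "fluid_domain k \<subseteq> fluid_domain b"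
      using k_le by (auto simp: fluid_domain_def intro: less_le_trans)
    note C2 = line_C2_minus_const[OF line_C2_diff[OF line_C2_translate[OF 1(1), of "(p, c)", unfolded dom]
          line_C2_subset[OF 2(1) sub]], of c, folded u_def[abs_def]]
    obtain C1 Y1 where Y1: "\<And>x. Y1 < a x"
      and C1: "\<And>y. y \<le> Y1 \<Longrightarrow> integral torus_cell (\<lambda>x. (\<phi>1 (x, y))\<^sup>2) \<le> C1 * (1 + \<bar>y\<bar>)"
      using harmonic_extension_slice_growth[OF a \<phi>1] by metis
    obtain C2 Y2 where Y2: "\<And>x. Y2 < b x"
      and C2': "\<And>y. y \<le> Y2 \<Longrightarrow> integral torus_cell (\<lambda>x. (\<phi>2 (x, y))\<^sup>2) \<le> C2 * (1 + \<bar>y\<bar>)"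
      using harmonic_extension_slice_growth[OF b \<phi>2] by metis
    define V where "V = integral (torus_cell :: (real^'n) set) (\<lambda>x. 3 * c\<^sup>2)"
    define Y where "Y = min (Y1 - c) Y2"
    show ?thesis
    proof (rule harmonic_nonpos[OF k k_per C2, where Y = Y
          and C = "3 * \<bar>C1\<bar> * (1 + \<bar>c\<bar>) + 3 * \<bar>C2\<bar> + \<bar>V\<bar>", OF _ _ _ _ _ xy])
      show "(\<Sum>b\<in>Basis. dd1 b (z + (p, c)) - dd2 b z) = 0" if "z \<in> fluid_domain k" for z
      proof -
        have "z + (p, c) \<in> fluid_domain a" "z \<in> fluid_domain b" using that dom sub by blast+
        then show ?thesis using 1(2)[of "z + (p, c)"] 2(2)[of z] by (simp add: sum_subtractf)
      qed
      have "continuous_on {(x, y). y \<le> k x} (\<lambda>z. \<phi>1 (z + (p, c)))"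
        by (rule continuous_on_compose2[OF f1(1)]) (auto intro!: continuous_intros simp: k_def)
      moreover have "continuous_on {(x, y). y \<le> k x} \<phi>2"
        by (rule continuous_on_subset[OF f2(1)]) (use k_le in \<open>auto intro: order_trans\<close>)
      ultimately show "continuous_on {(x, y). y \<le> k x} u"
        unfolding u_def[abs_def] by (intro continuous_intros)
      show "u (x + axis j (2 * pi), y) = u (x, y)" if "y \<le> k x" for x y j
        using that f1(2)[of "y + c" "x + p" j] f2(2)[of y x j] k_le[of x]
        by (simp add: u_def k_def algebra_simps)
      show "u (x, k x) \<le> 0" for x
        using f1(3)[of "x + p"] height_le_harmonic_extension[OF b \<phi>2 k_le[of x]]
        by (simp add: u_def k_def)
      fix y assume y: "y \<le> Y"
      have below: "y + c \<le> a x" "y \<le> b x" for x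
        using y Y1[of x] Y2[of x] by (auto simp: Y_def)
      note cont1 = slice_below_graph[OF f1(1) below(1), where A = UNIV]
      note cont2 = slice_below_graph[OF f2(1) below(2), where A = UNIV]
      have cont1': "continuous_on UNIV (\<lambda>x. \<phi>1 (x + p, y + c))"
        by (rule continuous_on_compose2[OF cont1]) (auto intro!: continuous_intros)
      have shift: "integral torus_cell (\<lambda>x. (\<phi>1 (x + p, y + c))\<^sup>2)
          = integral torus_cell (\<lambda>x. (\<phi>1 (x, y + c))\<^sup>2)"
        unfolding p(1)
        by (rule integral_torus_cell_shift[of "\<lambda>x. (\<phi>1 (x, y + c))\<^sup>2"])
           (use f1(2) below(1) p cont1 in \<open>auto intro!: continuous_intros\<close>)
      note ints = continuous_integrable_torus_cell
      have "integral torus_cell (\<lambda>x. (max 0 (u (x, y)))\<^sup>2)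
          \<le> integral torus_cell (\<lambda>x. 3 * (\<phi>1 (x + p, y + c))\<^sup>2 + 3 * (\<phi>2 (x, y))\<^sup>2 + 3 * c\<^sup>2)"
      proof (intro integral_le ints)
        show "continuous_on UNIV (\<lambda>x. (max 0 (u (x, y)))\<^sup>2)"
          unfolding u_def by (simp, intro continuous_intros cont1' cont2)
        show "continuous_on UNIV (\<lambda>x. 3 * (\<phi>1 (x + p, y + c))\<^sup>2 + 3 * (\<phi>2 (x, y))\<^sup>2 + 3 * c\<^sup>2)"
          by (intro continuous_intros cont1' cont2)
        fix x
        have *: "(A - B - c)\<^sup>2 \<le> 3 * A\<^sup>2 + 3 * B\<^sup>2 + 3 * c\<^sup>2" for A B :: real
        proof -
          have "0 \<le> (A + B)\<^sup>2 + (A + c)\<^sup>2 + (B - c)\<^sup>2" by simp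
          then show ?thesis by (simp add: power2_eq_square algebra_simps)
        qed
        have "(max 0 (u (x, y)))\<^sup>2 \<le> \<bar>u (x, y)\<bar>\<^sup>2" by (intro power_mono) auto
        then show "(max 0 (u (x, y)))\<^sup>2 \<le> 3 * (\<phi>1 (x + p, y + c))\<^sup>2 + 3 * (\<phi>2 (x, y))\<^sup>2 + 3 * c\<^sup>2"
          using *[of "\<phi>1 (x + p, y + c)" "\<phi>2 (x, y)"] by (simp add: u_def)
      qed
      also have "\<dots> = 3 * integral torus_cell (\<lambda>x. (\<phi>1 (x, y + c))\<^sup>2)
          + 3 * integral torus_cell (\<lambda>x. (\<phi>2 (x, y))\<^sup>2) + V"
      proof -
        have i: "(\<lambda>x. 3 * (\<phi>1 (x + p, y + c))\<^sup>2) integrable_on torus_cell"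
          "(\<lambda>x. 3 * (\<phi>2 (x, y))\<^sup>2) integrable_on torus_cell" "(\<lambda>x. 3 * c\<^sup>2) integrable_on torus_cell"
          by (intro ints continuous_intros cont1' cont2)+
        show ?thesis
          by (simp only: integral_add[OF integrable_add[OF i(1,2)] i(3)] integral_add[OF i(1,2)]
              integral_mult_right shift V_def)
      qed
      also have "\<dots> \<le> 3 * (\<bar>C1\<bar> * ((1 + \<bar>c\<bar>) * (1 + \<bar>y\<bar>))) + 3 * (\<bar>C2\<bar> * (1 + \<bar>y\<bar>)) + \<bar>V\<bar> * (1 + \<bar>y\<bar>)"
      proof (intro add_mono mult_left_mono)
        have "C1 * (1 + \<bar>y + c\<bar>) \<le> \<bar>C1\<bar> * (1 + \<bar>y + c\<bar>)" by (intro mult_right_mono) auto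
        also have "\<dots> \<le> \<bar>C1\<bar> * ((1 + \<bar>c\<bar>) * (1 + \<bar>y\<bar>))"
        proof (intro mult_left_mono)
          have "(1 + \<bar>c\<bar>) * (1 + \<bar>y\<bar>) = 1 + \<bar>y\<bar> + \<bar>c\<bar> + \<bar>c\<bar> * \<bar>y\<bar>"
            by (simp add: algebra_simps)
          moreover have "0 \<le> \<bar>c\<bar> * \<bar>y\<bar>" by simp
          ultimately show "1 + \<bar>y + c\<bar> \<le> (1 + \<bar>c\<bar>) * (1 + \<bar>y\<bar>)" by linarith
        qed simp
        finally show "integral torus_cell (\<lambda>x. (\<phi>1 (x, y + c))\<^sup>2) \<le> \<bar>C1\<bar> * ((1 + \<bar>c\<bar>) * (1 + \<bar>y\<bar>))"
          using C1[of "y + c"] y by (simp add: Y_def)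
        have "C2 * (1 + \<bar>y\<bar>) \<le> \<bar>C2\<bar> * (1 + \<bar>y\<bar>)" by (intro mult_right_mono) auto
        then show "integral torus_cell (\<lambda>x. (\<phi>2 (x, y))\<^sup>2) \<le> \<bar>C2\<bar> * (1 + \<bar>y\<bar>)"
          using C2'[of y] y by (simp add: Y_def)
        have "\<bar>V\<bar> * 1 \<le> \<bar>V\<bar> * (1 + \<bar>y\<bar>)" by (intro mult_left_mono) auto
        then show "V \<le> \<bar>V\<bar> * (1 + \<bar>y\<bar>)" by simp
      qed auto
      also have "\<dots> = (3 * \<bar>C1\<bar> * (1 + \<bar>c\<bar>) + 3 * \<bar>C2\<bar> + \<bar>V\<bar>) * (1 + \<bar>y\<bar>)"
        by (simp add: algebra_simps)
      finally show "integral torus_cell (\<lambda>x. (max 0 (u (x, y)))\<^sup>2)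
        \<le> (3 * \<bar>C1\<bar> * (1 + \<bar>c\<bar>) + 3 * \<bar>C2\<bar> + \<bar>V\<bar>) * (1 + \<bar>y\<bar>)" .
    qed
  qed
  define G where "G = grad b x0"
  have k_x0: "k x0 = b x0" using touch by (simp add: k_def)
  have da: "((\<lambda>x. a (x + p)) has_derivative (\<lambda>v. grad a (x0 + p) \<bullet> v)) (at x0)"
  proof -
    have "((\<lambda>x. x + p) has_derivative (\<lambda>v. v)) (at x0)" by (auto intro!: derivative_eq_intros)
    then show ?thesis by (rule has_derivative_compose) (rule has_derivative_grad[OF diff(1)])
  qed
  have db: "(b has_derivative (\<lambda>v. G \<bullet> v)) (at x0)"
    unfolding G_def by (rule has_derivative_grad[OF diff(2)])
  have grad_eq: "grad a (x0 + p) = G"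
  proof -
    have "((\<lambda>x. b x - a (x + p)) has_derivative (\<lambda>v. G \<bullet> v - grad a (x0 + p) \<bullet> v)) (at x0)"
      by (rule has_derivative_diff[OF db da])
    moreover have "\<forall>y\<in>UNIV. b x0 - a (x0 + p) \<le> b y - a (y + p)"
    proof
      fix y show "b x0 - a (x0 + p) \<le> b y - a (y + p)" using le[of y] touch by linarith
    qed
    ultimately have "(\<lambda>v. G \<bullet> v - grad a (x0 + p) \<bullet> v) = (\<lambda>v. 0)"
      using differential_zero_maxmin[OF UNIV_I open_UNIV] by blast
    then have "G \<bullet> v = grad a (x0 + p) \<bullet> v" for v by (metis eq_iff_diff_eq_0)
    then show ?thesis by (metis vector_eq_rdot)
  qed
  have "(k has_derivative (\<lambda>v. G \<bullet> v)) (at x0)"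
    unfolding k_def[abs_def] using da grad_eq by (auto intro!: derivative_eq_intros)
  then obtain \<delta> where \<delta>: "\<delta> > 0" "\<And>s. 0 \<le> s \<Longrightarrow> s < \<delta> \<Longrightarrow> k x0 - s \<le> k (x0 + s *\<^sub>R G)"
    using downward_ray_below_graph by metis
  \<comment> \<open>One-sided intervals, since the extensions are differentiated within their closed domains.\<close>
  define I where "I = {0..<\<delta>}"
  have ray: "((\<lambda>s. z + s *\<^sub>R (G, -1)) has_derivative (\<lambda>s. s *\<^sub>R (G, -1))) (at 0 within I)"
    for z :: "(real^'n) \<times> real"
    by (auto intro!: derivative_eq_intros)
  have along: "((\<lambda>s. \<phi> (z + s *\<^sub>R (G, -1))) has_real_derivative L (G, -1)) (at 0 within I)"
    if L: "(\<phi> has_derivative L) (at z within S)" and S: "\<And>s. s \<in> I \<Longrightarrow> z + s *\<^sub>R (G, -1) \<in> S"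
    for \<phi> :: "(real^'n) \<times> real \<Rightarrow> real" and L z S
  proof -
    have "((\<lambda>s. \<phi> (z + s *\<^sub>R (G, -1))) has_derivative (\<lambda>s. L (s *\<^sub>R (G, -1)))) (at 0 within I)"
      by (rule has_derivative_in_compose[OF ray])
         (rule has_derivative_subset[of _ _ _ S], use L S in \<open>auto simp flip: zero_prod_def\<close>)
    moreover have "(\<lambda>s. L (s *\<^sub>R (G, -1))) = (*) (L (G, -1))"
      by (rule ext) (simp only: linear_scale[OF has_derivative_linear[OF L]] real_scaleR_def mult.commute)
    ultimately show ?thesis by (simp add: has_field_derivative_def)
  qed
  have below: "b x0 - s \<le> k (x0 + s *\<^sub>R G)" if "s \<in> I" for s
    using \<delta>(2)[of s] that k_x0 by (simp add: I_def)
  have "((\<lambda>s. \<phi>1 ((x0 + p, a (x0 + p)) + s *\<^sub>R (G, -1))) has_real_derivative L1 (G, -1)) (at 0 within I)"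
  proof (rule along[OF L1])
    fix s assume "s \<in> I"
    then show "(x0 + p, a (x0 + p)) + s *\<^sub>R (G, -1) \<in> closure (fluid_domain a)"
      using below[of s] touch by (simp add: closure_fluid_domain[OF a(1)] k_def algebra_simps)
  qed
  moreover have "((\<lambda>s. \<phi>2 ((x0, b x0) + s *\<^sub>R (G, -1))) has_real_derivative L2 (G, -1)) (at 0 within I)"
  proof (rule along[OF L2])
    fix s assume "s \<in> I"
    then show "(x0, b x0) + s *\<^sub>R (G, -1) \<in> closure (fluid_domain b)"
      using below[of s] k_le[of "x0 + s *\<^sub>R G"] by (simp add: closure_fluid_domain[OF b(1)])
  qed
  ultimately have "((\<lambda>s. \<phi>1 ((x0 + p, a (x0 + p)) + s *\<^sub>R (G, -1)) - \<phi>2 ((x0, b x0) + s *\<^sub>R (G, -1)) - c)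
      has_real_derivative L1 (G, -1) - L2 (G, -1)) (at 0 within I)"
    by (auto intro!: derivative_eq_intros)
  moreover have "\<phi>1 ((x0 + p, a (x0 + p)) + s *\<^sub>R (G, -1)) - \<phi>2 ((x0, b x0) + s *\<^sub>R (G, -1)) - c
      = u (x0 + s *\<^sub>R G, b x0 - s)" for s
    unfolding touch by (simp add: u_def algebra_simps)
  ultimately have "((\<lambda>s. u (x0 + s *\<^sub>R G, b x0 - s)) has_real_derivative L1 (G, -1) - L2 (G, -1)) (at 0 within I)"
    by simp
  then have "L1 (G, -1) - L2 (G, -1) \<le> 0"
  proof (rule derivative_le_if_quotients_le)
    show "at 0 within I \<noteq> bot"
      using \<delta>(1) by (simp add: I_def trivial_limit_within islimpt_Ico)
    have u0: "u (x0 + 0 *\<^sub>R G, b x0 - 0) = 0"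
      using f1(3)[of "x0 + p"] f2(3)[of x0] touch by (simp add: u_def)
    have "\<forall>s\<in>I. s \<noteq> 0 \<longrightarrow> (u (x0 + s *\<^sub>R G, b x0 - s) - u (x0 + 0 *\<^sub>R G, b x0 - 0)) / (s - 0) \<le> 0"
      unfolding u0 using u_nonpos[OF below] by (auto simp: I_def divide_le_0_iff)
    then show "\<forall>\<^sub>F s in at 0 within I.
        (u (x0 + s *\<^sub>R G, b x0 - s) - u (x0 + 0 *\<^sub>R G, b x0 - 0)) / (s - 0) \<le> 0"
      by (auto simp: eventually_at_filter)
  qed
  moreover have at_G: "L (G, -1) = G \<bullet> (\<chi> i. L (axis i 1, 0)) - L (0, 1)" if "linear L"
    for L :: "(real^'n) \<times> real \<Rightarrow> real"
  proof -
    have "(G, -1) = (\<Sum>i\<in>UNIV. (G $ i) *\<^sub>R (axis i 1, 0)) - (0, 1)"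
      by (auto simp: prod_eq_iff vec_eq_iff axis_def fst_sum snd_sum if_distrib sum.delta cong: if_cong)
    then have "L (G, -1) = L ((\<Sum>i\<in>UNIV. (G $ i) *\<^sub>R (axis i 1, 0)) - (0, 1))" by (rule arg_cong)
    also have "\<dots> = (\<Sum>i\<in>UNIV. G $ i * L (axis i 1, 0)) - L (0, 1)"
      by (simp only: linear_diff[OF that] linear_sum[OF that] linear_scale[OF that] real_scaleR_def)
    finally show ?thesis by (simp add: inner_vec_def)
  qed
  ultimately show ?thesis
    unfolding g1_eq g2_eq grad_eq G_def[symmetric]
    using at_G[OF has_derivative_linear[OF L1]] at_G[OF has_derivative_linear[OF L2]] by linarith
qed

section \<open>Comparison of solutions\<close>

text \<open>The time derivative is taken from the left, because a first contact is approached from earlier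
  times; it is then insensitive to shortening the time interval.\<close>

definition classical_solution :: "real \<Rightarrow> (real \<Rightarrow> real^'n \<Rightarrow> real) \<Rightarrow> bool" where
  "classical_solution T h \<longleftrightarrow>
     continuous_on ({0..T} \<times> UNIV) (\<lambda>(t, x). h t x) \<and> (\<forall>t\<in>{0..T}. periodic (h t)) \<and>
     (\<forall>t\<in>{0<..T}. (\<forall>x. h t differentiable (at x)) \<and>
        (\<exists>g. has_dirichlet_neumann (h t) (h t) g \<and>
           (\<forall>x. ((\<lambda>\<tau>. h \<tau> x) has_real_derivative - g x) (at t within {0..t}))))"

text \<open>The defect \<open>m\<close> between the raised \<open>h2\<close> and the translated \<open>h1\<close> is positive at time 0. At the first
  time where it vanishes, its time derivative is nonpositive, but by
  \<open>dirichlet_neumann_touching\<close> it is at least \<open>\<epsilon>\<close>.\<close>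

lemma comparison:
  fixes h1 h2 :: "real \<Rightarrow> real^'n \<Rightarrow> real"
  assumes h1: "classical_solution T h1" and h2: "classical_solution T h2"
    and p: "p = r *\<^sub>R axis i 1" "0 \<le> r" "r \<le> 2 * pi"
    and init: "\<And>x. h1 0 (x + p) \<le> h2 0 x + c" and t: "t \<in> {0..T}"
  shows "h1 t (x + p) \<le> h2 t x + c"
proof -
  have eps: "0 \<le> h2 t x + c + \<epsilon> * (1 + t) - h1 t (x + p)" if \<epsilon>: "\<epsilon> > 0" for \<epsilon>
  proof (rule ccontr)
    assume neg: "\<not> ?thesis"
    define m where "m t x = h2 t x + c + \<epsilon> * (1 + t) - h1 t (x + p)" for t x
    have m_cont: "continuous_on ({0..T} \<times> UNIV) (\<lambda>z. m (fst z) (snd z))"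
    proof -
      have c: "continuous_on ({0..T} \<times> UNIV) (\<lambda>z. h1 (fst z) (snd z))"
        "continuous_on ({0..T} \<times> UNIV) (\<lambda>z. h2 (fst z) (snd z))"
        using h1 h2 by (auto simp: classical_solution_def split_beta)
      have "continuous_on ({0..T} \<times> UNIV) (\<lambda>z. h1 (fst z) (snd z + p))"
        using continuous_on_compose2[OF c(1), of "{0..T} \<times> UNIV" "\<lambda>z. (fst z, snd z + p)"]
        by (force intro!: continuous_intros)
      then show ?thesis unfolding m_def by (intro continuous_intros c)
    qed
    have m_per: "periodic (m s)" if "s \<in> {0..T}" for s
    proof -
      have "periodic (h1 s)" "periodic (h2 s)" using h1 h2 that by (auto simp: classical_solution_def)
      then have "h1 s (x + axis j (2 * pi) + p) = h1 s (x + p)" "h2 s (x + axis j (2 * pi)) = h2 s x" for x j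
        unfolding periodic_def by (metis add.commute add.left_commute)+
      then show ?thesis by (simp add: periodic_def m_def)
    qed
    define Bad where "Bad = {z \<in> {0..T} \<times> torus_cell. m (fst z) (snd z) \<le> 0}"
    have in_Bad: "\<exists>y. (s, y) \<in> Bad" if "s \<in> {0..T}" "m s z \<le> 0" for s z
    proof -
      have "periodic (m s)" by (rule m_per) (rule that)
      then obtain y where "y \<in> torus_cell" "m s y = m s z"
        using reduce_to_torus_cell[of z] by metis
      then have "(s, y) \<in> Bad" using \<open>s \<in> {0..T}\<close> \<open>m s z \<le> 0\<close> by (simp add: Bad_def)
      then show ?thesis ..
    qed
    have "compact Bad"
    proof -
      have K: "compact ({0..T} \<times> (torus_cell :: (real^'n) set))"
        by (intro compact_Times compact_torus_cell) auto
      have "continuous_on ({0..T} \<times> torus_cell) (\<lambda>z. m (fst z) (snd z))"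
        by (rule continuous_on_subset[OF m_cont]) auto
      then have "closed (({0..T} \<times> torus_cell) \<inter> (\<lambda>z. m (fst z) (snd z)) -` {..0})"
        using compact_imp_closed[OF K] by (rule continuous_closed_preimage) auto
      then have "compact (({0..T} \<times> torus_cell) \<inter> (({0..T} \<times> torus_cell) \<inter> (\<lambda>z. m (fst z) (snd z)) -` {..0}))"
        by (rule compact_Int_closed[OF K])
      moreover have "({0..T} \<times> torus_cell) \<inter> (({0..T} \<times> torus_cell) \<inter> (\<lambda>z. m (fst z) (snd z)) -` {..0}) = Bad"
        by (auto simp: Bad_def)
      ultimately show ?thesis by simp
    qed
    moreover have "Bad \<noteq> {}" using in_Bad[OF t, of x] neg by (auto simp: m_def)
    ultimately obtain z where z: "z \<in> Bad" "\<And>w. w \<in> Bad \<Longrightarrow> fst z \<le> fst w"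
      using continuous_attains_inf[of Bad fst] continuous_on_fst[OF continuous_on_id] by metis
    define s x0 where "s = fst z" "x0 = snd z"
    have s: "s \<in> {0..T}" "m s x0 \<le> 0" using z(1) by (auto simp: s_x0_def Bad_def)
    have before: "m q y > 0" if "q \<in> {0..T}" "q < s" for q y
      using in_Bad[of q y] z(2) that by (force simp: s_x0_def)
    have "m 0 y > 0" for y using init[of y] \<epsilon> by (simp add: m_def)
    then have "s > 0" using s by (cases "s = 0") (auto simp: not_less[symmetric])
    have nontriv: "at s within {0..s} \<noteq> bot" using \<open>s > 0\<close> by (simp add: trivial_limit_within)
    have after: "m s y \<ge> 0" for y
    proof (rule tendsto_lowerbound[OF _ _ nontriv])
      have "continuous_on {0..s} (\<lambda>q. m q y)"
        using continuous_on_compose2[OF m_cont, of "{0..s}" "\<lambda>q. (q, y)"] s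
        by (force intro!: continuous_intros)
      then show "((\<lambda>q. m q y) \<longlongrightarrow> m s y) (at s within {0..s})"
        using \<open>s > 0\<close> by (auto simp: continuous_on_def)
      have "\<forall>q\<in>{0..s}. q \<noteq> s \<longrightarrow> 0 \<le> m q y" using before[of _ y] s by (force intro: less_imp_le)
      then show "\<forall>\<^sub>F q in at s within {0..s}. 0 \<le> m q y"
        by (auto simp: eventually_at_filter)
    qed
    then have m0: "m s x0 = 0" using s(2) by (simp add: antisym)
    have s': "s \<in> {0<..T}" using s \<open>s > 0\<close> by auto
    obtain g1 where g1: "has_dirichlet_neumann (h1 s) (h1 s) g1"
      "\<And>x. ((\<lambda>\<tau>. h1 \<tau> x) has_real_derivative - g1 x) (at s within {0..s})"
      and d1: "\<And>x. h1 s differentiable (at x)" and p1: "periodic (h1 s)"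
      using h1 s s' unfolding classical_solution_def by blast
    obtain g2 where g2: "has_dirichlet_neumann (h2 s) (h2 s) g2"
      "\<And>x. ((\<lambda>\<tau>. h2 \<tau> x) has_real_derivative - g2 x) (at s within {0..s})"
      and d2: "\<And>x. h2 s differentiable (at x)" and p2: "periodic (h2 s)"
      using h2 s s' unfolding classical_solution_def by blast
    have cont: "continuous_on UNIV (h1 s)" "continuous_on UNIV (h2 s)"
      using d1 d2 by (auto intro!: differentiable_imp_continuous_on simp: differentiable_on_def)
    have "g2 x0 \<le> g1 (x0 + p)"
    proof (rule dirichlet_neumann_touching[OF cont(1) p1 cont(2) p2 g1(1) g2(1) p _ _ d1 d2])
      show "h1 s (y + p) \<le> h2 s y + (c + \<epsilon> * (1 + s))" for y using after[of y] by (simp add: m_def)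
      show "h1 s (x0 + p) = h2 s x0 + (c + \<epsilon> * (1 + s))" using m0 by (simp add: m_def)
    qed
    moreover have "((\<lambda>q. m q x0) has_real_derivative (- g2 x0 + \<epsilon> - - g1 (x0 + p))) (at s within {0..s})"
      unfolding m_def by (auto intro!: derivative_eq_intros g1(2) g2(2))
    then have "- g2 x0 + \<epsilon> - - g1 (x0 + p) \<le> 0"
    proof (rule derivative_le_if_quotients_le[OF _ nontriv])
      have "\<forall>q\<in>{0..s}. q \<noteq> s \<longrightarrow> (m q x0 - m s x0) / (q - s) \<le> 0"
        using before[of _ x0] s m0 by (force simp: divide_le_0_iff intro: less_imp_le)
      then show "\<forall>\<^sub>F q in at s within {0..s}. (m q x0 - m s x0) / (q - s) \<le> 0"
        by (auto simp: eventually_at_filter)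
    qed
    ultimately show False using \<epsilon> by simp
  qed
  show ?thesis
  proof (rule field_le_epsilon)
    fix e :: real assume "e > 0"
    then have "e / (1 + t) > 0" "1 + t > 0" using t by auto
    then show "h1 t (x + p) \<le> h2 t x + c + e" using eps[of "e / (1 + t)"] by simp
  qed
qed

section \<open>Fourier coefficients and the Sobolev embedding\<close>

definition wave :: "int^'n \<Rightarrow> real^'n \<Rightarrow> complex" where
  "wave k x = cis (\<Sum>i\<in>UNIV. of_int (k $ i) * x $ i)"

lemma norm_wave [simp]: "cmod (wave k x) = 1"
  by (simp add: wave_def)

lemma wave_0 [simp]: "wave 0 x = 1"
  by (simp add: wave_def)

lemma wave_add: "wave (k + l) x = wave k x * wave l x"
  by (simp add: wave_def cis_mult distrib_right sum.distrib)

lemma wave_minus: "wave (- k) x = cis (- (\<Sum>i\<in>UNIV. of_int (k $ i) * x $ i))"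
  by (simp add: wave_def sum_negf)

lemma wave_shift: "wave k (x + r *\<^sub>R axis i 1) = cis (of_int (k $ i) * r) * wave k x"
proof -
  have "of_int (k $ j) * (x + r *\<^sub>R axis i 1) $ j
      = of_int (k $ j) * x $ j + (if j = i then of_int (k $ i) * r else 0)" for j
    by (simp add: axis_def algebra_simps)
  then have "(\<Sum>j\<in>UNIV. of_int (k $ j) * (x + r *\<^sub>R axis i 1) $ j)
      = (\<Sum>j\<in>UNIV. of_int (k $ j) * x $ j) + of_int (k $ i) * r"
    by (simp only: sum.distrib) (simp add: sum.delta)
  then show ?thesis by (simp add: wave_def cis_mult add.commute)
qed

lemma wave_periodic: "wave k (x + axis i (2 * pi)) = wave k x"
proof -
  have "cis (of_int (k $ i) * (2 * pi)) = 1"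
    by (metis cis_multiple_2pi Ints_of_int mult.commute mult.left_commute mult.assoc)
  then show ?thesis using wave_shift[of k x "2 * pi" i] by (simp add: axis_as_scaleR[of i "2 * pi"])
qed

lemma continuous_on_wave [continuous_intros]:
  "continuous_on A f \<Longrightarrow> continuous_on A (\<lambda>x. wave k (f x))"
  unfolding wave_def by (intro continuous_intros)

text \<open>Shifting by half a wavelength in a direction where \<open>k\<close> is nonzero changes the sign of the wave but
  not its integral.\<close>

lemma integral_wave: "integral torus_cell (wave k) = (if k = 0 then of_real ((2 * pi) ^ CARD('n)) else 0)"
  for k :: "int^'n"
proof (cases "k = 0")
  case True
  have "measure lborel (cbox 0 (\<chi> i. 2 * pi) :: (real^'n) set) = (2 * pi) ^ CARD('n)"
    by (subst content_cbox_cart) (auto simp: interval_ne_empty_cart)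
  moreover have "wave k = (\<lambda>x. 1)" using True by auto
  ultimately show ?thesis using True by (simp add: torus_cell_def scaleR_conv_of_real)
next
  case False
  then obtain i where i: "k $ i \<noteq> 0" by (auto simp: vec_eq_iff)
  define r where "r = pi / \<bar>of_int (k $ i)\<bar>"
  have "of_int (k $ i) * r = pi \<or> of_int (k $ i) * r = - pi" using i by (auto simp: r_def abs_if)
  then have c: "cis (of_int (k $ i) * r) = -1" by (auto simp: cis_pi simp flip: cis_inverse)
  have "1 \<le> \<bar>real_of_int (k $ i)\<bar>" using i by (simp flip: of_int_abs)
  then have "r \<le> pi / 1" unfolding r_def by (intro divide_left_mono) auto
  moreover have "0 \<le> r" by (simp add: r_def)
  ultimately have r: "0 \<le> r" "r \<le> 2 * pi" using pi_gt_zero by linarith+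
  have "continuous_on UNIV (wave k)" using continuous_on_wave[OF continuous_on_id] by simp
  from integral_torus_cell_shift[OF wave_periodic this r, of i]
  have "integral torus_cell (\<lambda>x. (-1) * wave k x) = integral torus_cell (wave k)"
    unfolding wave_shift c .
  then have "- integral torus_cell (wave k) = integral torus_cell (wave k)" by simp
  then show ?thesis using False by (simp add: equation_minus_iff)
qed

lemma fourier_coeff_continuous:
  fixes f :: "real^'n \<Rightarrow> real"
  assumes "continuous_on UNIV f"
  shows "fourier_coeff f k
    = integral torus_cell (\<lambda>x. complex_of_real (f x) * wave (- k) x) / of_real ((2 * pi) ^ CARD('n))"
proof -
  have "continuous_on (cbox 0 (\<chi> i. 2 * pi)) (\<lambda>x. f x *\<^sub>R wave (- k) x)"
    by (intro continuous_intros continuous_on_subset[OF assms]) auto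
  from set_lebesgue_integral_eq_integral(2)[OF absolutely_integrable_continuous[OF this]]
  show ?thesis
    unfolding fourier_coeff_def wave_minus torus_cell_def by (simp add: scaleR_conv_of_real)
qed

definition trig_poly :: "(real^'n \<Rightarrow> real) \<Rightarrow> bool" where
  "trig_poly P \<longleftrightarrow> (\<exists>F c. finite F \<and> (\<forall>x. complex_of_real (P x) = (\<Sum>k\<in>F. c k * wave k x)))"

lemma trig_polyI:
  "finite F \<Longrightarrow> (\<And>x. complex_of_real (P x) = (\<Sum>k\<in>F. c k * wave k x)) \<Longrightarrow> trig_poly P"
  unfolding trig_poly_def by blast

lemma trig_polyE:
  assumes "trig_poly P"
  obtains F c where "finite F" "\<And>x. complex_of_real (P x) = (\<Sum>k\<in>F. c k * wave k x)"
  using assms unfolding trig_poly_def by blast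

lemma trig_poly_const: "trig_poly (\<lambda>x. a)"
  by (rule trig_polyI[of "{0}" _ "\<lambda>_. of_real a"]) auto

lemma trig_poly_cos: "trig_poly (\<lambda>x :: real^'n. cos (x $ i - t))"
proof (rule trig_polyI[of "{axis i 1, axis i (-1)}" _ "\<lambda>k. if k = axis i 1 then cis (- t) / 2 else cis t / 2"])
  fix x :: "real^'n"
  have ne: "axis i (1::int) \<noteq> (axis i (-1) :: int^'n)" by (simp add: axis_eq_axis)
  have "of_int (axis i c $ j) * x $ j = (if j = i then of_int c * x $ i else 0)" for c j
    by (simp add: axis_def)
  then have "wave (axis i c) x = cis (of_int c * x $ i)" for c
    by (simp only: wave_def) (simp add: sum.delta)
  then show "complex_of_real (cos (x $ i - t))
     = (\<Sum>k\<in>{axis i 1, axis i (-1)}. (if k = axis i 1 then cis (- t) / 2 else cis t / 2) * wave k x)"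
    using ne by (simp add: complex_eq_iff cos_diff sin_diff flip: add_divide_distrib)
qed simp

lemma trig_poly_add: "trig_poly P \<Longrightarrow> trig_poly Q \<Longrightarrow> trig_poly (\<lambda>x. P x + Q x)"
proof -
  assume P: "trig_poly P" and Q: "trig_poly Q"
  obtain F c where F: "finite F" "\<And>x. complex_of_real (P x) = (\<Sum>k\<in>F. c k * wave k x)"
    using trig_polyE[OF P] by blast
  obtain G d where G: "finite G" "\<And>x. complex_of_real (Q x) = (\<Sum>k\<in>G. d k * wave k x)"
    using trig_polyE[OF Q] by blast
  define c' d' where "c' k = (if k \<in> F then c k else 0)" "d' k = (if k \<in> G then d k else 0)" for k
  show ?thesis
  proof (rule trig_polyI[of "F \<union> G" _ "\<lambda>k. c' k + d' k"])
    fix x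
    have "(\<Sum>k\<in>F \<union> G. c' k * wave k x) = (\<Sum>k\<in>F. c k * wave k x)"
         "(\<Sum>k\<in>F \<union> G. d' k * wave k x) = (\<Sum>k\<in>G. d k * wave k x)"
      using F(1) G(1) by (auto intro!: sum.mono_neutral_cong_right simp: c'_d'_def)
    then show "complex_of_real (P x + Q x) = (\<Sum>k\<in>F \<union> G. (c' k + d' k) * wave k x)"
      using F(2) G(2) by (simp add: distrib_right sum.distrib)
  qed (use F G in auto)
qed

text \<open>Collecting equal frequencies keeps the coefficients of a product indexed by frequencies, so that
  they remain Fourier coefficients.\<close>

lemma trig_poly_mult: "trig_poly P \<Longrightarrow> trig_poly Q \<Longrightarrow> trig_poly (\<lambda>x. P x * Q x)"
proof -
  assume P: "trig_poly P" and Q: "trig_poly Q"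
  obtain F c where F: "finite F" "\<And>x. complex_of_real (P x) = (\<Sum>k\<in>F. c k * wave k x)"
    using trig_polyE[OF P] by blast
  obtain G d where G: "finite G" "\<And>x. complex_of_real (Q x) = (\<Sum>k\<in>G. d k * wave k x)"
    using trig_polyE[OF Q] by blast
  define H where "H = (\<lambda>(k, l). k + l) ` (F \<times> G)"
  define e where "e m = (\<Sum>(k, l)\<in>{p \<in> F \<times> G. (\<lambda>(k, l). k + l) p = m}. c k * d l)" for m
  have fin: "finite (F \<times> G)" "finite H" using F G by (auto simp: H_def)
  show ?thesis
  proof (rule trig_polyI[OF fin(2), of _ e])
    fix x
    have "complex_of_real (P x * Q x) = (\<Sum>(k, l)\<in>F \<times> G. (c k * wave k x) * (d l * wave l x))"
      using F(2) G(2) by (simp add: sum_product sum.cartesian_product)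
    also have "\<dots> = (\<Sum>p\<in>F \<times> G. c (fst p) * d (snd p) * wave (fst p + snd p) x)"
      by (intro sum.cong) (auto simp: wave_add)
    also have "\<dots> = (\<Sum>m\<in>H. \<Sum>p\<in>{p \<in> F \<times> G. (\<lambda>(k, l). k + l) p = m}.
        c (fst p) * d (snd p) * wave (fst p + snd p) x)"
      by (rule sum.group[symmetric, OF fin]) (auto simp: H_def)
    also have "\<dots> = (\<Sum>m\<in>H. e m * wave m x)"
      unfolding e_def sum_distrib_right by (intro sum.cong) auto
    finally show "complex_of_real (P x * Q x) = (\<Sum>m\<in>H. e m * wave m x)" .
  qed
qed

lemma trig_poly_sum: "finite A \<Longrightarrow> (\<And>i. i \<in> A \<Longrightarrow> trig_poly (P i)) \<Longrightarrow> trig_poly (\<lambda>x. \<Sum>i\<in>A. P i x)"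
  by (induction rule: finite_induct) (auto intro: trig_poly_const trig_poly_add)

lemma trig_poly_power: "trig_poly P \<Longrightarrow> trig_poly (\<lambda>x. P x ^ m)"
  by (induction m) (auto intro: trig_poly_const trig_poly_mult)

text \<open>Expand \<open>P\<close>: by orthogonality its coefficients are integrals of \<open>P\<close> against waves, and since \<open>P\<close> is
  nonnegative each is bounded by the integral of \<open>P\<close> itself.\<close>

lemma integral_mult_trig_poly_le:
  fixes f P :: "real^'n \<Rightarrow> real"
  assumes f: "continuous_on UNIV f" and A: "\<And>F. finite F \<Longrightarrow> (\<Sum>k\<in>F. cmod (fourier_coeff f k)) \<le> A"
    and P: "trig_poly P" "continuous_on UNIV P" "\<And>x. 0 \<le> P x"
  shows "integral torus_cell (\<lambda>x. f x * P x) \<le> A * integral torus_cell P"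
proof -
  obtain F c where F: "finite F" "\<And>x. complex_of_real (P x) = (\<Sum>k\<in>F. c k * wave k x)"
    using trig_polyE[OF P(1)] by blast
  let ?V = "complex_of_real ((2 * pi) ^ CARD('n))"
  note ints = continuous_integrable_torus_cell
  have of_real: "integral torus_cell (\<lambda>x. complex_of_real (g x)) = complex_of_real (integral torus_cell g)"
    if "continuous_on UNIV g" for g :: "real^'n \<Rightarrow> real"
    using integral_linear[OF ints[OF that] bounded_linear_of_real] by (simp add: o_def)
  have coef: "cmod (c k * ?V) \<le> integral torus_cell P" if "k \<in> F" for k
  proof -
    have "integral torus_cell (\<lambda>x. complex_of_real (P x) * wave (- k) x)
        = integral torus_cell (\<lambda>x. \<Sum>l\<in>F. c l * wave (l + - k) x)"
      unfolding F(2) wave_add by (simp add: sum_distrib_right mult.assoc)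
    also have "\<dots> = (\<Sum>l\<in>F. integral torus_cell (\<lambda>x. c l * wave (l + - k) x))"
      by (intro integral_sum F ints continuous_intros)
    also have "\<dots> = (\<Sum>l\<in>F. c l * (if l = k then ?V else 0))"
      unfolding integral_mult_right integral_wave by (intro sum.cong) auto
    also have "\<dots> = c k * ?V" using F(1) that by (simp add: if_distrib sum.delta cong: if_cong)
    finally have "cmod (c k * ?V) = cmod (integral torus_cell (\<lambda>x. complex_of_real (P x) * wave (- k) x))"
      by simp
    also have "\<dots> \<le> integral torus_cell P"
      by (rule integral_norm_bound_integral)
         (use P in \<open>auto simp: norm_mult intro!: ints continuous_intros\<close>)
    finally show ?thesis .
  qed
  have "complex_of_real (integral torus_cell (\<lambda>x. f x * P x))
      = integral torus_cell (\<lambda>x. complex_of_real (f x) * complex_of_real (P x))"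
    by (subst of_real[symmetric]) (auto intro!: continuous_intros f P)
  also have "\<dots> = integral torus_cell (\<lambda>x. \<Sum>k\<in>F. c k * (complex_of_real (f x) * wave k x))"
    unfolding F(2) by (simp add: sum_distrib_left mult_ac)
  also have "\<dots> = (\<Sum>k\<in>F. integral torus_cell (\<lambda>x. c k * (complex_of_real (f x) * wave k x)))"
    by (intro integral_sum F ints continuous_intros f)
  also have "\<dots> = (\<Sum>k\<in>F. c k * ?V * fourier_coeff f (- k))"
    unfolding integral_mult_right fourier_coeff_continuous[OF f] by simp
  finally have eq: "complex_of_real (integral torus_cell (\<lambda>x. f x * P x)) = (\<Sum>k\<in>F. c k * ?V * fourier_coeff f (- k))" .
  have "integral torus_cell (\<lambda>x. f x * P x) \<le> cmod (complex_of_real (integral torus_cell (\<lambda>x. f x * P x)))"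
    by simp
  also have "\<dots> \<le> (\<Sum>k\<in>F. cmod (c k * ?V * fourier_coeff f (- k)))"
    unfolding eq by (rule norm_sum)
  also have "\<dots> \<le> (\<Sum>k\<in>F. integral torus_cell P * cmod (fourier_coeff f (- k)))"
    using coef by (intro sum_mono) (simp add: norm_mult mult_right_mono)
  also have "\<dots> = integral torus_cell P * (\<Sum>k\<in>uminus ` F. cmod (fourier_coeff f k))"
    by (simp add: sum_distrib_left sum.reindex)
  also have "\<dots> \<le> integral torus_cell P * A"
    using F(1) P by (intro mult_left_mono A integral_nonneg ints) auto
  finally show ?thesis by (simp add: mult.commute)
qed

text \<open>Suppose \<open>f x0 > A\<close> at an interior point \<open>x0\<close> of the cell. The polynomial
  \<open>Q x = \<Sum>\<^sub>i (1 + cos (x\<^sub>i - x0\<^sub>i))\<close> has its only maximum on the cell at \<open>x0\<close>, so for large \<open>N\<close> the integral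
  of \<open>(f - A) Q\<^sup>N\<close> is dominated by a neighbourhood of \<open>x0\<close> and is positive. This contradicts the
  preceding lemma with \<open>P = Q\<^sup>N\<close>.\<close>

lemma le_sum_fourier_coeffs:
  fixes f :: "real^'n \<Rightarrow> real"
  assumes f: "continuous_on UNIV f" and per: "periodic f"
    and A: "\<And>F. finite F \<Longrightarrow> (\<Sum>k\<in>F. cmod (fourier_coeff f k)) \<le> A"
  shows "f x \<le> A"
proof -
  let ?B = "box 0 (\<chi> i. 2 * pi) :: (real^'n) set"
  have ne: "?B \<noteq> {}" by (simp add: interval_ne_empty_cart)
  have interior: "f x0 \<le> A" if x0: "x0 \<in> ?B" for x0
  proof (rule ccontr)
    assume "\<not> f x0 \<le> A"
    define \<epsilon> where "\<epsilon> = (f x0 - A) / 2"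
    have \<epsilon>: "\<epsilon> > 0" "f x0 - A > \<epsilon>" using \<open>\<not> f x0 \<le> A\<close> by (auto simp: \<epsilon>_def)
    define n where "n = real CARD('n)"
    have n: "n \<ge> 1" by (simp add: n_def Suc_leI)
    define Q where "Q x = n + (\<Sum>i\<in>UNIV. cos (x $ i - x0 $ i))" for x :: "real^'n"
    have Q_cont: "continuous_on S Q" for S unfolding Q_def by (intro continuous_intros)
    have Q_nonneg: "0 \<le> Q x" for x
    proof -
      have "(\<Sum>i\<in>(UNIV :: 'n set). - 1) \<le> (\<Sum>i\<in>UNIV. cos (x $ i - x0 $ i))"
        by (intro sum_mono) (simp add: cos_ge_minus_one)
      then show ?thesis by (simp add: Q_def n_def)
    qed
    have "trig_poly Q"
      unfolding Q_def by (intro trig_poly_add trig_poly_const trig_poly_sum trig_poly_cos) auto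
    then have trig: "trig_poly (\<lambda>x. Q x ^ m)" for m by (rule trig_poly_power)
    define U where "U = ?B \<inter> {x. f x - A > \<epsilon>}"
    have "open U"
      unfolding U_def by (intro open_Int open_box open_Collect_less continuous_intros f)
    have "x0 \<in> U" using x0 \<epsilon> by (simp add: U_def)
    have U_cell: "U \<subseteq> torus_cell" using box_subset_cbox by (auto simp: U_def torus_cell_def)
    have Q_less: "Q y < 2 * n" if "y \<in> torus_cell - U" for y
    proof -
      have "y \<noteq> x0" using that \<open>x0 \<in> U\<close> by auto
      then obtain i where i: "y $ i \<noteq> x0 $ i" by (auto simp: vec_eq_iff)
      have "0 < x0 $ i" "x0 $ i < 2 * pi" "0 \<le> y $ i" "y $ i \<le> 2 * pi"
        using x0 that by (auto simp: mem_box_cart torus_cell_eq)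
      \<comment> \<open>Strict because \<open>x0\<close> is an interior point, so no coordinate differs by a full period.\<close>
      then have "\<bar>y $ i - x0 $ i\<bar> < 2 * pi" by auto
      moreover have "m = 0" if "\<bar>real_of_int m\<bar> < 1" for m using that by linarith
      ultimately have "cos (y $ i - x0 $ i) \<noteq> 1"
        using i by (force simp: cos_one_2pi_int abs_mult)
      then have "cos (y $ i - x0 $ i) < 1" by (simp only: less_le cos_le_one simp_thms)
      then have "(\<Sum>i\<in>UNIV. cos (y $ i - x0 $ i)) < (\<Sum>i\<in>(UNIV :: 'n set). 1)"
        by (intro sum_strict_mono_ex1) auto
      then show ?thesis by (simp add: Q_def n_def)
    qed
    obtain q where q: "1 \<le> q" "q < 2 * n" "\<And>y. y \<in> torus_cell - U \<Longrightarrow> Q y \<le> q"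
    proof (cases "torus_cell - U = {}")
      case True
      then show thesis using that[of 1] n by auto
    next
      case False
      have "compact (torus_cell - U)" by (rule compact_diff[OF compact_torus_cell \<open>open U\<close>])
      then obtain y where y: "y \<in> torus_cell - U" "\<And>z. z \<in> torus_cell - U \<Longrightarrow> Q z \<le> Q y"
        using continuous_attains_sup[OF _ False Q_cont] by metis
      show thesis
        using that[of "max 1 (Q y)"] y Q_less[OF y(1)] n by (auto simp: le_max_iff_disj)
    qed
    \<comment> \<open>Off \<open>U\<close> one has \<open>Q \<le> q\<close>, while \<open>Q > q'\<close> near \<open>x0\<close>, where \<open>Q\<close> attains its maximum \<open>2 n\<close>.\<close>
    define q' where "q' = (q + 2 * n) / 2"
    have q': "q < q'" "q' < 2 * n" using q by (auto simp: q'_def)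
    have "open (U \<inter> {x. q' < Q x})"
      by (intro open_Int \<open>open U\<close> open_Collect_less continuous_intros Q_cont)
    moreover have "x0 \<in> U \<inter> {x. q' < Q x}" using \<open>x0 \<in> U\<close> q' by (simp add: Q_def n_def)
    ultimately obtain a b where ab: "cbox a b \<subseteq> U \<inter> {x. q' < Q x}" "x0 \<in> box a b"
      using open_contains_cbox by metis
    define m where "m = measure lborel (cbox a b)"
    have "m > 0" using ab(2) unfolding m_def content_pos_lt_eq by (auto simp: mem_box intro: less_trans)
    define V where "V = measure lborel (torus_cell :: (real^'n) set)"
    have "bounded ((\<lambda>x. f x - A) ` torus_cell)"
      by (intro compact_imp_bounded compact_continuous_image compact_torus_cell continuous_intros
           continuous_on_subset[OF f]) auto
    then obtain C where C: "\<And>x. x \<in> torus_cell \<Longrightarrow> \<bar>f x - A\<bar> \<le> C"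
      unfolding bounded_iff by auto
    have "0 \<le> C" using C[of x0] U_cell \<open>x0 \<in> U\<close> by force
    have bound: "\<epsilon> * m * q' ^ N \<le> C * V * q ^ N" for N
    proof -
      define g where "g x = (f x - A) * Q x ^ N + C * q ^ N" for x
      have g_cont: "continuous_on S g" for S
        unfolding g_def by (intro continuous_intros Q_cont continuous_on_subset[OF f]) auto
      have g_int: "g integrable_on cbox a' b'" for a' b'
        by (intro integrable_continuous g_cont)
      have g_nonneg: "0 \<le> g x" if "x \<in> torus_cell" for x
      proof (cases "x \<in> U")
        case True
        then have "0 \<le> (f x - A) * Q x ^ N" using \<epsilon> Q_nonneg by (auto simp: U_def)
        then show ?thesis using \<open>0 \<le> C\<close> q by (simp add: g_def)
      next
        case False
        have "Q x ^ N \<le> q ^ N" using q(3)[of x] that False Q_nonneg by (intro power_mono) auto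
        then have "\<bar>f x - A\<bar> * Q x ^ N \<le> C * q ^ N"
          using C[OF that] Q_nonneg \<open>0 \<le> C\<close> by (intro mult_mono) auto
        moreover have "- (\<bar>f x - A\<bar> * Q x ^ N) \<le> (f x - A) * Q x ^ N"
          using mult_right_mono[of "- \<bar>f x - A\<bar>" "f x - A" "Q x ^ N"] Q_nonneg by simp
        ultimately show ?thesis by (simp add: g_def)
      qed
      have "\<epsilon> * m * q' ^ N = integral (cbox a b) (\<lambda>x. \<epsilon> * q' ^ N)"
        by (simp add: m_def)
      also have "\<dots> \<le> integral (cbox a b) g"
      proof (intro integral_le g_int)
        fix x assume x: "x \<in> cbox a b"
        then have "\<epsilon> * q' ^ N \<le> (f x - A) * Q x ^ N"
          using ab(1) \<epsilon> q q' by (intro mult_mono power_mono) (auto simp: U_def)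
        moreover have "0 \<le> C * q ^ N" using \<open>0 \<le> C\<close> q(1) by simp
        ultimately show "\<epsilon> * q' ^ N \<le> g x" unfolding g_def by linarith
      qed (rule integrable_const)
      also have "\<dots> \<le> integral torus_cell g"
        using ab(1) U_cell g_nonneg g_int unfolding torus_cell_def
        by (intro integral_subset_le) auto
      also have "\<dots> = integral torus_cell (\<lambda>x. f x * Q x ^ N) - A * integral torus_cell (\<lambda>x. Q x ^ N) + C * V * q ^ N"
      proof -
        have i: "(\<lambda>x. f x * Q x ^ N) integrable_on torus_cell" "(\<lambda>x. A * Q x ^ N) integrable_on torus_cell"
          "(\<lambda>x :: real^'n. C * q ^ N) integrable_on torus_cell"
          by (intro continuous_integrable_torus_cell continuous_intros Q_cont f)+
        have "g = (\<lambda>x. f x * Q x ^ N - A * Q x ^ N + C * q ^ N)"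
          by (auto simp: g_def algebra_simps)
        then have "integral torus_cell g = integral torus_cell (\<lambda>x. f x * Q x ^ N)
            - integral torus_cell (\<lambda>x. A * Q x ^ N) + integral torus_cell (\<lambda>x :: real^'n. C * q ^ N)"
          by (simp only: integral_add[OF integrable_diff[OF i(1,2)] i(3)] integral_diff[OF i(1,2)])
        also have "integral torus_cell (\<lambda>x :: real^'n. C * q ^ N) = C * V * q ^ N"
          by (simp add: V_def torus_cell_def)
        finally show ?thesis by (simp only: integral_mult_right)
      qed
      also have "integral torus_cell (\<lambda>x. f x * Q x ^ N) \<le> A * integral torus_cell (\<lambda>x. Q x ^ N)"
        by (rule integral_mult_trig_poly_le[OF f A trig])
           (use Q_nonneg Q_cont in \<open>auto intro!: continuous_intros\<close>)
      finally show ?thesis by simp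
    qed
    have "1 < q' / q" using q q' by simp
    then obtain N where N: "C * V / (\<epsilon> * m) < (q' / q) ^ N" using real_arch_pow by metis
    have "C * V * q ^ N < \<epsilon> * m * q' ^ N"
      using N q \<epsilon> \<open>m > 0\<close> by (simp add: power_divide field_simps)
    then show False using bound[of N] by simp
  qed
  obtain x' where x': "x' \<in> torus_cell" "f x' = f x" using reduce_to_torus_cell[of x] per by metis
  have "f x' \<le> A"
    by (rule continuous_le_on_closure[of ?B])
       (use x'(1) interior ne in \<open>auto simp: torus_cell_def intro: continuous_on_subset[OF f]\<close>)
  then show ?thesis using x' by simp
qed

lemma abs_le_sum_fourier_coeffs:
  fixes f :: "real^'n \<Rightarrow> real"
  assumes f: "continuous_on UNIV f" and per: "periodic f"
    and A: "\<And>F. finite F \<Longrightarrow> (\<Sum>k\<in>F. cmod (fourier_coeff f k)) \<le> A"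
  shows "\<bar>f x\<bar> \<le> A"
proof -
  have "fourier_coeff (\<lambda>x. - f x) k = - fourier_coeff f k" for k
    by (simp add: fourier_coeff_continuous f continuous_on_minus)
  then have "- f x \<le> A"
    using A per by (intro le_sum_fourier_coeffs[of "\<lambda>x. - f x"] continuous_on_minus f) (auto simp: periodic_def)
  then show ?thesis using le_sum_fourier_coeffs[OF assms, of x] by simp
qed

text \<open>Each factor \<open>1 + k\<^sub>i\<^sup>2\<close> is at most \<open>1 + |k|\<^sup>2\<close>, so the summand is at most the product over \<open>i\<close> of
  \<open>(1 + k\<^sub>i\<^sup>2)\<close> to the power \<open>- s / n\<close>. This reduces the claim to one dimension, where \<open>2 s / n > 1\<close>.\<close>

lemma lattice_sum_bounded:
  assumes s: "s > real CARD('n) / 2"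
  obtains C where "\<And>F :: (int^'n) set. finite F \<Longrightarrow>
    (\<Sum>k\<in>F. (1 + (\<Sum>i\<in>UNIV. (real_of_int (k $ i))\<^sup>2)) powr (- s)) \<le> C"
proof -
  define n where "n = real CARD('n)"
  have n: "n > 0" by (simp add: n_def)
  define a where "a = s / n"
  have a: "a > 1 / 2" using s n by (simp add: a_def n_def[symmetric] field_simps)
  define g where "g j = (1 + (real_of_int j)\<^sup>2) powr (- a)" for j
  have g_nonneg: "0 \<le> g j" for j by (simp add: g_def)
  have "summable (\<lambda>j. g (int j))"
  proof (rule summable_comparison_test')
    show "summable (\<lambda>j. real j powr (- 2 * a))" using a by (subst summable_real_powr_iff) simp
    fix j :: nat assume "1 \<le> j"
    then have "g (int j) \<le> ((real j)\<^sup>2) powr (- a)"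
      unfolding g_def using a by (intro powr_mono2') auto
    also have "((real j)\<^sup>2) powr (- a) = real j powr (- 2 * a)"
      using \<open>1 \<le> j\<close> by (simp add: powr_powr flip: powr_numeral)
    finally show "norm (g (int j)) \<le> real j powr (- 2 * a)" using g_nonneg by simp
  qed
  note summ = this
  define Z where "Z = 2 * (\<Sum>j. g (int j))"
  have line: "(\<Sum>j\<in>{- int m..int m}. g j) \<le> Z" for m
  proof -
    have "(\<Sum>j\<in>{- int m..int m}. g j) \<le> (\<Sum>j\<in>int ` {..m} \<union> (\<lambda>j. - int j) ` {..m}. g j)"
    proof (intro sum_mono2)
      show "{- int m..int m} \<subseteq> int ` {..m} \<union> (\<lambda>j. - int j) ` {..m}"
      proof
        fix j assume "j \<in> {- int m..int m}"
        then have "(j = int (nat \<bar>j\<bar>) \<or> j = - int (nat \<bar>j\<bar>)) \<and> nat \<bar>j\<bar> \<in> {..m}" by auto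
        then show "j \<in> int ` {..m} \<union> (\<lambda>j. - int j) ` {..m}" by blast
      qed
    qed (auto simp: g_nonneg)
    also have "\<dots> \<le> (\<Sum>j\<in>int ` {..m}. g j) + (\<Sum>j\<in>(\<lambda>j. - int j) ` {..m}. g j)"
    proof -
      have "(\<Sum>j\<in>int ` {..m} \<union> (\<lambda>j. - int j) ` {..m}. g j) + (\<Sum>j\<in>int ` {..m} \<inter> (\<lambda>j. - int j) ` {..m}. g j)
          = (\<Sum>j\<in>int ` {..m}. g j) + (\<Sum>j\<in>(\<lambda>j. - int j) ` {..m}. g j)"
        by (rule sum.union_inter) auto
      moreover have "0 \<le> (\<Sum>j\<in>int ` {..m} \<inter> (\<lambda>j. - int j) ` {..m}. g j)"
        by (intro sum_nonneg g_nonneg)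
      ultimately show ?thesis by linarith
    qed
    also have "(\<Sum>j\<in>int ` {..m}. g j) = (\<Sum>j\<le>m. g (int j))"
      by (subst sum.reindex) (auto simp: inj_on_def)
    also have "(\<Sum>j\<in>(\<lambda>j. - int j) ` {..m}. g j) = (\<Sum>j\<le>m. g (int j))"
      by (subst sum.reindex) (auto simp: inj_on_def g_def)
    also have "(\<Sum>j\<le>m. g (int j)) + (\<Sum>j\<le>m. g (int j)) = 2 * (\<Sum>j\<le>m. g (int j))" by simp
    also have "\<dots> \<le> Z"
      unfolding Z_def using sum_le_suminf[OF summ] g_nonneg by auto
    finally show ?thesis .
  qed
  have "(\<Sum>k\<in>F. (1 + (\<Sum>i\<in>UNIV. (real_of_int (k $ i))\<^sup>2)) powr (- s)) \<le> Z ^ CARD('n)"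
    if F: "finite F" for F :: "(int^'n) set"
  proof -
    have "finite ((\<lambda>(k, i). nat \<bar>k $ i\<bar>) ` (F \<times> UNIV))" using F by auto
    then obtain m where m: "\<And>k i. k \<in> F \<Longrightarrow> nat \<bar>k $ i\<bar> \<le> m"
      by (auto simp: finite_nat_set_iff_bounded_le)
    have "(\<Sum>k\<in>F. (1 + (\<Sum>i\<in>UNIV. (real_of_int (k $ i))\<^sup>2)) powr (- s)) \<le> (\<Sum>k\<in>F. \<Prod>i\<in>UNIV. g (k $ i))"
    proof (intro sum_mono)
      fix k :: "int^'n"
      let ?w = "1 + (\<Sum>i\<in>UNIV. (real_of_int (k $ i))\<^sup>2)"
      have w: "1 + (real_of_int (k $ i))\<^sup>2 \<le> ?w" for i
        using member_le_sum[of i UNIV "\<lambda>i. (real_of_int (k $ i))\<^sup>2"] by simp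
      have "?w > 0" by (intro add_pos_nonneg sum_nonneg) auto
      have "?w powr (- s) = ?w powr (- a * n)" using n by (simp add: a_def)
      also have "\<dots> = (?w powr (- a)) ^ CARD('n)"
      proof -
        have "?w powr (- a) > 0" using \<open>?w > 0\<close> by simp
        from powr_realpow[OF this, of "CARD('n)"] show ?thesis by (simp only: n_def powr_powr)
      qed
      also have "\<dots> = (\<Prod>i\<in>(UNIV :: 'n set). ?w powr (- a))" by simp
      also have "\<dots> \<le> (\<Prod>i\<in>UNIV. g (k $ i))"
        unfolding g_def using w a
        by (intro prod_mono conjI powr_mono2') (auto intro: add_pos_nonneg)
      finally show "?w powr (- s) \<le> (\<Prod>i\<in>UNIV. g (k $ i))" .
    qed
    also have "\<dots> = (\<Sum>p\<in>vec_nth ` F. \<Prod>i\<in>UNIV. g (p i))"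
      by (subst sum.reindex) (auto simp: inj_on_def vec_nth_inject)
    also have "\<dots> \<le> (\<Sum>p\<in>PiE (UNIV :: 'n set) (\<lambda>_. {- int m..int m}). \<Prod>i\<in>UNIV. g (p i))"
    proof (intro sum_mono2)
      show "vec_nth ` F \<subseteq> PiE UNIV (\<lambda>_. {- int m..int m})"
      proof
        fix p assume "p \<in> vec_nth ` F"
        then obtain k where k: "k \<in> F" "p = vec_nth k" by auto
        have "p i \<in> {- int m..int m}" for i using m[OF k(1), of i] k(2) by auto
        then show "p \<in> PiE UNIV (\<lambda>_. {- int m..int m})" by auto
      qed
    qed (auto intro!: finite_PiE prod_nonneg simp: g_nonneg)
    also have "\<dots> = (\<Prod>i\<in>(UNIV :: 'n set). \<Sum>j\<in>{- int m..int m}. g j)"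
      by (rule prod_sum_PiE[symmetric]) auto
    also have "\<dots> \<le> (\<Prod>i\<in>(UNIV :: 'n set). Z)"
      using line by (intro prod_mono) (auto intro!: sum_nonneg simp: g_nonneg)
    finally show ?thesis by simp
  qed
  then show thesis by (rule that)
qed

lemma sobolev_term_nonneg: "0 \<le> sobolev_term s f k"
  by (simp add: sobolev_term_def)

text \<open>The Cauchy-Schwarz inequality bounds the sum of the Fourier coefficients by the Sobolev norm
  times a lattice sum. The norm enters through finite partial sums, since an infinite sum has the
  default value 0 when it does not converge.\<close>

lemma sobolev_embedding:
  assumes s: "s > real CARD('n) / 2"
  obtains C where "C \<ge> 0" "\<And>(f :: real^'n \<Rightarrow> real) B x. continuous_on UNIV f \<Longrightarrow> periodic f \<Longrightarrow>
    (\<And>F. finite F \<Longrightarrow> sum (sobolev_term s f) F \<le> B) \<Longrightarrow> \<bar>f x\<bar> \<le> C * sqrt B"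
proof -
  define w where "w k = 1 + (\<Sum>i\<in>UNIV. (real_of_int (k $ i))\<^sup>2)" for k :: "int^'n"
  have w: "w k > 0" for k unfolding w_def by (intro add_pos_nonneg sum_nonneg) auto
  obtain C where C: "\<And>F. finite F \<Longrightarrow> (\<Sum>k\<in>F. w k powr (- s)) \<le> C"
    using lattice_sum_bounded[OF s] unfolding w_def by blast
  have "C \<ge> 0" using C[of "{}"] by simp
  show thesis
  proof (rule that[of "sqrt C"])
    fix f :: "real^'n \<Rightarrow> real" and B x
    assume f: "continuous_on UNIV f" "periodic f" and B: "\<And>F. finite F \<Longrightarrow> sum (sobolev_term s f) F \<le> B"
    show "\<bar>f x\<bar> \<le> sqrt C * sqrt B"
    proof (rule abs_le_sum_fourier_coeffs[OF f])
      fix F :: "(int^'n) set" assume F: "finite F"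
      have "(\<Sum>k\<in>F. cmod (fourier_coeff f k))
          = (\<Sum>k\<in>F. \<bar>w k powr (- s / 2)\<bar> * \<bar>w k powr (s / 2) * cmod (fourier_coeff f k)\<bar>)"
        using less_imp_neq[OF w] by (intro sum.cong refl) (simp add: abs_mult powr_minus field_simps)
      also have "\<dots> \<le> L2_set (\<lambda>k. w k powr (- s / 2)) F * L2_set (\<lambda>k. w k powr (s / 2) * cmod (fourier_coeff f k)) F"
        by (rule L2_set_mult_ineq)
      also have "\<dots> = sqrt (\<Sum>k\<in>F. w k powr (- s)) * sqrt (sum (sobolev_term s f) F)"
        unfolding L2_set_def sobolev_term_def w_def[symmetric]
        by (simp add: power_mult_distrib power2_eq_square[of "w _ powr _"] flip: powr_add)
      also have "\<dots> \<le> sqrt C * sqrt B"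
        using C[OF F] B[OF F] \<open>C \<ge> 0\<close>
        by (intro mult_mono real_sqrt_le_mono) (auto intro!: sum_nonneg sobolev_term_nonneg)
      finally show "(\<Sum>k\<in>F. cmod (fourier_coeff f k)) \<le> sqrt C * sqrt B" .
    qed
  qed (use \<open>C \<ge> 0\<close> in simp)
qed

text \<open>The derivative of \<open>f\<close> times a wave integrates to zero over the cell.\<close>

lemma fourier_coeff_derivative:
  fixes f f' :: "real^'n \<Rightarrow> real"
  assumes f: "continuous_on UNIV f" "periodic f" and f': "continuous_on UNIV f'"
    and der: "\<And>x. ((\<lambda>r. f (x + r *\<^sub>R axis i 1)) has_real_derivative f' x) (at 0)"
  shows "fourier_coeff f' k = \<i> * of_int (k $ i) * fourier_coeff f k"
proof -
  define g where "g x = complex_of_real (f x) * wave (- k) x" for x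
  define g' where "g' x = complex_of_real (f' x) * wave (- k) x
      + (- (\<i> * of_int (k $ i))) * (complex_of_real (f x) * wave (- k) x)" for x
  have c: "continuous_on UNIV (\<lambda>x. complex_of_real (f x) * wave (- k) x)"
    "continuous_on UNIV (\<lambda>x. complex_of_real (f' x) * wave (- k) x)"
    by (intro continuous_intros f f')+
  have "integral torus_cell g' = 0"
  proof (rule integral_torus_cell_derivative[where g = g and i = i])
    show "g (x + axis i (2 * pi)) = g x" for x
      using f(2) by (simp add: g_def wave_periodic periodic_def)
    show "continuous_on UNIV g" unfolding g_def by (rule c)
    show "continuous_on UNIV g'" unfolding g'_def by (intro continuous_intros c f f')
    fix x
    have "((\<lambda>r. complex_of_real (f (x + r *\<^sub>R axis i 1))) has_vector_derivative complex_of_real (f' x)) (at 0)"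
      by (rule has_vector_derivative_of_real[OF der])
    moreover have "((\<lambda>r. wave (- k) (x + r *\<^sub>R axis i 1)) has_vector_derivative
        - (\<i> * of_int (k $ i)) * wave (- k) x) (at 0)"
      unfolding wave_shift has_vector_derivative_def
      by (auto intro!: derivative_eq_intros simp: scaleR_conv_of_real algebra_simps)
    ultimately have D: "((\<lambda>r. g (x + r *\<^sub>R axis i 1)) has_vector_derivative
        complex_of_real (f (x + 0 *\<^sub>R axis i 1)) * (- (\<i> * of_int (k $ i)) * wave (- k) x)
        + complex_of_real (f' x) * wave (- k) (x + 0 *\<^sub>R axis i 1)) (at 0)"
      unfolding g_def by (rule has_vector_derivative_mult)
    have "complex_of_real (f (x + 0 *\<^sub>R axis i 1)) * (- (\<i> * of_int (k $ i)) * wave (- k) x)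
        + complex_of_real (f' x) * wave (- k) (x + 0 *\<^sub>R axis i 1) = g' x"
      by (simp add: g'_def algebra_simps)
    with D show "((\<lambda>r. g (x + r *\<^sub>R axis i 1)) has_vector_derivative g' x) (at 0)" by simp
  qed
  moreover have "integral torus_cell g' = integral torus_cell (\<lambda>x. complex_of_real (f' x) * wave (- k) x)
      + (- (\<i> * of_int (k $ i))) * integral torus_cell (\<lambda>x. complex_of_real (f x) * wave (- k) x)"
    unfolding g'_def
    by (simp only: integral_mult_right integral_add[OF continuous_integrable_torus_cell[OF c(2)]
          integrable_on_mult_right[OF continuous_integrable_torus_cell[OF c(1)]]])
  moreover have "a = b * d" if "a + (- b) * d = 0" for a b d :: complex
    using that by simp
  ultimately have "integral torus_cell (\<lambda>x. complex_of_real (f' x) * wave (- k) x)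
      = \<i> * of_int (k $ i) * integral torus_cell (\<lambda>x. complex_of_real (f x) * wave (- k) x)"
    by metis
  then show ?thesis by (simp add: fourier_coeff_continuous f f')
qed

section \<open>Differences of Sobolev functions\<close>

lemma torus_cell_lebesgue: "torus_cell \<in> sets lebesgue"
  by (simp add: torus_cell_def)

text \<open>A square integrable function on a set of finite measure is integrable, by \<open>|f| \<le> 1 + f\<^sup>2\<close>. The
  integral defining a Fourier coefficient is therefore additive on \<open>sobolev s\<close>.\<close>

lemma sobolev_integrable:
  fixes f :: "real^'n \<Rightarrow> real"
  assumes f: "f \<in> sobolev s"
  shows "set_integrable lebesgue torus_cell
           (\<lambda>x. f x *\<^sub>R cis (- (\<Sum>i\<in>UNIV. of_int (k $ i) * x $ i)))"
proof -
  have f2: "set_integrable lebesgue torus_cell (\<lambda>x. (f x)\<^sup>2)" and fm: "f \<in> borel_measurable lebesgue"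
    using f by (auto simp: sobolev_def)
  have "set_integrable lebesgue torus_cell (\<lambda>x. 1 :: real)"
    unfolding torus_cell_def by (rule absolutely_integrable_continuous[OF continuous_on_const])
  from set_integral_add(1)[OF this f2]
  have dom: "integrable lebesgue (\<lambda>x. indicator torus_cell x *\<^sub>R (1 + (f x)\<^sup>2))"
    unfolding set_integrable_def .
  have "continuous_on UNIV (\<lambda>x. cis (- (\<Sum>i\<in>UNIV. of_int (k $ i) * x $ i)) :: complex)"
    by (intro continuous_intros)
  then have cis: "(\<lambda>x. cis (- (\<Sum>i\<in>UNIV. of_int (k $ i) * x $ i))) \<in> borel_measurable lebesgue"
    by (intro measurable_completion) (simp add: borel_measurable_continuous_onI)
  have m: "(\<lambda>x. indicator torus_cell x *\<^sub>R f x *\<^sub>R cis (- (\<Sum>i\<in>UNIV. of_int (k $ i) * x $ i)))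
      \<in> borel_measurable lebesgue"
    by (intro borel_measurable_scaleR borel_measurable_indicator torus_cell_lebesgue fm cis)
  have "\<bar>a\<bar> \<le> 1 + a\<^sup>2" for a :: real
  proof -
    have "0 \<le> (\<bar>a\<bar> - 1)\<^sup>2" by simp
    then show ?thesis by (simp add: power2_eq_square algebra_simps)
  qed
  then have "norm (indicator torus_cell x *\<^sub>R f x *\<^sub>R cis (- (\<Sum>i\<in>UNIV. of_int (k $ i) * x $ i)))
      \<le> norm (indicator torus_cell x *\<^sub>R (1 + (f x)\<^sup>2))" for x
    by (auto simp: indicator_def)
  then show ?thesis
    unfolding set_integrable_def by (intro Bochner_Integration.integrable_bound[OF dom m]) simp
qed

lemma fourier_coeff_diff:
  assumes "f \<in> sobolev s" "g \<in> sobolev s"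
  shows "fourier_coeff (\<lambda>x. f x - g x) k = fourier_coeff f k - fourier_coeff g k"
  unfolding fourier_coeff_def
  using set_integral_diff(2)[OF sobolev_integrable[OF assms(1), of k] sobolev_integrable[OF assms(2), of k]]
  by (simp add: scaleR_diff_left diff_divide_distrib)

lemma sobolev_term_diff_le:
  assumes "f \<in> sobolev s" "g \<in> sobolev s"
  shows "sobolev_term s (\<lambda>x. f x - g x) k \<le> 2 * sobolev_term s f k + 2 * sobolev_term s g k"
proof -
  have "(cmod (a - b))\<^sup>2 \<le> 2 * (cmod a)\<^sup>2 + 2 * (cmod b)\<^sup>2" for a b :: complex
  proof -
    have "(cmod (a - b))\<^sup>2 \<le> (cmod a + cmod b)\<^sup>2" by (intro power_mono norm_triangle_ineq4) auto
    also have "\<dots> \<le> 2 * (cmod a)\<^sup>2 + 2 * (cmod b)\<^sup>2"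
      using sum_squares_bound[of "cmod a" "cmod b"] by (simp add: power2_sum)
    finally show ?thesis .
  qed
  then have "sobolev_term s (\<lambda>x. f x - g x) k \<le> (1 + (\<Sum>i\<in>UNIV. (of_int (k $ i))\<^sup>2)) powr s
      * (2 * (cmod (fourier_coeff f k))\<^sup>2 + 2 * (cmod (fourier_coeff g k))\<^sup>2)"
    unfolding sobolev_term_def fourier_coeff_diff[OF assms] by (intro mult_left_mono) auto
  also have "\<dots> = 2 * sobolev_term s f k + 2 * sobolev_term s g k"
    by (simp add: sobolev_term_def distrib_left)
  finally show ?thesis .
qed

lemma sobolev_diff:
  assumes f: "f \<in> sobolev s" and g: "g \<in> sobolev s"
  shows "(\<lambda>x. f x - g x) \<in> sobolev s"
proof -
  have per: "periodic (\<lambda>x. f x - g x)" using f g by (auto simp: sobolev_def periodic_def)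
  have m: "f \<in> borel_measurable lebesgue" "g \<in> borel_measurable lebesgue"
    using f g by (auto simp: sobolev_def)
  have "set_integrable lebesgue torus_cell (\<lambda>x. 2 * (f x)\<^sup>2 + 2 * (g x)\<^sup>2)"
    using f g by (auto simp: sobolev_def intro!: set_integral_add set_integrable_mult_right)
  then have dom: "integrable lebesgue (\<lambda>x. indicator torus_cell x *\<^sub>R (2 * (f x)\<^sup>2 + 2 * (g x)\<^sup>2))"
    unfolding set_integrable_def .
  have "(a - b)\<^sup>2 \<le> 2 * a\<^sup>2 + 2 * b\<^sup>2" for a b :: real
    using sum_squares_bound[of a "- b"] by (simp add: power2_diff)
  then have "norm (indicator torus_cell x *\<^sub>R (f x - g x)\<^sup>2)
      \<le> norm (indicator torus_cell x *\<^sub>R (2 * (f x)\<^sup>2 + 2 * (g x)\<^sup>2))" for x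
    by (auto simp: indicator_def)
  moreover have "(\<lambda>x. indicator torus_cell x *\<^sub>R (f x - g x)\<^sup>2) \<in> borel_measurable lebesgue"
    by (intro borel_measurable_scaleR borel_measurable_indicator torus_cell_lebesgue
        borel_measurable_power borel_measurable_diff m)
  ultimately have "set_integrable lebesgue torus_cell (\<lambda>x. (f x - g x)\<^sup>2)"
    unfolding set_integrable_def by (intro Bochner_Integration.integrable_bound[OF dom]) auto
  moreover have "sobolev_term s (\<lambda>x. f x - g x) summable_on UNIV"
  proof (rule summable_on_comparison_test)
    show "(\<lambda>k. 2 * sobolev_term s f k + 2 * sobolev_term s g k) summable_on UNIV"
      using f g by (intro summable_on_add summable_on_cmult_right) (auto simp: sobolev_def)
  qed (use sobolev_term_diff_le[OF f g] sobolev_term_nonneg in auto)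
  ultimately show ?thesis using per m by (simp add: sobolev_def)
qed

lemma sobolev_divide:
  assumes f: "f \<in> sobolev s"
  shows "(\<lambda>x. f x / c) \<in> sobolev s"
proof -
  have "fourier_coeff (\<lambda>x. f x / c) k = fourier_coeff f k / of_real c" for k
  proof -
    have "(LINT x:torus_cell|lebesgue. (f x / c) *\<^sub>R cis (- (\<Sum>i\<in>UNIV. of_int (k $ i) * x $ i)))
       = (LINT x:torus_cell|lebesgue. (1 / c) *\<^sub>R (f x *\<^sub>R cis (- (\<Sum>i\<in>UNIV. of_int (k $ i) * x $ i))))"
      by (simp add: divide_inverse mult.commute)
    then show ?thesis
      unfolding fourier_coeff_def by (simp add: scaleR_conv_of_real)
  qed
  then have "sobolev_term s (\<lambda>x. f x / c) = (\<lambda>k. inverse (c\<^sup>2) * sobolev_term s f k)"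
    by (auto simp: sobolev_term_def norm_divide power_divide field_simps)
  moreover have "sobolev_term s f summable_on UNIV" using f by (simp add: sobolev_def)
  ultimately have "sobolev_term s (\<lambda>x. f x / c) summable_on UNIV"
    by (simp add: summable_on_cmult_right)
  moreover have "set_integrable lebesgue torus_cell (\<lambda>x. (f x / c)\<^sup>2)"
    using f by (auto simp: sobolev_def power_divide)
  ultimately show ?thesis using f by (auto simp: sobolev_def periodic_def)
qed

lemma sum_sobolev_term_le:
  assumes "f \<in> sobolev s" "finite F"
  shows "sum (sobolev_term s f) F \<le> (sobolev_norm s f)\<^sup>2"
proof -
  have "sobolev_term s f summable_on UNIV" using assms by (simp add: sobolev_def)
  then have "sum (sobolev_term s f) F \<le> infsum (sobolev_term s f) UNIV"
    by (rule finite_sum_le_infsum) (use assms sobolev_term_nonneg in auto)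
  moreover have "0 \<le> infsum (sobolev_term s f) UNIV"
    by (rule infsum_nonneg) (rule sobolev_term_nonneg)
  ultimately show ?thesis by (simp add: sobolev_norm_def)
qed

text \<open>A triangle inequality through a third function \<open>v\<close>. With \<open>v\<close> the limit of a family in \<open>H\<^sup>s\<close>, it shows
  that the family is Cauchy; the members of the family may be continuous while \<open>v\<close> is only defined
  up to a null set.\<close>

lemma sum_sobolev_term_diff_le:
  assumes f: "f \<in> sobolev s" and g: "g \<in> sobolev s" and v: "v \<in> sobolev s" and F: "finite F"
  shows "sum (sobolev_term s (\<lambda>x. f x - g x)) F
    \<le> 2 * (sobolev_norm s (\<lambda>x. f x - v x))\<^sup>2 + 2 * (sobolev_norm s (\<lambda>x. g x - v x))\<^sup>2"
proof -
  note fv = sobolev_diff[OF f v] and gv = sobolev_diff[OF g v]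
  have "sum (sobolev_term s (\<lambda>x. f x - g x)) F
      \<le> (\<Sum>k\<in>F. 2 * sobolev_term s (\<lambda>x. f x - v x) k + 2 * sobolev_term s (\<lambda>x. g x - v x) k)"
    using sobolev_term_diff_le[OF fv gv] by (intro sum_mono) simp
  also have "\<dots> = 2 * sum (sobolev_term s (\<lambda>x. f x - v x)) F + 2 * sum (sobolev_term s (\<lambda>x. g x - v x)) F"
    by (simp add: sum.distrib flip: sum_distrib_left)
  finally show ?thesis
    using sum_sobolev_term_le[OF fv F] sum_sobolev_term_le[OF gv F] by linarith
qed

section \<open>Regular solutions near the initial time\<close>

lemma uniform_limit_at_zero:
  fixes q :: "real \<Rightarrow> 'a \<Rightarrow> real"
  assumes T: "T > 0"
    and cauchy: "\<And>e. e > 0 \<Longrightarrow> \<exists>\<delta>>0. \<forall>\<tau>\<in>{0<..T}. \<forall>\<tau>'\<in>{0<..T}. \<tau> < \<delta> \<longrightarrow> \<tau>' < \<delta> \<longrightarrow>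
                    (\<forall>x. \<bar>q \<tau> x - q \<tau>' x\<bar> \<le> e)"
  obtains L where "\<And>e. e > 0 \<Longrightarrow> \<exists>\<delta>>0. \<forall>\<tau>\<in>{0<..T}. \<tau> < \<delta> \<longrightarrow> (\<forall>x. \<bar>q \<tau> x - L x\<bar> \<le> e)"
proof -
  define t where "t n = T * inverse (real (Suc n))" for n
  have t: "t n \<in> {0<..T}" for n using T by (auto simp: t_def field_simps)
  have t0: "t \<longlonglongrightarrow> 0"
    unfolding t_def by (rule tendsto_mult_right_zero[OF LIMSEQ_inverse_real_of_nat])
  have "\<exists>l. (\<lambda>n. q (t n) x) \<longlonglongrightarrow> l" for x
  proof -
    have "Cauchy (\<lambda>n. q (t n) x)"
    proof (rule CauchyI')
      fix e :: real assume "e > 0"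
      then obtain \<delta> where \<delta>: "\<delta> > 0" "\<And>a b x. a \<in> {0<..T} \<Longrightarrow> b \<in> {0<..T} \<Longrightarrow> a < \<delta> \<Longrightarrow> b < \<delta> \<Longrightarrow> \<bar>q a x - q b x\<bar> \<le> e / 2"
        using cauchy[of "e / 2"] by (auto 0 0)
      obtain N where "\<And>n. n \<ge> N \<Longrightarrow> t n < \<delta>"
        using order_tendstoD(2)[OF t0 \<delta>(1)] unfolding eventually_sequentially by blast
      then have "\<bar>q (t m) x - q (t n) x\<bar> < e" if "m \<ge> N" "n > m" for m n
        using \<delta>(2)[OF t[of m] t[of n], of x] that \<open>e > 0\<close> by fastforce
      then show "\<exists>M. \<forall>m\<ge>M. \<forall>n>m. dist (q (t m) x) (q (t n) x) < e"
        unfolding dist_real_def by blast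
    qed
    then show ?thesis using Cauchy_convergent convergent_def by blast
  qed
  then obtain L where L: "\<And>x. (\<lambda>n. q (t n) x) \<longlonglongrightarrow> L x" by metis
  show thesis
  proof (rule that[of L])
    fix e :: real assume "e > 0"
    then obtain \<delta> where \<delta>: "\<delta> > 0" "\<And>a b x. a \<in> {0<..T} \<Longrightarrow> b \<in> {0<..T} \<Longrightarrow> a < \<delta> \<Longrightarrow> b < \<delta> \<Longrightarrow> \<bar>q a x - q b x\<bar> \<le> e"
      using cauchy[of e] by metis
    have "\<bar>q a x - L x\<bar> \<le> e" if "a \<in> {0<..T}" "a < \<delta>" for a x
    proof (rule tendsto_upperbound)
      show "(\<lambda>n. \<bar>q a x - q (t n) x\<bar>) \<longlonglongrightarrow> \<bar>q a x - L x\<bar>" by (intro tendsto_intros L)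
      show "\<forall>\<^sub>F n in sequentially. \<bar>q a x - q (t n) x\<bar> \<le> e"
        using order_tendstoD(2)[OF t0 \<delta>(1)] by eventually_elim (use \<delta>(2) that t in auto)
    qed simp
    then show "\<exists>\<delta>>0. \<forall>\<tau>\<in>{0<..T}. \<tau> < \<delta> \<longrightarrow> (\<forall>x. \<bar>q \<tau> x - L x\<bar> \<le> e)" using \<delta>(1) by blast
  qed
qed

text \<open>The bound \<open>4 \<eta>\<^sup>2\<close> is what the triangle inequality gives for two functions within \<open>\<eta>\<close> of a third.\<close>

lemma sobolev_small:
  fixes e :: real
  assumes "\<sigma> > real CARD('n) / 2" "e > 0"
  obtains \<eta> where "\<eta> > 0" "\<And>(d :: real^'n \<Rightarrow> real) x. continuous_on UNIV d \<Longrightarrow> periodic d \<Longrightarrow>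
    (\<And>F. finite F \<Longrightarrow> sum (sobolev_term \<sigma> d) F \<le> 4 * \<eta>\<^sup>2) \<Longrightarrow> \<bar>d x\<bar> \<le> e"
proof -
  obtain C where C: "C \<ge> 0" "\<And>(f :: real^'n \<Rightarrow> real) B x. continuous_on UNIV f \<Longrightarrow> periodic f \<Longrightarrow>
    (\<And>F. finite F \<Longrightarrow> sum (sobolev_term \<sigma> f) F \<le> B) \<Longrightarrow> \<bar>f x\<bar> \<le> C * sqrt B"
    using sobolev_embedding[OF assms(1)] by blast
  define \<eta> where "\<eta> = e / (2 * C + 1)"
  have \<eta>: "\<eta> > 0" using C(1) assms(2) by (simp add: \<eta>_def)
  have "C * sqrt (4 * \<eta>\<^sup>2) = 2 * C * \<eta>" using \<eta> by (simp add: real_sqrt_mult)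
  also have "\<dots> \<le> (2 * C + 1) * \<eta>" using \<eta> by (simp add: algebra_simps)
  also have "\<dots> = e" using C(1) by (simp add: \<eta>_def)
  finally have "C * sqrt (4 * \<eta>\<^sup>2) \<le> e" .
  then show thesis using that[OF \<eta>] C(2) by (meson order_trans)
qed

lemma sobolev_norm_nonneg: "0 \<le> sobolev_norm s f"
  unfolding sobolev_norm_def by (intro real_sqrt_ge_zero infsum_nonneg sobolev_term_nonneg)

lemma sum_sobolev_term_diff_le_square:
  assumes "f \<in> sobolev s" "g \<in> sobolev s" "v \<in> sobolev s" "finite F"
    and "sobolev_norm s (\<lambda>x. f x - v x) < \<eta>" "sobolev_norm s (\<lambda>x. g x - v x) < \<eta>"
  shows "sum (sobolev_term s (\<lambda>x. f x - g x)) F \<le> 4 * \<eta>\<^sup>2"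
proof -
  have "(sobolev_norm s (\<lambda>x. f x - v x))\<^sup>2 \<le> \<eta>\<^sup>2" "(sobolev_norm s (\<lambda>x. g x - v x))\<^sup>2 \<le> \<eta>\<^sup>2"
    using assms(5,6) sobolev_norm_nonneg by (auto intro!: power_mono)
  then show ?thesis using sum_sobolev_term_diff_le[OF assms(1-4)] by linarith
qed

lemma line_derivative_periodic:
  fixes f f' :: "real^'n \<Rightarrow> real"
  assumes f: "periodic f" and der: "\<And>x. ((\<lambda>r. f (x + r *\<^sub>R axis i 1)) has_real_derivative f' x) (at 0)"
  shows "periodic f'"
  unfolding periodic_def
proof (intro allI)
  fix x j
  have "f (x + axis j (2 * pi) + r *\<^sub>R axis i 1) = f (x + r *\<^sub>R axis i 1)" for r
    using f[unfolded periodic_def, rule_format, of "x + r *\<^sub>R axis i 1" j] by (simp add: algebra_simps)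
  then have "((\<lambda>r. f (x + r *\<^sub>R axis i 1)) has_real_derivative f' (x + axis j (2 * pi))) (at 0)"
    using der[of "x + axis j (2 * pi)"] by simp
  then show "f' (x + axis j (2 * pi)) = f' x" using DERIV_unique der by blast
qed

text \<open>The factor \<open>k\<^sub>i\<^sup>2\<close> produced by differentiation is at most \<open>1 + |k|\<^sup>2\<close>, which is one order of the weight.\<close>

lemma sobolev_term_derivative_le:
  fixes f f' :: "real^'n \<Rightarrow> real"
  assumes f: "continuous_on UNIV f" "periodic f" and f': "continuous_on UNIV f'"
    and der: "\<And>x. ((\<lambda>r. f (x + r *\<^sub>R axis i 1)) has_real_derivative f' x) (at 0)"
  shows "sobolev_term (s - 1) f' k \<le> sobolev_term s f k"
proof -
  define w where "w = 1 + (\<Sum>i\<in>UNIV. (real_of_int (k $ i))\<^sup>2)"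
  have w: "w > 0" unfolding w_def by (intro add_pos_nonneg sum_nonneg) auto
  have ki: "(real_of_int (k $ i))\<^sup>2 \<le> w"
    using member_le_sum[of i UNIV "\<lambda>i. (real_of_int (k $ i))\<^sup>2"] by (simp add: w_def)
  have "sobolev_term (s - 1) f' k = w powr (s - 1) * ((real_of_int (k $ i))\<^sup>2 * (cmod (fourier_coeff f k))\<^sup>2)"
    unfolding sobolev_term_def fourier_coeff_derivative[OF assms] w_def
    by (simp add: norm_mult power_mult_distrib)
  also have "\<dots> \<le> w powr (s - 1) * (w * (cmod (fourier_coeff f k))\<^sup>2)"
    using ki by (intro mult_left_mono mult_right_mono) auto
  also have "\<dots> = w powr s * (cmod (fourier_coeff f k))\<^sup>2"
    using w by (simp add: powr_diff)
  finally show ?thesis by (simp add: sobolev_term_def w_def)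
qed

lemma regular_solution_derivatives:
  fixes h :: "real \<Rightarrow> real^'n \<Rightarrow> real"
  assumes "regular_solution T h"
  shows "\<exists>h' :: real \<times> (real^'n) \<Rightarrow> real \<times> (real^'n) \<Rightarrow> real.
    (\<forall>t\<in>{0<..T}. \<forall>x. (h t has_derivative (\<lambda>v. h' (t, x) (0, v))) (at x) \<and>
       ((\<lambda>\<tau>. h \<tau> x) has_real_derivative h' (t, x) (1, 0)) (at t within {0..T})) \<and>
    (\<forall>t\<in>{0<..T}. \<forall>v. continuous_on UNIV (\<lambda>x. h' (t, x) v))"
    (is "\<exists>h'. ?space_time h' \<and> ?cont h'")
    and "continuous_on ({0<..T} \<times> UNIV) (\<lambda>(t, x). h t x)"
proof -
  let ?S = "{0<..T} \<times> (UNIV :: (real^'n) set)"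
  let ?H = "\<lambda>(t, x). h t x"
  have "Ck_on 0 ?H ?S" "Ck_on (Suc 0) ?H ?S"
    using assms unfolding regular_solution_def smooth_on_def by blast+
  then obtain h' where h': "\<And>z. z \<in> ?S \<Longrightarrow> (?H has_derivative h' z) (at z within ?S)"
    "\<And>v. continuous_on ?S (\<lambda>z. h' z v)" and c: "continuous_on ?S ?H"
    by auto
  show "continuous_on ?S ?H" by (rule c)
  show "\<exists>h'. ?space_time h' \<and> ?cont h'"
  proof (intro exI[of _ h'] conjI ballI allI)
    fix t x assume t: "t \<in> {0<..T}"
    then have z: "(t, x) \<in> ?S" by simp
    have "((\<lambda>y. ?H (t, y)) has_derivative (\<lambda>v. h' (t, x) (0, v))) (at x)"
    proof (rule has_derivative_in_compose[where f = "\<lambda>y. (t, y)"])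
      show "((\<lambda>y. (t, y)) has_derivative (\<lambda>v. (0, v))) (at x)" by (auto intro!: derivative_eq_intros)
      show "(?H has_derivative h' (t, x)) (at (t, x) within range (\<lambda>y. (t, y)))"
        by (rule has_derivative_subset[OF h'(1)[OF z]]) (use t in auto)
    qed
    then show "(h t has_derivative (\<lambda>v. h' (t, x) (0, v))) (at x)" by simp
    have "((\<lambda>\<tau>. ?H (\<tau>, x)) has_derivative (\<lambda>r. h' (t, x) (r, 0))) (at t within {0<..T})"
    proof (rule has_derivative_in_compose[where f = "\<lambda>\<tau>. (\<tau>, x)"])
      show "((\<lambda>\<tau>. (\<tau>, x)) has_derivative (\<lambda>r. (r, 0))) (at t within {0<..T})"
        by (auto intro!: derivative_eq_intros)
      show "(?H has_derivative h' (t, x)) (at (t, x) within (\<lambda>\<tau>. (\<tau>, x)) ` {0<..T})"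
        by (rule has_derivative_subset[OF h'(1)[OF z]]) auto
    qed
    moreover have "(\<lambda>r. h' (t, x) (r, 0)) = (*) (h' (t, x) (1, 0))"
    proof
      fix r
      have "h' (t, x) (r *\<^sub>R (1, 0)) = r *\<^sub>R h' (t, x) (1, 0)"
        by (rule linear_scale[OF has_derivative_linear[OF h'(1)[OF z]]])
      then show "h' (t, x) (r, 0) = h' (t, x) (1, 0) * r" by simp
    qed
    moreover have "at t within {0<..T} = at t within {0..T}"
      by (rule at_within_nhd[of t "{0<..}"]) (use t in auto)
    ultimately show "((\<lambda>\<tau>. h \<tau> x) has_real_derivative h' (t, x) (1, 0)) (at t within {0..T})"
      by (simp add: has_field_derivative_def)
  next
    fix t v assume "t \<in> {0<..T}"
    then show "continuous_on UNIV (\<lambda>x. h' (t, x) v)"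
      by (intro continuous_on_compose2[OF h'(2)] continuous_intros) auto
  qed
qed

lemma regular_solution_partials:
  fixes h :: "real \<Rightarrow> real^'n \<Rightarrow> real"
  assumes "regular_solution T h" "t \<in> {0<..T}"
  shows "((\<lambda>r. h t (x + r *\<^sub>R axis i 1)) has_real_derivative partial i (h t) x) (at 0)"
    "continuous_on UNIV (partial i (h t))" "h t differentiable (at x)"
    "((\<lambda>\<tau>. h \<tau> x) has_real_derivative time_deriv T h t x) (at t within {0..T})"
proof -
  obtain h' :: "real \<times> (real^'n) \<Rightarrow> real \<times> (real^'n) \<Rightarrow> real" where
    h': "\<forall>t\<in>{0<..T}. \<forall>x. (h t has_derivative (\<lambda>v. h' (t, x) (0, v))) (at x) \<and>
       ((\<lambda>\<tau>. h \<tau> x) has_real_derivative h' (t, x) (1, 0)) (at t within {0..T})"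
    "\<forall>t\<in>{0<..T}. \<forall>v. continuous_on UNIV (\<lambda>x. h' (t, x) v)"
    using regular_solution_derivatives(1)[OF assms(1)] by (elim exE conjE) (rule that)
  have d: "(h t has_derivative (\<lambda>v. h' (t, x) (0, v))) (at x)" for x
    using h'(1)[rule_format, OF assms(2)] by simp
  then show "h t differentiable (at x)" unfolding differentiable_def by blast
  have dt: "((\<lambda>\<tau>. h \<tau> x) has_real_derivative h' (t, x) (1, 0)) (at t within {0..T})"
    using h'(1) assms(2) by simp
  have "at t within {0..T} \<noteq> bot" using assms(2) by (simp add: trivial_limit_within)
  then have "time_deriv T h t x = h' (t, x) (1, 0)"
    unfolding time_deriv_def using dt
    by (intro vector_derivative_within) (simp_all add: has_real_derivative_iff_has_vector_derivative)
  then show "((\<lambda>\<tau>. h \<tau> x) has_real_derivative time_deriv T h t x) (at t within {0..T})"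
    using dt by simp
  note p = has_line_derivative_partial[OF d]
  show "((\<lambda>r. h t (x + r *\<^sub>R axis i 1)) has_real_derivative partial i (h t) x) (at 0)"
    unfolding p(2) by (rule p(1))
  have "partial i (h t) = (\<lambda>x. h' (t, x) (0, axis i 1))" using p(2) by (rule ext)
  then show "continuous_on UNIV (partial i (h t))" using h'(2)[rule_format, OF assms(2)] by simp
qed

lemma tendsto_zero_near_zero:
  fixes f :: "real \<Rightarrow> real"
  assumes "(f \<longlongrightarrow> 0) (at 0 within {0..T})" "\<eta> > 0"
  obtains \<delta> where "\<delta> > 0" "\<And>\<tau>. \<tau> \<in> {0<..T} \<Longrightarrow> \<tau> < \<delta> \<Longrightarrow> f \<tau> < \<eta>"
proof -
  have "\<forall>\<^sub>F \<tau> in at 0 within {0..T}. f \<tau> < \<eta>" using order_tendstoD(2)[OF assms] .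
  then obtain \<delta> where "\<delta> > 0" "\<And>\<tau>. \<tau> \<in> {0..T} \<Longrightarrow> \<tau> \<noteq> 0 \<Longrightarrow> dist \<tau> 0 < \<delta> \<Longrightarrow> f \<tau> < \<eta>"
    unfolding eventually_at by blast
  then show thesis using that[of \<delta>] by auto
qed

text \<open>Convergence in \<open>H\<^sup>s\<close>, convergence of the difference quotients in \<open>H\<^sup>s\<^sup>-\<^sup>1\<close>, and the fact that \<open>\<partial>\<^sub>i\<close>
  maps \<open>H\<^sup>s\<close> to \<open>H\<^sup>s\<^sup>-\<^sup>1\<close> turn into uniform statements by the Sobolev embedding, as \<open>s - 1 > n / 2\<close>. In the
  last two the limits are only known as Sobolev functions, so the Cauchy property is stated
  instead.\<close>

lemma regular_solution_near_initial:
  fixes h :: "real \<Rightarrow> real^'n \<Rightarrow> real"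
  assumes T: "0 < T" and h: "regular_solution T h" and e: "e > 0"
  shows "\<exists>\<delta>>0. \<forall>\<tau>\<in>{0<..T}. \<tau> < \<delta> \<longrightarrow> (\<forall>x. \<bar>h \<tau> x - h 0 x\<bar> \<le> e)" (is ?value)
    and "\<exists>\<delta>>0. \<forall>\<tau>\<in>{0<..T}. \<forall>\<tau>'\<in>{0<..T}. \<tau> < \<delta> \<longrightarrow> \<tau>' < \<delta> \<longrightarrow>
      (\<forall>x. \<bar>(h \<tau> x - h 0 x) / \<tau> - (h \<tau>' x - h 0 x) / \<tau>'\<bar> \<le> e)" (is ?time)
    and "\<exists>\<delta>>0. \<forall>\<tau>\<in>{0<..T}. \<forall>\<tau>'\<in>{0<..T}. \<tau> < \<delta> \<longrightarrow> \<tau>' < \<delta> \<longrightarrow>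
      (\<forall>x. \<bar>partial i (h \<tau>) x - partial i (h \<tau>') x\<bar> \<le> e)" (is ?space)
proof -
  obtain s where s: "s > real CARD('n) / 2 + 1" and C0: "C0_sobolev T s h" and C1: "C1_sobolev T (s - 1) h"
    and cont: "\<And>t. t \<in> {0..T} \<Longrightarrow> continuous_on UNIV (h t)"
    using h unfolding regular_solution_def by blast
  have z: "0 \<in> {0..T}" using T by simp
  have \<sigma>: "s - 1 > real CARD('n) / 2" "s > real CARD('n) / 2" using s by auto
  have hs: "h t \<in> sobolev s" "h t \<in> sobolev (s - 1)" if "t \<in> {0..T}" for t
    using C0 C1 that by (auto simp: C0_sobolev_def C1_sobolev_def)
  have per: "periodic (h t)" if "t \<in> {0..T}" for t using hs[OF that] by (simp add: sobolev_def)
  have lim0: "((\<lambda>\<tau>. sobolev_norm s (\<lambda>x. h \<tau> x - h 0 x)) \<longlongrightarrow> 0) (at 0 within {0..T})"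
    using C0 z unfolding C0_sobolev_def by blast
  show ?value
  proof -
    obtain \<eta> where \<eta>: "\<eta> > 0" "\<And>(d :: real^'n \<Rightarrow> real) x. continuous_on UNIV d \<Longrightarrow> periodic d \<Longrightarrow>
      (\<And>F. finite F \<Longrightarrow> sum (sobolev_term s d) F \<le> 4 * \<eta>\<^sup>2) \<Longrightarrow> \<bar>d x\<bar> \<le> e"
      using sobolev_small[OF \<sigma>(2) e] by blast
    obtain \<delta> where \<delta>: "\<delta> > 0" "\<And>\<tau>. \<tau> \<in> {0<..T} \<Longrightarrow> \<tau> < \<delta> \<Longrightarrow> sobolev_norm s (\<lambda>x. h \<tau> x - h 0 x) < \<eta>"
      using tendsto_zero_near_zero[OF lim0 \<eta>(1)] by blast
    have "\<bar>h \<tau> x - h 0 x\<bar> \<le> e" if \<tau>: "\<tau> \<in> {0<..T}" "\<tau> < \<delta>" for \<tau> x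
    proof (rule \<eta>(2))
      have \<tau>': "\<tau> \<in> {0..T}" using \<tau> by auto
      show "continuous_on UNIV (\<lambda>x. h \<tau> x - h 0 x)" by (intro continuous_intros cont \<tau>' z)
      show "periodic (\<lambda>x. h \<tau> x - h 0 x)" using per[OF \<tau>'] per[OF z] by (simp add: periodic_def)
      fix F :: "(int^'n) set" assume "finite F"
      then have "sum (sobolev_term s (\<lambda>x. h \<tau> x - h 0 x)) F \<le> (sobolev_norm s (\<lambda>x. h \<tau> x - h 0 x))\<^sup>2"
        by (rule sum_sobolev_term_le[OF sobolev_diff[OF hs(1)[OF \<tau>'] hs(1)[OF z]]])
      also have "\<dots> \<le> \<eta>\<^sup>2" using \<delta>(2)[OF \<tau>] sobolev_norm_nonneg by (auto intro!: power_mono)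
      also have "\<dots> \<le> 4 * \<eta>\<^sup>2" by simp
      finally show "sum (sobolev_term s (\<lambda>x. h \<tau> x - h 0 x)) F \<le> 4 * \<eta>\<^sup>2" .
    qed
    then show ?thesis using \<delta>(1) by blast
  qed
  show ?time
  proof -
    obtain \<eta> where \<eta>: "\<eta> > 0" "\<And>(d :: real^'n \<Rightarrow> real) x. continuous_on UNIV d \<Longrightarrow> periodic d \<Longrightarrow>
      (\<And>F. finite F \<Longrightarrow> sum (sobolev_term (s - 1) d) F \<le> 4 * \<eta>\<^sup>2) \<Longrightarrow> \<bar>d x\<bar> \<le> e"
      using sobolev_small[OF \<sigma>(1) e] by blast
    obtain u' where u': "C0_sobolev T (s - 1) u'"
      "((\<lambda>\<tau>. sobolev_norm (s - 1) (\<lambda>x. (h \<tau> x - h 0 x) / (\<tau> - 0) - u' 0 x)) \<longlongrightarrow> 0) (at 0 within {0..T})"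
      using C1 z unfolding C1_sobolev_def by blast
    have v: "u' 0 \<in> sobolev (s - 1)" using u'(1) z by (simp add: C0_sobolev_def)
    obtain \<delta> where \<delta>: "\<delta> > 0" "\<And>\<tau>. \<tau> \<in> {0<..T} \<Longrightarrow> \<tau> < \<delta> \<Longrightarrow>
        sobolev_norm (s - 1) (\<lambda>x. (h \<tau> x - h 0 x) / \<tau> - u' 0 x) < \<eta>"
      using tendsto_zero_near_zero[OF u'(2)[unfolded diff_zero] \<eta>(1)] by blast
    have q: "(\<lambda>x. (h \<tau> x - h 0 x) / \<tau>) \<in> sobolev (s - 1)" "continuous_on UNIV (\<lambda>x. (h \<tau> x - h 0 x) / \<tau>)"
      if "\<tau> \<in> {0<..T}" for \<tau>
    proof -
      have \<tau>': "\<tau> \<in> {0..T}" "\<tau> \<noteq> 0" using that by auto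
      show "(\<lambda>x. (h \<tau> x - h 0 x) / \<tau>) \<in> sobolev (s - 1)"
        by (intro sobolev_divide sobolev_diff hs \<tau>' z)
      show "continuous_on UNIV (\<lambda>x. (h \<tau> x - h 0 x) / \<tau>)"
        using \<tau>'(2) by (intro continuous_intros cont \<tau>'(1) z) auto
    qed
    have "\<bar>(h \<tau> x - h 0 x) / \<tau> - (h \<tau>' x - h 0 x) / \<tau>'\<bar> \<le> e"
      if \<tau>: "\<tau> \<in> {0<..T}" "\<tau> < \<delta>" and \<tau>': "\<tau>' \<in> {0<..T}" "\<tau>' < \<delta>" for \<tau> \<tau>' x
    proof (rule \<eta>(2))
      show "continuous_on UNIV (\<lambda>x. (h \<tau> x - h 0 x) / \<tau> - (h \<tau>' x - h 0 x) / \<tau>')"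
        by (intro continuous_on_diff q \<tau> \<tau>')
      show "periodic (\<lambda>x. (h \<tau> x - h 0 x) / \<tau> - (h \<tau>' x - h 0 x) / \<tau>')"
        using sobolev_diff[OF q(1)[OF \<tau>(1)] q(1)[OF \<tau>'(1)]] unfolding sobolev_def by blast
      fix F :: "(int^'n) set" assume "finite F"
      then show "sum (sobolev_term (s - 1) (\<lambda>x. (h \<tau> x - h 0 x) / \<tau> - (h \<tau>' x - h 0 x) / \<tau>')) F \<le> 4 * \<eta>\<^sup>2"
        by (rule sum_sobolev_term_diff_le_square[OF q(1)[OF \<tau>(1)] q(1)[OF \<tau>'(1)] v _ \<delta>(2)[OF \<tau>] \<delta>(2)[OF \<tau>']])
    qed
    then show ?thesis using \<delta>(1) by blast
  qed
  show ?space
  proof -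
    obtain \<eta> where \<eta>: "\<eta> > 0" "\<And>(d :: real^'n \<Rightarrow> real) x. continuous_on UNIV d \<Longrightarrow> periodic d \<Longrightarrow>
      (\<And>F. finite F \<Longrightarrow> sum (sobolev_term (s - 1) d) F \<le> 4 * \<eta>\<^sup>2) \<Longrightarrow> \<bar>d x\<bar> \<le> e"
      using sobolev_small[OF \<sigma>(1) e] by blast
    obtain \<delta> where \<delta>: "\<delta> > 0" "\<And>\<tau>. \<tau> \<in> {0<..T} \<Longrightarrow> \<tau> < \<delta> \<Longrightarrow> sobolev_norm s (\<lambda>x. h \<tau> x - h 0 x) < \<eta>"
      using tendsto_zero_near_zero[OF lim0 \<eta>(1)] by blast
    have "\<bar>partial i (h \<tau>) x - partial i (h \<tau>') x\<bar> \<le> e"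
      if \<tau>: "\<tau> \<in> {0<..T}" "\<tau> < \<delta>" and \<tau>': "\<tau>' \<in> {0<..T}" "\<tau>' < \<delta>" for \<tau> \<tau>' x
    proof (rule \<eta>(2))
      have c: "\<tau> \<in> {0..T}" "\<tau>' \<in> {0..T}" using \<tau> \<tau>' by auto
      have fc: "continuous_on UNIV (\<lambda>x. h \<tau> x - h \<tau>' x)" by (intro continuous_on_diff cont c)
      have fp: "periodic (\<lambda>x. h \<tau> x - h \<tau>' x)" using per[OF c(1)] per[OF c(2)] by (simp add: periodic_def)
      have der: "((\<lambda>r. h \<tau> (x + r *\<^sub>R axis i 1) - h \<tau>' (x + r *\<^sub>R axis i 1))
          has_real_derivative partial i (h \<tau>) x - partial i (h \<tau>') x) (at 0)" for x
        by (intro DERIV_diff regular_solution_partials(1)[OF h] \<tau> \<tau>')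
      show dc: "continuous_on UNIV (\<lambda>x. partial i (h \<tau>) x - partial i (h \<tau>') x)"
        by (intro continuous_on_diff regular_solution_partials(2)[OF h] \<tau> \<tau>')
      show "periodic (\<lambda>x. partial i (h \<tau>) x - partial i (h \<tau>') x)"
        by (rule line_derivative_periodic[OF fp der])
      fix F :: "(int^'n) set" assume F: "finite F"
      have "sum (sobolev_term (s - 1) (\<lambda>x. partial i (h \<tau>) x - partial i (h \<tau>') x)) F
          \<le> sum (sobolev_term s (\<lambda>x. h \<tau> x - h \<tau>' x)) F"
        by (intro sum_mono sobolev_term_derivative_le[OF fc fp dc der])
      also have "\<dots> \<le> 4 * \<eta>\<^sup>2"
        by (rule sum_sobolev_term_diff_le_square[OF hs(1)[OF c(1)] hs(1)[OF c(2)] hs(1)[OF z] F \<delta>(2)[OF \<tau>] \<delta>(2)[OF \<tau>']])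
      finally show "sum (sobolev_term (s - 1) (\<lambda>x. partial i (h \<tau>) x - partial i (h \<tau>') x)) F \<le> 4 * \<eta>\<^sup>2" .
    qed
    then show ?thesis using \<delta>(1) by blast
  qed
qed

text \<open>Smoothness covers positive times; at time 0 the continuity of \<open>h 0\<close> combines with uniform
  convergence.\<close>

lemma regular_solution_continuous:
  fixes h :: "real \<Rightarrow> real^'n \<Rightarrow> real"
  assumes T: "0 < T" and h: "regular_solution T h"
  shows "continuous_on ({0..T} \<times> UNIV) (\<lambda>(t, x). h t x)"
  unfolding continuous_on_def
proof
  let ?S = "{0..T} \<times> (UNIV :: (real^'n) set)"
  let ?H = "\<lambda>(t, x). h t x"
  fix z assume z: "z \<in> ?S"
  show "(?H \<longlongrightarrow> ?H z) (at z within ?S)"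
  proof (cases "fst z = 0")
    case False
    then have "(?H \<longlongrightarrow> ?H z) (at z within {0<..T} \<times> UNIV)"
      using regular_solution_derivatives(2)[OF h] z unfolding continuous_on_def by (cases z) auto
    moreover have "at z within ?S = at z within {0<..T} \<times> UNIV"
      by (rule at_within_nhd[of z "{0<..} \<times> UNIV"]) (use z False in \<open>auto intro: open_Times\<close>)
    ultimately show ?thesis by simp
  next
    case True
    then obtain x0 where z0: "z = (0, x0)" by (cases z) auto
    have "continuous_on UNIV (h 0)" using h T by (simp add: regular_solution_def)
    then have h0: "isCont (h 0) x0" by (simp add: continuous_on_eq_continuous_at)
    have fst0: "((\<lambda>w. fst w) \<longlongrightarrow> 0) (at z within ?S)" and snd0: "((\<lambda>w. snd w) \<longlongrightarrow> x0) (at z within ?S)"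
      using tendsto_fst[OF tendsto_ident_at, of z ?S] tendsto_snd[OF tendsto_ident_at, of z ?S] by (simp_all add: z0)
    show ?thesis
    proof (rule tendstoI)
      fix e :: real assume "e > 0"
      then obtain \<delta> where \<delta>: "\<delta> > 0" "\<forall>\<tau>\<in>{0<..T}. \<tau> < \<delta> \<longrightarrow> (\<forall>x. \<bar>h \<tau> x - h 0 x\<bar> \<le> e / 2)"
        using regular_solution_near_initial(1)[OF T h, of "e / 2"] by auto
      have "\<forall>\<^sub>F w in at z within ?S. fst w < \<delta>" by (rule order_tendstoD(2)[OF fst0 \<delta>(1)])
      moreover have "\<forall>\<^sub>F w in at z within ?S. dist (h 0 (snd w)) (h 0 x0) < e / 2"
        by (rule tendstoD[OF isCont_tendsto_compose[OF h0 snd0]]) (use \<open>e > 0\<close> in simp)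
      moreover have "\<forall>\<^sub>F w in at z within ?S. w \<in> ?S" by (simp add: eventually_at_filter)
      ultimately show "\<forall>\<^sub>F w in at z within ?S. dist (?H w) (?H z) < e"
      proof eventually_elim
        case (elim w)
        have "\<bar>h (fst w) (snd w) - h 0 (snd w)\<bar> \<le> e / 2"
        proof (cases "fst w = 0")
          case False
          then have "fst w \<in> {0<..T}" using elim(3) by auto
          then show ?thesis using \<delta>(2) elim(1) by blast
        qed (use \<open>e > 0\<close> in simp)
        then have "\<bar>h (fst w) (snd w) - h 0 x0\<bar> < e"
          using elim(2) unfolding dist_real_def by linarith
        then show ?case by (simp add: split_beta z0 dist_real_def)
      qed
    qed
  qed
qed

lemma classical_solution_if_regular:
  fixes h :: "real \<Rightarrow> real^'n \<Rightarrow> real"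
  assumes T: "0 < T" and h: "regular_solution T h"
  shows "classical_solution T h"
  unfolding classical_solution_def
proof (intro conjI ballI)
  show "continuous_on ({0..T} \<times> UNIV) (\<lambda>(t, x). h t x)" by (rule regular_solution_continuous[OF T h])
  show "periodic (h t)" if "t \<in> {0..T}" for t
    using h that by (auto simp: regular_solution_def C0_sobolev_def sobolev_def)
  fix t assume t: "t \<in> {0<..T}"
  note partials = regular_solution_partials[OF h t]
  show "\<forall>x. h t differentiable at x" using partials(3) by blast
  have "t \<in> {0..T}" using t by auto
  then obtain g where g: "has_dirichlet_neumann (h t) (h t) g" "\<And>x. time_deriv T h t x + g x = 0"
    using h unfolding regular_solution_def by blast
  have "((\<lambda>\<tau>. h \<tau> x) has_real_derivative - g x) (at t within {0..t})" for x
  proof -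
    have "time_deriv T h t x = - g x" using g(2)[of x] by simp
    then show ?thesis using has_field_derivative_subset[OF partials(4)[of x], of "{0..t}"] t by simp
  qed
  then show "\<exists>g. has_dirichlet_neumann (h t) (h t) g \<and>
      (\<forall>x. ((\<lambda>\<tau>. h \<tau> x) has_real_derivative - g x) (at t within {0..t}))"
    using g(1) by blast
qed

section \<open>Bounds on the derivatives of a solution\<close>

lemma classical_solution_restrict:
  assumes "classical_solution T h" "T' \<le> T"
  shows "classical_solution T' h"
proof -
  have "continuous_on ({0..T'} \<times> UNIV) (\<lambda>(t, x). h t x)"
    by (rule continuous_on_subset[of "{0..T} \<times> UNIV"]) (use assms in \<open>auto simp: classical_solution_def\<close>)
  then show ?thesis using assms by (simp add: classical_solution_def)
qed

lemma classical_solution_time_shift: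
  assumes h: "classical_solution T h" and r: "0 \<le> r"
  shows "classical_solution (T - r) (\<lambda>t. h (t + r))"
  unfolding classical_solution_def
proof (intro conjI ballI)
  have "continuous_on ({0..T} \<times> UNIV) (\<lambda>(t, x). h t x)" using h by (simp add: classical_solution_def)
  then have "continuous_on ({0..T - r} \<times> UNIV) (\<lambda>z. (\<lambda>(t, x). h t x) (fst z + r, snd z))"
    by (rule continuous_on_compose2) (use r in \<open>auto intro!: continuous_intros\<close>)
  then show "continuous_on ({0..T - r} \<times> UNIV) (\<lambda>(t, x). h (t + r) x)" by (simp add: split_beta)
  show "periodic (h (t + r))" if "t \<in> {0..T - r}" for t
    using h r that by (auto simp: classical_solution_def)
  fix t assume t: "t \<in> {0<..T - r}"
  then have tr: "t + r \<in> {0<..T}" using r by auto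
  show "\<forall>x. h (t + r) differentiable at x" using h tr unfolding classical_solution_def by blast
  obtain g where g: "has_dirichlet_neumann (h (t + r)) (h (t + r)) g"
    "\<And>x. ((\<lambda>\<tau>. h \<tau> x) has_real_derivative - g x) (at (t + r) within {0..t + r})"
    using h tr unfolding classical_solution_def by blast
  have "((\<lambda>\<tau>. h (\<tau> + r) x) has_real_derivative - g x) (at t within {0..t})" for x
  proof -
    have "((\<lambda>\<tau>. h \<tau> x) has_real_derivative - g x) (at (t + r) within (\<lambda>\<tau>. \<tau> + r) ` {0..t})"
      by (rule has_field_derivative_subset[OF g(2)]) (use r in auto)
    moreover have "((\<lambda>\<tau>. \<tau> + r) has_real_derivative 1) (at t within {0..t})"
      by (auto intro!: derivative_eq_intros)
    ultimately have "((\<lambda>\<tau>. h \<tau> x) \<circ> (\<lambda>\<tau>. \<tau> + r) has_real_derivative - g x * 1) (at t within {0..t})"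
      by (rule DERIV_image_chain)
    then show ?thesis by (simp add: o_def)
  qed
  then show "\<exists>g. has_dirichlet_neumann (h (t + r)) (h (t + r)) g \<and>
      (\<forall>x. ((\<lambda>\<tau>. h (\<tau> + r) x) has_real_derivative - g x) (at t within {0..t}))"
    using g(1) by blast
qed

text \<open>Smoothness is only known for positive times. As \<open>t\<close> tends to 0, \<open>h t\<close> converges and its partial
  derivative converges uniformly, so the limit is differentiable along the line.\<close>

lemma initial_line_derivative:
  fixes h :: "real \<Rightarrow> real^'n \<Rightarrow> real"
  assumes T: "0 < T" and h: "regular_solution T h"
  shows "((\<lambda>r. h 0 (x + r *\<^sub>R axis i 1)) has_real_derivative partial i (h 0) x) (at 0)"
proof -
  let ?e = "axis i 1 :: real^'n"
  obtain L where L: "\<And>e. e > 0 \<Longrightarrow> \<exists>\<delta>>0. \<forall>\<tau>\<in>{0<..T}. \<tau> < \<delta> \<longrightarrow> (\<forall>x. \<bar>partial i (h \<tau>) x - L x\<bar> \<le> e)"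
    using uniform_limit_at_zero[OF T regular_solution_near_initial(3)[OF T h, where i = i]] by blast
  define t where "t n = T * inverse (real (Suc n))" for n
  have t: "t n \<in> {0<..T}" for n using T by (auto simp: t_def field_simps)
  have t0: "t \<longlonglongrightarrow> 0"
    unfolding t_def by (rule tendsto_mult_right_zero[OF LIMSEQ_inverse_real_of_nat])
  have conv: "(\<lambda>n. h (t n) y) \<longlonglongrightarrow> h 0 y" for y
  proof (rule LIMSEQ_I)
    fix e :: real assume "e > 0"
    then obtain \<delta> where \<delta>: "\<delta> > 0" "\<forall>\<tau>\<in>{0<..T}. \<tau> < \<delta> \<longrightarrow> (\<forall>x. \<bar>h \<tau> x - h 0 x\<bar> \<le> e / 2)"
      using regular_solution_near_initial(1)[OF T h, of "e / 2"] by auto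
    obtain N where "\<forall>n\<ge>N. t n < \<delta>"
      using order_tendstoD(2)[OF t0 \<delta>(1)] unfolding eventually_sequentially by blast
    then have "\<bar>h (t n) y - h 0 y\<bar> \<le> e / 2" if "n \<ge> N" for n using \<delta>(2) t that by blast
    then show "\<exists>N. \<forall>n\<ge>N. norm (h (t n) y - h 0 y) < e"
      using \<open>e > 0\<close> by (intro exI[of _ N]) fastforce
  qed
  have "\<exists>g. \<forall>r\<in>UNIV. (\<lambda>n. h (t n) (x + r *\<^sub>R ?e)) \<longlonglongrightarrow> g r \<and>
      (g has_derivative (\<lambda>k. k * L (x + r *\<^sub>R ?e))) (at r within UNIV)"
  proof (rule has_derivative_sequence[where f' = "\<lambda>n r k. k * partial i (h (t n)) (x + r *\<^sub>R ?e)" and ?x0.0 = 0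
        and l = "h 0 (x + 0 *\<^sub>R ?e)"])
    show "((\<lambda>r. h (t n) (x + r *\<^sub>R ?e)) has_derivative (\<lambda>k. k * partial i (h (t n)) (x + r *\<^sub>R ?e))) (at r within UNIV)"
      for n r
    proof -
      have "((\<lambda>s. h (t n) ((x + r *\<^sub>R ?e) + s *\<^sub>R ?e)) has_vector_derivative partial i (h (t n)) (x + r *\<^sub>R ?e)) (at 0)"
        using regular_solution_partials(1)[OF h t] by (simp add: has_real_derivative_iff_has_vector_derivative)
      from line_derivative_shift[OF this, of UNIV] show ?thesis
        by (simp add: has_vector_derivative_def)
    qed
    fix e :: real assume "e > 0"
    then obtain \<delta> where \<delta>: "\<delta> > 0" "\<forall>\<tau>\<in>{0<..T}. \<tau> < \<delta> \<longrightarrow> (\<forall>x. \<bar>partial i (h \<tau>) x - L x\<bar> \<le> e)"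
      using L by blast
    show "\<forall>\<^sub>F n in sequentially. \<forall>r\<in>UNIV. \<forall>k. norm (k * partial i (h (t n)) (x + r *\<^sub>R ?e) - k * L (x + r *\<^sub>R ?e)) \<le> e * norm k"
      using order_tendstoD(2)[OF t0 \<delta>(1)]
    proof eventually_elim
      case (elim n)
      show ?case
      proof (intro ballI allI)
        fix r k :: real
        have "\<bar>k\<bar> * \<bar>partial i (h (t n)) (x + r *\<^sub>R ?e) - L (x + r *\<^sub>R ?e)\<bar> \<le> \<bar>k\<bar> * e"
          using \<delta>(2) t elim by (intro mult_left_mono) auto
        then show "norm (k * partial i (h (t n)) (x + r *\<^sub>R ?e) - k * L (x + r *\<^sub>R ?e)) \<le> e * norm k"
          by (simp add: mult.commute flip: abs_mult right_diff_distrib)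
      qed
    qed
  qed (use conv in auto)
  then obtain g where g: "\<And>r. (\<lambda>n. h (t n) (x + r *\<^sub>R ?e)) \<longlonglongrightarrow> g r"
    "\<And>r. (g has_derivative (\<lambda>k. k * L (x + r *\<^sub>R ?e))) (at r)"
    by auto
  have "g = (\<lambda>r. h 0 (x + r *\<^sub>R ?e))"
    using LIMSEQ_unique[OF g(1) conv] by (rule ext)
  then have "((\<lambda>r. h 0 (x + r *\<^sub>R ?e)) has_derivative (\<lambda>k. k * L x)) (at 0)"
    using g(2)[of 0] by simp
  then have "((\<lambda>r. h 0 (x + r *\<^sub>R ?e)) has_real_derivative L x) (at 0)"
    by (simp add: has_field_derivative_def mult_commute_abs)
  moreover from this have "partial i (h 0) x = L x" unfolding partial_def by (rule DERIV_imp_deriv)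
  ultimately show ?thesis by simp
qed

text \<open>The difference quotients at time 0 converge uniformly in \<open>x\<close>, so \<open>\<delta>\<close> can be chosen independent of \<open>x\<close>.\<close>

lemma initial_time_derivative:
  fixes h :: "real \<Rightarrow> real^'n \<Rightarrow> real"
  assumes T: "0 < T" and h: "regular_solution T h" and e: "e > 0"
  obtains \<delta> where "\<delta> > 0"
    "\<And>\<tau> x. \<tau> \<in> {0<..T} \<Longrightarrow> \<tau> < \<delta> \<Longrightarrow> h \<tau> x \<le> h 0 x + (time_deriv T h 0 x + e) * \<tau>"
proof -
  obtain L where L: "\<And>e. e > 0 \<Longrightarrow> \<exists>\<delta>>0. \<forall>\<tau>\<in>{0<..T}. \<tau> < \<delta> \<longrightarrow> (\<forall>x. \<bar>(h \<tau> x - h 0 x) / \<tau> - L x\<bar> \<le> e)"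
    using uniform_limit_at_zero[OF T, of "\<lambda>\<tau> x. (h \<tau> x - h 0 x) / \<tau>"]
      regular_solution_near_initial(2)[OF T h] by blast
  have "((\<lambda>\<tau>. h \<tau> x) has_real_derivative L x) (at 0 within {0..T})" for x
    unfolding has_field_derivative_iff
  proof (rule tendstoI)
    fix e :: real assume "e > 0"
    then obtain \<delta> where \<delta>: "\<delta> > 0" "\<forall>\<tau>\<in>{0<..T}. \<tau> < \<delta> \<longrightarrow> (\<forall>x. \<bar>(h \<tau> x - h 0 x) / \<tau> - L x\<bar> \<le> e / 2)"
      using L[of "e / 2"] by auto
    have "dist ((h \<tau> x - h 0 x) / (\<tau> - 0)) (L x) < e" if "\<tau> \<in> {0..T}" "\<tau> \<noteq> 0" "dist \<tau> 0 < \<delta>" for \<tau>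
    proof -
      have "\<bar>(h \<tau> x - h 0 x) / \<tau> - L x\<bar> \<le> e / 2" using \<delta>(2) that by auto
      then show ?thesis using \<open>e > 0\<close> by (simp add: dist_real_def)
    qed
    then show "\<forall>\<^sub>F \<tau> in at 0 within {0..T}. dist ((h \<tau> x - h 0 x) / (\<tau> - 0)) (L x) < e"
      using \<delta>(1) unfolding eventually_at by blast
  qed
  moreover have "at 0 within {0..T} \<noteq> bot" using T by (simp add: trivial_limit_within)
  ultimately have "time_deriv T h 0 x = L x" for x
    unfolding time_deriv_def
    by (intro vector_derivative_within) (simp_all add: has_real_derivative_iff_has_vector_derivative)
  moreover obtain \<delta> where \<delta>: "\<delta> > 0" "\<forall>\<tau>\<in>{0<..T}. \<tau> < \<delta> \<longrightarrow> (\<forall>x. \<bar>(h \<tau> x - h 0 x) / \<tau> - L x\<bar> \<le> e)"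
    using L[OF e] by blast
  have "h \<tau> x \<le> h 0 x + (L x + e) * \<tau>" if \<tau>: "\<tau> \<in> {0<..T}" "\<tau> < \<delta>" for \<tau> x
  proof -
    have "\<bar>(h \<tau> x - h 0 x) / \<tau> - L x\<bar> \<le> e" using \<delta>(2) \<tau> by blast
    then have "(h \<tau> x - h 0 x) / \<tau> \<le> L x + e" by linarith
    then show ?thesis using \<tau>(1) by (simp add: divide_le_eq)
  qed
  ultimately show thesis using that[OF \<delta>(1)] by simp
qed

theorem theorem2p11:
  fixes h :: "real \<Rightarrow> real^'n \<Rightarrow> real"
    and D :: "(real \<Rightarrow> real^'n \<Rightarrow> real) \<Rightarrow> real \<Rightarrow> real^'n \<Rightarrow> real"
    and T M :: real
  assumes "0 < T" and "0 < M"
    and "regular_solution T h"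
    and "D \<in> insert (time_deriv T) (range space_deriv)"
    and "(SUP x. ereal (D h 0 x)) \<le> ereal M"
  shows "\<forall>t\<in>{0..T}. (SUP x. ereal (D h t x)) \<le> ereal M"
proof -
  note T = \<open>0 < T\<close> and h = \<open>regular_solution T h\<close>
  note classical = classical_solution_if_regular[OF T h]
  have init: "D h 0 x \<le> M" for x
    using assms(5) by (simp add: SUP_le_iff)
  have "D h t x \<le> M" if t: "t \<in> {0<..T}" for t x
  proof -
    consider "D = time_deriv T" | i where "D = space_deriv i" using assms(4) by auto
    then show ?thesis
    proof cases
      case 1
      have nontriv: "at t within {0..t} \<noteq> bot" using t by (simp add: trivial_limit_within)
      have left: "((\<lambda>\<tau>. h \<tau> x) has_real_derivative time_deriv T h t x) (at t within {0..t})"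
        using t by (intro has_field_derivative_subset[OF regular_solution_partials(4)[OF h t]]) auto
      have "time_deriv T h t x \<le> M + e" if "e > 0" for e
      proof (rule derivative_le_if_quotients_le[OF left nontriv])
        obtain \<delta> where \<delta>: "\<delta> > 0"
          "\<And>\<tau> x. \<tau> \<in> {0<..T} \<Longrightarrow> \<tau> < \<delta> \<Longrightarrow> h \<tau> x \<le> h 0 x + (time_deriv T h 0 x + e) * \<tau>"
          using initial_time_derivative[OF T h \<open>e > 0\<close>] by blast
        have "(h \<tau> x - h t x) / (\<tau> - t) \<le> M + e" if \<tau>: "\<tau> \<in> {0..t}" "\<tau> \<noteq> t" "dist \<tau> t < \<delta>" for \<tau>
        proof -
          \<comment> \<open>Compare the solution shifted by the remaining time \<open>r\<close> with the solution itself at time \<open>\<tau>\<close>.\<close>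
          define r where "r = t - \<tau>"
          have r: "r \<in> {0<..T}" "r < \<delta>" using \<tau> t by (auto simp: r_def dist_real_def)
          have "h r y \<le> h 0 y + (M + e) * r" for y
          proof -
            have "(time_deriv T h 0 y + e) * r \<le> (M + e) * r"
              using init[of y] 1 r by (intro mult_right_mono) auto
            then show ?thesis using \<delta>(2)[OF r, of y] by linarith
          qed
          have "(\<lambda>t. h (t + r)) \<tau> (x + 0) \<le> h \<tau> x + (M + e) * r"
          proof (rule comparison[where T = "T - r" and ?h1.0 = "\<lambda>t. h (t + r)" and ?h2.0 = h
                and p = 0 and r = 0 and i = undefined])
            show "classical_solution (T - r) (\<lambda>t. h (t + r))"
              by (rule classical_solution_time_shift[OF classical]) (use r in simp)
            show "classical_solution (T - r) h"
              by (rule classical_solution_restrict[OF classical]) (use r in simp)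
            show "h (0 + r) (y + 0) \<le> h 0 y + (M + e) * r" for y
              using \<open>\<And>y. h r y \<le> h 0 y + (M + e) * r\<close>[of y] by simp
            show "\<tau> \<in> {0..T - r}" using \<tau> t by (auto simp: r_def)
          qed auto
          then have "h t x - h \<tau> x \<le> (M + e) * (t - \<tau>)" by (simp add: r_def)
          then show ?thesis using \<tau> by (simp add: divide_le_eq algebra_simps)
        qed
        then show "\<forall>\<^sub>F \<tau> in at t within {0..t}. (h \<tau> x - h t x) / (\<tau> - t) \<le> M + e"
          using \<delta>(1) unfolding eventually_at by blast
      qed
      then have "time_deriv T h t x \<le> M" by (rule field_le_epsilon)
      then show ?thesis using 1 by simp
    next
      case 2
      let ?e = "axis i 1 :: real^'n"
      have init_shift: "h 0 (y + r *\<^sub>R ?e) \<le> h 0 y + M * r" if "0 \<le> r" for y r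
      proof -
        have "h 0 (y + r *\<^sub>R ?e) - M * r \<le> h 0 (y + 0 *\<^sub>R ?e) - M * 0"
        proof (rule DERIV_nonpos_imp_nonincreasing[OF that])
          fix s assume "0 \<le> s" "s \<le> r"
          have "((\<lambda>k. h 0 ((y + s *\<^sub>R ?e) + k *\<^sub>R ?e)) has_vector_derivative partial i (h 0) (y + s *\<^sub>R ?e)) (at 0)"
            using initial_line_derivative[OF T h] by (simp add: has_real_derivative_iff_has_vector_derivative)
          from line_derivative_shift[OF this, of UNIV]
          have "((\<lambda>k. h 0 (y + k *\<^sub>R ?e)) has_real_derivative partial i (h 0) (y + s *\<^sub>R ?e)) (at s)"
            by (simp add: has_real_derivative_iff_has_vector_derivative)
          then have "((\<lambda>k. h 0 (y + k *\<^sub>R ?e) - M * k) has_real_derivative partial i (h 0) (y + s *\<^sub>R ?e) - M) (at s)"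
            by (auto intro!: derivative_eq_intros)
          moreover have "partial i (h 0) (y + s *\<^sub>R ?e) - M \<le> 0"
            using init[of "y + s *\<^sub>R ?e"] 2 by (simp add: space_deriv_def)
          ultimately show "\<exists>d. ((\<lambda>k. h 0 (y + k *\<^sub>R ?e) - M * k) has_real_derivative d) (at s) \<and> d \<le> 0"
            by blast
        qed
        then show ?thesis by simp
      qed
      have "partial i (h t) x \<le> M"
      proof (rule derivative_le_if_quotients_le)
        show "((\<lambda>r. h t (x + r *\<^sub>R ?e)) has_real_derivative partial i (h t) x) (at 0 within {0..1})"
          by (rule has_field_derivative_at_within[OF regular_solution_partials(1)[OF h t]])
        show "at 0 within {0..1::real} \<noteq> bot" by (simp add: trivial_limit_within)
        have "(h t (x + r *\<^sub>R ?e) - h t (x + 0 *\<^sub>R ?e)) / (r - 0) \<le> M" if "r \<in> {0..1}" "r \<noteq> 0" for r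
        proof -
          have "r \<le> 2 * pi" using that pi_gt3 by auto
          have "h t (x + r *\<^sub>R ?e) \<le> h t x + M * r"
          proof (rule comparison[OF classical classical refl])
            show "0 \<le> r" "t \<in> {0..T}" using that t by auto
            from this(1) show "h 0 (y + r *\<^sub>R ?e) \<le> h 0 y + M * r" for y by (rule init_shift)
          qed (rule \<open>r \<le> 2 * pi\<close>)
          then show ?thesis using that by (simp add: divide_le_eq mult.commute)
        qed
        then show "\<forall>\<^sub>F r in at 0 within {0..1}. (h t (x + r *\<^sub>R ?e) - h t (x + 0 *\<^sub>R ?e)) / (r - 0) \<le> M"
          by (auto simp: eventually_at_filter)
      qed
      then show ?thesis using 2 by (simp add: space_deriv_def)
    qed
  qed
  then have "D h t x \<le> M" if "t \<in> {0..T}" for t x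
    using init that by (cases "t = 0") auto
  then show ?thesis by (simp add: SUP_le_iff)
qed

end
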